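(* Let $A$ and $B$ be weak bialgebras over a commutative ring $k$, and let $(\psi:A\otimes B\to B\otimes A,\ \phi:B\otimes A\to A\otimes B)$ be a weakly comonoidal mutually weak inverse pair of weak distributive laws. Let $B\otimes_\psi A$ denote the image of the idempotent map $\psi\phi:B\otimes A\to B\otimes A$, with corresponding epimorphism $p:B\otimes A\to B\otimes_\psi A$ and monomorphism $i:B\otimes_\psi A\to B\otimes A$ (so $ip=\psi\phi$ and $pi=\mathrm{id}$). Then the following hold. (1) $B\otimes_\psi A$ is an algebra via the weak wreath product construction, that is, with multiplication $p\,(\mu\otimes\mu)(B\otimes\psi\otimes A)(i\otimes i)$ and unit $p\,\psi\,(\eta\otimes\eta)$ (where $\eta\otimes\eta:k\to A\otimes B$). (2) $B\otimes_\psi A$ is a coalgebra via the comultiplication $(p\otimes p)\,\Delta_{B\otimes A}\,i$ and the counit $\epsilon_{B\otimes A}\,i$, defined in terms of the tensor product coalgebra $B\otimes A$. (3) The algebra in part (1) and the coalgebra in part (2) constitute a weak bialgebra.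
   Context: Throughout, $k$ is a commutative ring, $\otimes=\otimes_k$, algebras are associative unital $k$-algebras $(\mu,\eta)$, coalgebras are coassociative counital $k$-coalgebras $(\Delta,\epsilon)$, and the name of a module also denotes its identity map. Juxtaposition of maps is composition. Write $\Delta(a)=a_1\otimes a_2$ (summation understood). Weak bialgebra: a $k$-module $H$ with a $k$-algebra structure and a $k$-coalgebra structure such that for all $a,b,c\in H$: $\Delta(ab)=\Delta(a)\Delta(b)$; $(\Delta(1)\otimes 1)(1\otimes\Delta(1))=(\Delta\otimes H)\Delta(1)=(1\otimes\Delta(1))(\Delta(1)\otimes 1)$; $\epsilon(ab_1)\epsilon(b_2c)=\epsilon(abc)=\epsilon(ab_2)\epsilon(b_1c)$. Tensor product coalgebra: for coalgebras $A,B$, $A\otimes B$ is a coalgebra via $\Delta_{A\otimes B}(a\otimes b)=(a_1\otimes b_1)\otimes(a_2\otimes b_2)$ and $\epsilon_{A\otimes B}=\epsilon\otimes\epsilon$; symmetrically for $B\otimes A$. Weak distributive law: for algebras $A$ and $B$, a $k$-module map $\psi:A\otimes B\to B\otimes A$ such that $\psi(\mu\otimes B)=(B\otimes\mu)(\psi\otimes A)(A\otimes\psi)$, $\psi(A\otimes\mu)=(\mu\otimes A)(B\otimes\psi)(\psi\otimes B)$, $\psi(\eta\otimes B)=(\mu\otimes A)(B\otimes\psi)(B\otimes\eta\otimes\eta)$, $\psi(A\otimes\eta)=(B\otimes\mu)(\psi\otimes A)(\eta\otimes\eta\otimes A)$. A weak distributive law $\phi:B\otimes A\to A\otimes B$ is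 defined by the same conditions with the roles of $A$ and $B$ interchanged. Weak inverse: a weak distributive law $\phi:B\otimes A\to A\otimes B$ is the weak inverse of the weak distributive law $\psi:A\otimes B\to B\otimes A$ (and $(\psi,\phi)$ is a mutually weak inverse pair) if $\psi\phi=(\mu\otimes A)(B\otimes\psi)(B\otimes A\otimes\eta)$ and $\phi\psi=(\mu\otimes B)(A\otimes\phi)(A\otimes B\otimes\eta)$. (Then $\psi\phi\psi=\psi$ and $\phi\psi\phi=\phi$.) Weakly comonoidal: when $A$ and $B$ also carry coalgebra structures, a mutually weak inverse pair of weak distributive laws $(\psi,\phi)$ is weakly comonoidal if $(\psi\phi\otimes B\otimes A)\Delta_{B\otimes A}\psi=(\psi\otimes\psi)\Delta_{A\otimes B}=(B\otimes A\otimes\psi\phi)\Delta_{B\otimes A}\psi$, $(\phi\psi\otimes A\otimes B)\Delta_{A\otimes B}\phi=(\phi\otimes\phi)\Delta_{B\otimes A}=(A\otimes B\otimes\phi\psi)\Delta_{A\otimes B}\phi$, $\epsilon_{B\otimes A}\psi=\epsilon_{A\otimes B}\phi\psi$. *)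

theory Defs
  imports "HOL-Algebra.Module" "HOL-Algebra.AbelCoset"
begin

section \<open>Linear maps and tensor products of modules over a commutative ring\<close>

definition linear_map ::
  "('r, 'q) ring_scheme \<Rightarrow> ('r, 'a, 'm) module_scheme \<Rightarrow> ('r, 'b, 'n) module_scheme \<Rightarrow> ('a \<Rightarrow> 'b) \<Rightarrow> bool"
where
  "linear_map R M N f \<longleftrightarrow>
     f \<in> hom (add_monoid M) (add_monoid N) \<and>
     (\<forall>r\<in>carrier R. \<forall>x\<in>carrier M. f (r \<odot>\<^bsub>M\<^esub> x) = r \<odot>\<^bsub>N\<^esub> f x)"

definition regular_module :: "('r, 'q) ring_scheme \<Rightarrow> ('r, 'r) module" where
  "regular_module R =
     \<lparr>carrier = carrier R, mult = mult R, one = one R, zero = zero R, add = add R, smult = mult R\<rparr>"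

text \<open>In the next two records the fields \<open>mult\<close> and \<open>one\<close> carry no information: they are present
  only because \<open>module\<close> extends \<open>ring\<close>, and the locale \<open>module\<close> does not refer to them.\<close>

definition free_module :: "('r, 'q) ring_scheme \<Rightarrow> 'x set \<Rightarrow> ('r, 'x \<Rightarrow> 'r) module" where
  "free_module R S =
     \<lparr>carrier = {f. range f \<subseteq> carrier R \<and> finite {x. f x \<noteq> \<zero>\<^bsub>R\<^esub>} \<and> {x. f x \<noteq> \<zero>\<^bsub>R\<^esub>} \<subseteq> S},
      mult = undefined, one = undefined,
      zero = (\<lambda>x. \<zero>\<^bsub>R\<^esub>),
      add = (\<lambda>f g x. f x \<oplus>\<^bsub>R\<^esub> g x),
      smult = (\<lambda>r f x. r \<otimes>\<^bsub>R\<^esub> f x)\<rparr>"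

definition quotient_module ::
  "('r, 'a, 'm) module_scheme \<Rightarrow> 'a set \<Rightarrow> ('r, 'a set) module"
where
  "quotient_module M N =
     \<lparr>carrier = a_rcosets\<^bsub>M\<^esub> N,
      mult = undefined, one = undefined,
      zero = N,
      add = (\<lambda>X Y. X <+>\<^bsub>M\<^esub> Y),
      smult = (\<lambda>r X. \<Union>x\<in>X. N +>\<^bsub>M\<^esub> (r \<odot>\<^bsub>M\<^esub> x))\<rparr>"

definition submodule_generated ::
  "('r, 'q) ring_scheme \<Rightarrow> ('r, 'a, 'm) module_scheme \<Rightarrow> 'a set \<Rightarrow> 'a set"
where
  "submodule_generated R M G = \<Inter>{N. submodule N R M \<and> G \<subseteq> N}"

definition single :: "('r, 'q) ring_scheme \<Rightarrow> 'x \<Rightarrow> 'x \<Rightarrow> 'r" where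
  "single R x = (\<lambda>y. if y = x then \<one>\<^bsub>R\<^esub> else \<zero>\<^bsub>R\<^esub>)"

definition tensor_relators ::
  "('r, 'q) ring_scheme \<Rightarrow> ('r, 'a, 'm) module_scheme \<Rightarrow> ('r, 'b, 'n) module_scheme
    \<Rightarrow> ('a \<times> 'b \<Rightarrow> 'r) set"
where
  "tensor_relators R A B =
     (let F = free_module R (carrier A \<times> carrier B) in
       {single R (a \<oplus>\<^bsub>A\<^esub> a', b) \<ominus>\<^bsub>F\<^esub> (single R (a, b) \<oplus>\<^bsub>F\<^esub> single R (a', b)) | a a' b.
          a \<in> carrier A \<and> a' \<in> carrier A \<and> b \<in> carrier B} \<union>
       {single R (a, b \<oplus>\<^bsub>B\<^esub> b') \<ominus>\<^bsub>F\<^esub> (single R (a, b) \<oplus>\<^bsub>F\<^esub> single R (a, b')) | a b b'.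
          a \<in> carrier A \<and> b \<in> carrier B \<and> b' \<in> carrier B} \<union>
       {single R (r \<odot>\<^bsub>A\<^esub> a, b) \<ominus>\<^bsub>F\<^esub> r \<odot>\<^bsub>F\<^esub> single R (a, b) | r a b.
          r \<in> carrier R \<and> a \<in> carrier A \<and> b \<in> carrier B} \<union>
       {single R (a, r \<odot>\<^bsub>B\<^esub> b) \<ominus>\<^bsub>F\<^esub> r \<odot>\<^bsub>F\<^esub> single R (a, b) | r a b.
          r \<in> carrier R \<and> a \<in> carrier A \<and> b \<in> carrier B})"

definition tensor_null ::
  "('r, 'q) ring_scheme \<Rightarrow> ('r, 'a, 'm) module_scheme \<Rightarrow> ('r, 'b, 'n) module_scheme
    \<Rightarrow> ('a \<times> 'b \<Rightarrow> 'r) set"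
where
  "tensor_null R A B =
     submodule_generated R (free_module R (carrier A \<times> carrier B)) (tensor_relators R A B)"

type_synonym ('r, 'a, 'b) tens = "('a \<times> 'b \<Rightarrow> 'r) set"

definition tensor ::
  "('r, 'q) ring_scheme \<Rightarrow> ('r, 'a, 'm) module_scheme \<Rightarrow> ('r, 'b, 'n) module_scheme
    \<Rightarrow> ('r, ('r, 'a, 'b) tens) module"
where
  "tensor R A B = quotient_module (free_module R (carrier A \<times> carrier B)) (tensor_null R A B)"

definition pure ::
  "('r, 'q) ring_scheme \<Rightarrow> ('r, 'a, 'm) module_scheme \<Rightarrow> ('r, 'b, 'n) module_scheme
    \<Rightarrow> 'a \<Rightarrow> 'b \<Rightarrow> ('r, 'a, 'b) tens"
where
  "pure R A B a b =
     tensor_null R A B +>\<^bsub>free_module R (carrier A \<times> carrier B)\<^esub> single R (a, b)"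

text \<open>The linear map on a tensor product induced by a bilinear map \<open>f\<close> into \<open>M\<close>: it is evaluated on
  a representing formal linear combination, whose choice is immaterial when \<open>f\<close> is bilinear.\<close>

definition tensor_lift ::
  "('r, 'q) ring_scheme \<Rightarrow> ('r, 'c, 'm) module_scheme \<Rightarrow> ('a \<Rightarrow> 'b \<Rightarrow> 'c) \<Rightarrow> ('r, 'a, 'b) tens \<Rightarrow> 'c"
where
  "tensor_lift R M f X =
     (let c = (SOME c. c \<in> X) in
       \<Oplus>\<^bsub>M\<^esub> p \<in> {p. c p \<noteq> \<zero>\<^bsub>R\<^esub>}. c p \<odot>\<^bsub>M\<^esub> f (fst p) (snd p))"

text \<open>\<open>tensor_map R C D f g\<close> is \<open>f \<otimes> g\<close>, where \<open>C\<close> and \<open>D\<close> are the codomains of \<open>f\<close> and \<open>g\<close>.\<close>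

definition tensor_map ::
  "('r, 'q) ring_scheme \<Rightarrow> ('r, 'c, 'm) module_scheme \<Rightarrow> ('r, 'd, 'n) module_scheme
    \<Rightarrow> ('a \<Rightarrow> 'c) \<Rightarrow> ('b \<Rightarrow> 'd) \<Rightarrow> ('r, 'a, 'b) tens \<Rightarrow> ('r, 'c, 'd) tens"
where
  "tensor_map R C D f g = tensor_lift R (tensor R C D) (\<lambda>a b. pure R C D (f a) (g b))"

text \<open>\<open>assoc R A B C: (A \<otimes> B) \<otimes> C \<rightarrow> A \<otimes> (B \<otimes> C)\<close> and its inverse \<open>assoc_inv\<close>.\<close>

definition assoc ::
  "('r, 'q) ring_scheme \<Rightarrow> ('r, 'a, 'm) module_scheme \<Rightarrow> ('r, 'b, 'n) module_scheme
    \<Rightarrow> ('r, 'c, 'o) module_scheme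
    \<Rightarrow> ('r, ('r, 'a, 'b) tens, 'c) tens \<Rightarrow> ('r, 'a, ('r, 'b, 'c) tens) tens"
where
  "assoc R A B C =
     (let T = tensor R A (tensor R B C) in
       tensor_lift R T (\<lambda>x c. tensor_lift R T (\<lambda>a b. pure R A (tensor R B C) a (pure R B C b c)) x))"

definition assoc_inv ::
  "('r, 'q) ring_scheme \<Rightarrow> ('r, 'a, 'm) module_scheme \<Rightarrow> ('r, 'b, 'n) module_scheme
    \<Rightarrow> ('r, 'c, 'o) module_scheme
    \<Rightarrow> ('r, 'a, ('r, 'b, 'c) tens) tens \<Rightarrow> ('r, ('r, 'a, 'b) tens, 'c) tens"
where
  "assoc_inv R A B C =
     (let T = tensor R (tensor R A B) C in
       tensor_lift R T (\<lambda>a y. tensor_lift R T (\<lambda>b c. pure R (tensor R A B) C (pure R A B a b) c) y))"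

definition twist ::
  "('r, 'q) ring_scheme \<Rightarrow> ('r, 'a, 'm) module_scheme \<Rightarrow> ('r, 'b, 'n) module_scheme
    \<Rightarrow> ('r, 'a, 'b) tens \<Rightarrow> ('r, 'b, 'a) tens"
where
  "twist R A B = tensor_lift R (tensor R B A) (\<lambda>a b. pure R B A b a)"

definition lunit ::
  "('r, 'q) ring_scheme \<Rightarrow> ('r, 'a, 'm) module_scheme \<Rightarrow> ('r, 'r, 'a) tens \<Rightarrow> 'a"
where
  "lunit R M = tensor_lift R M (\<lambda>r x. r \<odot>\<^bsub>M\<^esub> x)"

definition runit ::
  "('r, 'q) ring_scheme \<Rightarrow> ('r, 'a, 'm) module_scheme \<Rightarrow> ('r, 'a, 'r) tens \<Rightarrow> 'a"
where
  "runit R M = tensor_lift R M (\<lambda>x r. r \<odot>\<^bsub>M\<^esub> x)"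

text \<open>For \<open>f: B \<otimes> C \<rightarrow> E \<otimes> F\<close>, the map
  \<open>A \<otimes> f \<otimes> D: (A \<otimes> B) \<otimes> (C \<otimes> D) \<rightarrow> (A \<otimes> E) \<otimes> (F \<otimes> D)\<close>.\<close>

definition middle_map ::
  "('r, 'q) ring_scheme \<Rightarrow> ('r, 'a, 'm1) module_scheme \<Rightarrow> ('r, 'b, 'm2) module_scheme
    \<Rightarrow> ('r, 'c, 'm3) module_scheme \<Rightarrow> ('r, 'd, 'm4) module_scheme
    \<Rightarrow> ('r, 'e, 'm5) module_scheme \<Rightarrow> ('r, 'f, 'm6) module_scheme
    \<Rightarrow> (('r, 'b, 'c) tens \<Rightarrow> ('r, 'e, 'f) tens)
    \<Rightarrow> ('r, ('r, 'a, 'b) tens, ('r, 'c, 'd) tens) tens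
    \<Rightarrow> ('r, ('r, 'a, 'e) tens, ('r, 'f, 'd) tens) tens"
where
  "middle_map R A B C D E F f =
     assoc_inv R A E (tensor R F D) \<circ>
     tensor_map R A (tensor R E (tensor R F D)) id
       (assoc R E F D \<circ> tensor_map R (tensor R E F) D f id \<circ> assoc_inv R B C D) \<circ>
     assoc R A B (tensor R C D)"


section \<open>Algebras, coalgebras and weak bialgebras\<close>

locale assoc_algebra = module R A + A: ring A for R (structure) and A (structure) +
  assumes smult_mult_left:
      "\<lbrakk>r \<in> carrier R; x \<in> carrier A; y \<in> carrier A\<rbrakk>
        \<Longrightarrow> (r \<odot>\<^bsub>A\<^esub> x) \<otimes>\<^bsub>A\<^esub> y = r \<odot>\<^bsub>A\<^esub> (x \<otimes>\<^bsub>A\<^esub> y)"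
    and smult_mult_right:
      "\<lbrakk>r \<in> carrier R; x \<in> carrier A; y \<in> carrier A\<rbrakk>
        \<Longrightarrow> x \<otimes>\<^bsub>A\<^esub> (r \<odot>\<^bsub>A\<^esub> y) = r \<odot>\<^bsub>A\<^esub> (x \<otimes>\<^bsub>A\<^esub> y)"

definition mult_map ::
  "('r, 'q) ring_scheme \<Rightarrow> ('r, 'a, 'm) module_scheme \<Rightarrow> ('r, 'a, 'a) tens \<Rightarrow> 'a"
where
  "mult_map R A = tensor_lift R A (\<lambda>x y. x \<otimes>\<^bsub>A\<^esub> y)"

definition tensor_algebra ::
  "('r, 'q) ring_scheme \<Rightarrow> ('r, 'a, 'm) module_scheme \<Rightarrow> ('r, 'b, 'n) module_scheme
    \<Rightarrow> ('r, ('r, 'a, 'b) tens) module"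
where
  "tensor_algebra R A B =
     (tensor R A B)
       \<lparr>mult := (\<lambda>x y.
          (tensor_map R A B (mult_map R A) (mult_map R B) \<circ>
           middle_map R A B A B A B (twist R B A))
            (pure R (tensor R A B) (tensor R A B) x y)),
        one := pure R A B \<one>\<^bsub>A\<^esub> \<one>\<^bsub>B\<^esub>\<rparr>"

record ('r, 'a) bialgebra_data = "('r, 'a) module" +
  comult :: "'a \<Rightarrow> ('r, 'a, 'a) tens"
  counit :: "'a \<Rightarrow> 'r"

locale coalgebra = module R C for R (structure) and C (structure) +
  assumes comult_linear: "linear_map R C (tensor R C C) (comult C)"
    and counit_linear: "linear_map R C (regular_module R) (counit C)"
    and coassoc: "x \<in> carrier C \<Longrightarrow>
      (assoc R C C C \<circ> tensor_map R (tensor R C C) C (comult C) id) (comult C x) =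
      tensor_map R C (tensor R C C) id (comult C) (comult C x)"
    and counit_left: "x \<in> carrier C \<Longrightarrow>
      (lunit R C \<circ> tensor_map R (regular_module R) C (counit C) id) (comult C x) = x"
    and counit_right: "x \<in> carrier C \<Longrightarrow>
      (runit R C \<circ> tensor_map R C (regular_module R) id (counit C)) (comult C x) = x"

text \<open>In \<open>comult_one_left\<close> and \<open>comult_one_right\<close> the threefold tensor power is bracketed to the
  left. The maps \<open>b \<otimes> b' \<mapsto> \<epsilon>(ab)\<epsilon>(b'c)\<close> and \<open>b \<otimes> b' \<mapsto> \<epsilon>(ab')\<epsilon>(bc)\<close> applied to \<open>\<Delta>(b)\<close> give the
  Sweedler expressions \<open>\<epsilon>(ab\<^sub>1)\<epsilon>(b\<^sub>2c)\<close> and \<open>\<epsilon>(ab\<^sub>2)\<epsilon>(b\<^sub>1c)\<close>.\<close>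

locale weak_bialgebra = assoc_algebra R H + coalgebra R H
  for R (structure) and H (structure) +
  assumes comult_mult: "\<lbrakk>a \<in> carrier H; b \<in> carrier H\<rbrakk> \<Longrightarrow>
      comult H (a \<otimes>\<^bsub>H\<^esub> b) = comult H a \<otimes>\<^bsub>tensor_algebra R H H\<^esub> comult H b"
    and comult_one_left:
      "pure R (tensor R H H) H (comult H \<one>\<^bsub>H\<^esub>) \<one>\<^bsub>H\<^esub>
         \<otimes>\<^bsub>tensor_algebra R (tensor_algebra R H H) H\<^esub>
       assoc_inv R H H H (pure R H (tensor R H H) \<one>\<^bsub>H\<^esub> (comult H \<one>\<^bsub>H\<^esub>)) =
       tensor_map R (tensor R H H) H (comult H) id (comult H \<one>\<^bsub>H\<^esub>)"
    and comult_one_right: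
      "assoc_inv R H H H (pure R H (tensor R H H) \<one>\<^bsub>H\<^esub> (comult H \<one>\<^bsub>H\<^esub>))
         \<otimes>\<^bsub>tensor_algebra R (tensor_algebra R H H) H\<^esub>
       pure R (tensor R H H) H (comult H \<one>\<^bsub>H\<^esub>) \<one>\<^bsub>H\<^esub> =
       tensor_map R (tensor R H H) H (comult H) id (comult H \<one>\<^bsub>H\<^esub>)"
    and counit_mult_12: "\<lbrakk>a \<in> carrier H; b \<in> carrier H; c \<in> carrier H\<rbrakk> \<Longrightarrow>
      tensor_lift R (regular_module R)
        (\<lambda>u v. counit H (a \<otimes>\<^bsub>H\<^esub> u) \<otimes>\<^bsub>R\<^esub> counit H (v \<otimes>\<^bsub>H\<^esub> c)) (comult H b) =
      counit H (a \<otimes>\<^bsub>H\<^esub> b \<otimes>\<^bsub>H\<^esub> c)"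
    and counit_mult_21: "\<lbrakk>a \<in> carrier H; b \<in> carrier H; c \<in> carrier H\<rbrakk> \<Longrightarrow>
      tensor_lift R (regular_module R)
        (\<lambda>u v. counit H (a \<otimes>\<^bsub>H\<^esub> v) \<otimes>\<^bsub>R\<^esub> counit H (u \<otimes>\<^bsub>H\<^esub> c)) (comult H b) =
      counit H (a \<otimes>\<^bsub>H\<^esub> b \<otimes>\<^bsub>H\<^esub> c)"

definition tensor_comult ::
  "('r, 'q) ring_scheme \<Rightarrow> ('r, 'a, 'm) bialgebra_data_scheme \<Rightarrow> ('r, 'b, 'n) bialgebra_data_scheme
    \<Rightarrow> ('r, 'a, 'b) tens \<Rightarrow> ('r, ('r, 'a, 'b) tens, ('r, 'a, 'b) tens) tens"
where
  "tensor_comult R A B =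
     middle_map R A A B B B A (twist R A B) \<circ>
     tensor_map R (tensor R A A) (tensor R B B) (comult A) (comult B)"

definition tensor_counit ::
  "('r, 'q) ring_scheme \<Rightarrow> ('r, 'a, 'm) bialgebra_data_scheme \<Rightarrow> ('r, 'b, 'n) bialgebra_data_scheme
    \<Rightarrow> ('r, 'a, 'b) tens \<Rightarrow> 'r"
where
  "tensor_counit R A B =
     lunit R (regular_module R) \<circ>
     tensor_map R (regular_module R) (regular_module R) (counit A) (counit B)"


section \<open>Weak distributive laws\<close>

text \<open>Associators are made explicit in the four axioms. In the last two,
  the identifications \<open>k \<otimes> B \<cong> B\<close> and \<open>A \<otimes> k \<cong> A\<close> are used: \<open>\<eta> \<otimes> B\<close> is \<open>b \<mapsto> 1 \<otimes> b\<close>,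
  \<open>B \<otimes> \<eta> \<otimes> \<eta>\<close> is \<open>b \<mapsto> b \<otimes> (1 \<otimes> 1)\<close>, and so on.\<close>

definition weak_distributive_law ::
  "('r, 'q) ring_scheme \<Rightarrow> ('r, 'a, 'm) module_scheme \<Rightarrow> ('r, 'b, 'n) module_scheme
    \<Rightarrow> (('r, 'a, 'b) tens \<Rightarrow> ('r, 'b, 'a) tens) \<Rightarrow> bool"
where
  "weak_distributive_law R A B \<psi> \<longleftrightarrow>
     linear_map R (tensor R A B) (tensor R B A) \<psi> \<and>
     (\<forall>x\<in>carrier (tensor R (tensor R A A) B).
        (\<psi> \<circ> tensor_map R A B (mult_map R A) id) x =
        (tensor_map R B A id (mult_map R A) \<circ> assoc R B A A \<circ>
         tensor_map R (tensor R B A) A \<psi> id \<circ> assoc_inv R A B A \<circ>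
         tensor_map R A (tensor R B A) id \<psi> \<circ> assoc R A A B) x) \<and>
     (\<forall>x\<in>carrier (tensor R A (tensor R B B)).
        (\<psi> \<circ> tensor_map R A B id (mult_map R B)) x =
        (tensor_map R B A (mult_map R B) id \<circ> assoc_inv R B B A \<circ>
         tensor_map R B (tensor R B A) id \<psi> \<circ> assoc R B A B \<circ>
         tensor_map R (tensor R B A) B \<psi> id \<circ> assoc_inv R A B B) x) \<and>
     (\<forall>b\<in>carrier B.
        \<psi> (pure R A B \<one>\<^bsub>A\<^esub> b) =
        (tensor_map R B A (mult_map R B) id \<circ> assoc_inv R B B A \<circ>
         tensor_map R B (tensor R B A) id \<psi>)
          (pure R B (tensor R A B) b (pure R A B \<one>\<^bsub>A\<^esub> \<one>\<^bsub>B\<^esub>))) \<and>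
     (\<forall>a\<in>carrier A.
        \<psi> (pure R A B a \<one>\<^bsub>B\<^esub>) =
        (tensor_map R B A id (mult_map R A) \<circ> assoc R B A A \<circ>
         tensor_map R (tensor R B A) A \<psi> id)
          (pure R (tensor R A B) A (pure R A B \<one>\<^bsub>A\<^esub> \<one>\<^bsub>B\<^esub>) a))"

definition mutually_weak_inverse ::
  "('r, 'q) ring_scheme \<Rightarrow> ('r, 'a, 'm) module_scheme \<Rightarrow> ('r, 'b, 'n) module_scheme
    \<Rightarrow> (('r, 'a, 'b) tens \<Rightarrow> ('r, 'b, 'a) tens) \<Rightarrow> (('r, 'b, 'a) tens \<Rightarrow> ('r, 'a, 'b) tens) \<Rightarrow> bool"
where
  "mutually_weak_inverse R A B \<psi> \<phi> \<longleftrightarrow>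
     weak_distributive_law R A B \<psi> \<and>
     weak_distributive_law R B A \<phi> \<and>
     (\<forall>x\<in>carrier (tensor R B A).
        (\<psi> \<circ> \<phi>) x =
        (tensor_map R B A (mult_map R B) id \<circ> assoc_inv R B B A \<circ>
         tensor_map R B (tensor R B A) id \<psi> \<circ> assoc R B A B)
          (pure R (tensor R B A) B x \<one>\<^bsub>B\<^esub>)) \<and>
     (\<forall>x\<in>carrier (tensor R A B).
        (\<phi> \<circ> \<psi>) x =
        (tensor_map R A B (mult_map R A) id \<circ> assoc_inv R A A B \<circ>
         tensor_map R A (tensor R A B) id \<phi> \<circ> assoc R A B A)
          (pure R (tensor R A B) A x \<one>\<^bsub>A\<^esub>))"

definition weakly_comonoidal ::
  "('r, 'q) ring_scheme \<Rightarrow> ('r, 'a, 'm) bialgebra_data_scheme \<Rightarrow> ('r, 'b, 'n) bialgebra_data_scheme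
    \<Rightarrow> (('r, 'a, 'b) tens \<Rightarrow> ('r, 'b, 'a) tens) \<Rightarrow> (('r, 'b, 'a) tens \<Rightarrow> ('r, 'a, 'b) tens) \<Rightarrow> bool"
where
  "weakly_comonoidal R A B \<psi> \<phi> \<longleftrightarrow>
     (\<forall>x\<in>carrier (tensor R A B).
        (tensor_map R (tensor R B A) (tensor R B A) (\<psi> \<circ> \<phi>) id \<circ> tensor_comult R B A \<circ> \<psi>) x =
        (tensor_map R (tensor R B A) (tensor R B A) \<psi> \<psi> \<circ> tensor_comult R A B) x \<and>
        (tensor_map R (tensor R B A) (tensor R B A) \<psi> \<psi> \<circ> tensor_comult R A B) x =
        (tensor_map R (tensor R B A) (tensor R B A) id (\<psi> \<circ> \<phi>) \<circ> tensor_comult R B A \<circ> \<psi>) x) \<and>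
     (\<forall>x\<in>carrier (tensor R B A).
        (tensor_map R (tensor R A B) (tensor R A B) (\<phi> \<circ> \<psi>) id \<circ> tensor_comult R A B \<circ> \<phi>) x =
        (tensor_map R (tensor R A B) (tensor R A B) \<phi> \<phi> \<circ> tensor_comult R B A) x \<and>
        (tensor_map R (tensor R A B) (tensor R A B) \<phi> \<phi> \<circ> tensor_comult R B A) x =
        (tensor_map R (tensor R A B) (tensor R A B) id (\<phi> \<circ> \<psi>) \<circ> tensor_comult R A B \<circ> \<phi>) x) \<and>
     (\<forall>x\<in>carrier (tensor R A B).
        (tensor_counit R B A \<circ> \<psi>) x = (tensor_counit R A B \<circ> \<phi> \<circ> \<psi>) x)"


section \<open>The weak wreath product\<close>

definition image_module ::
  "('r, 'a, 'm) module_scheme \<Rightarrow> ('a \<Rightarrow> 'a) \<Rightarrow> ('r, 'a, 'm) module_scheme"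
where
  "image_module M e = M\<lparr>carrier := e ` carrier M\<rparr>"

text \<open>For linear maps \<open>p: B \<otimes> A \<rightarrow> W\<close> and \<open>i: W \<rightarrow> B \<otimes> A\<close>, the module \<open>W\<close> with the multiplication
  \<open>p (\<mu> \<otimes> \<mu>) (B \<otimes> \<psi> \<otimes> A) (i \<otimes> i)\<close>, the unit \<open>p \<psi> (\<eta> \<otimes> \<eta>)\<close>, the comultiplication
  \<open>(p \<otimes> p) \<Delta> i\<close> and the counit \<open>\<epsilon> i\<close>, where \<open>\<Delta>\<close> and \<open>\<epsilon>\<close> are those of \<open>B \<otimes> A\<close>.\<close>

definition wreath_along ::
  "('r, 'q) ring_scheme \<Rightarrow> ('r, 'a, 'm) bialgebra_data_scheme \<Rightarrow> ('r, 'b, 'n) bialgebra_data_scheme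
    \<Rightarrow> (('r, 'a, 'b) tens \<Rightarrow> ('r, 'b, 'a) tens)
    \<Rightarrow> ('r, 'w, 'o) module_scheme \<Rightarrow> (('r, 'b, 'a) tens \<Rightarrow> 'w) \<Rightarrow> ('w \<Rightarrow> ('r, 'b, 'a) tens)
    \<Rightarrow> ('r, 'w) bialgebra_data"
where
  "wreath_along R A B \<psi> W p i =
     \<lparr>carrier = carrier W,
      mult = (\<lambda>x y.
        (p \<circ> tensor_map R B A (mult_map R B) (mult_map R A) \<circ>
         middle_map R B A B A B A \<psi> \<circ>
         tensor_map R (tensor R B A) (tensor R B A) i i) (pure R W W x y)),
      one = p (\<psi> (pure R A B \<one>\<^bsub>A\<^esub> \<one>\<^bsub>B\<^esub>)),
      zero = zero W,
      add = add W,
      smult = smult W,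
      comult = tensor_map R W W p p \<circ> tensor_comult R B A \<circ> i,
      counit = tensor_counit R B A \<circ> i\<rparr>"

text \<open>Here \<open>W\<close> is the image of \<open>\<psi>\<phi>\<close>, \<open>p\<close> is \<open>\<psi>\<phi>\<close> with codomain restricted to \<open>W\<close>, and \<open>i\<close> is the
  inclusion.\<close>

definition weak_wreath_product ::
  "('r, 'q) ring_scheme \<Rightarrow> ('r, 'a, 'm) bialgebra_data_scheme \<Rightarrow> ('r, 'b, 'n) bialgebra_data_scheme
    \<Rightarrow> (('r, 'a, 'b) tens \<Rightarrow> ('r, 'b, 'a) tens) \<Rightarrow> (('r, 'b, 'a) tens \<Rightarrow> ('r, 'a, 'b) tens)
    \<Rightarrow> ('r, ('r, 'b, 'a) tens) bialgebra_data"
where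
  "weak_wreath_product R A B \<psi> \<phi> =
     wreath_along R A B \<psi> (image_module (tensor R B A) (\<psi> \<circ> \<phi>)) (\<psi> \<circ> \<phi>) id"

end

theory Submission
  imports Defs
begin

text \<open>On \<open>B \<otimes> A\<close> the product \<open>(b \<otimes> a)(b' \<otimes> a') = b \<psi>(a \<otimes> b') a'\<close> is associative, and \<open>\<psi>\<phi>\<close> is
  multiplication by \<open>1 \<otimes> 1\<close>, so its image \<open>H\<close> is an algebra with unit \<open>\<psi>(1 \<otimes> 1)\<close>. The maps
  \<open>i\<^sub>A(a) = \<psi>(a \<otimes> 1)\<close> and \<open>i\<^sub>B(b) = \<psi>(1 \<otimes> b)\<close> are algebra homomorphisms into \<open>H\<close> with
  \<open>i\<^sub>A(a) i\<^sub>B(b) = \<psi>(a \<otimes> b)\<close> and \<open>i\<^sub>B(b) i\<^sub>A(a) = \<psi>\<phi>(b \<otimes> a)\<close>. Weak comonoidality gives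
  \<open>\<Delta>(i\<^sub>A(a) i\<^sub>B(b)) = (i\<^sub>A \<otimes> i\<^sub>A)\<Delta>(a) \<cdot> (i\<^sub>B \<otimes> i\<^sub>B)\<Delta>(b)\<close> and
  \<open>\<Delta>(i\<^sub>B(b) i\<^sub>A(a)) = (i\<^sub>B \<otimes> i\<^sub>B)\<Delta>(b) \<cdot> (i\<^sub>A \<otimes> i\<^sub>A)\<Delta>(a)\<close>, whence \<open>\<Delta>\<close> is coassociative and multiplicative.
  In particular \<open>(i\<^sub>A \<otimes> i\<^sub>A)\<Delta>(1)\<close> commutes with \<open>(i\<^sub>B \<otimes> i\<^sub>B)\<Delta>(b)\<close>, which reduces the axioms on \<open>\<Delta>(1)\<close>
  to those of \<open>A\<close> and \<open>B\<close>. For the counit, the functional \<open>\<epsilon>(x y\<^sub>1) \<epsilon>(y\<^sub>2 z)\<close> is shown to be balanced: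
  factors \<open>i\<^sub>A(a)\<close> and \<open>i\<^sub>B(b)\<close> of \<open>y\<close> can be moved into \<open>x\<close> or into \<open>z\<close>. Hence it depends only on
  \<open>x y z\<close>, and for \<open>x = z = 1\<close> it is \<open>\<epsilon>(y)\<close>.\<close>

section \<open>Linear and bilinear maps\<close>

text \<open>The delicate point is why factors can be moved in the counit functional. In a weak
  bialgebra K, a factor crosses \<Delta>(h) as soon as one leg is read by a functional g with g(y) =
  \<open>g(1\<^sub>1) \<epsilon>(1\<^sub>2 y)\<close> or a mirror form of this law. The functionals
  y \<mapsto> \<epsilon>(a y) and y \<mapsto> \<epsilon>(y a) obey such laws by the counit axiom
  with middle argument 1, and the laws are linear in g. They therefore pass to the counit of a
  tensor product M \<otimes> K evaluated after y has acted on the leg in K. For H this covers right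
  multiplication by \<open>i\<^sub>A(y)\<close> and left multiplication by
  \<open>i\<^sub>B(y)\<close>, which act on the outer legs of B \<otimes> A. The other two
  multiplications reach an inner leg, where \<psi> interferes; under \<phi> they become actions on
  the outer legs of A \<otimes> B, and the relation between the two counits keeps the values.
  Elsewhere the recurring obstacle is that \<psi>(a \<otimes> b) and \<Delta>(a) are in general not
  pure: auxiliary identities are stated for arbitrary tensors and reduced to pure ones by
  linearity.\<close>

lemma linear_mapI:
  assumes "\<And>x. x \<in> carrier M \<Longrightarrow> f x \<in> carrier N"
    and "\<And>x y. \<lbrakk>x \<in> carrier M; y \<in> carrier M\<rbrakk> \<Longrightarrow> f (x \<oplus>\<^bsub>M\<^esub> y) = f x \<oplus>\<^bsub>N\<^esub> f y"
    and "\<And>r x. \<lbrakk>r \<in> carrier R; x \<in> carrier M\<rbrakk> \<Longrightarrow> f (r \<odot>\<^bsub>M\<^esub> x) = r \<odot>\<^bsub>N\<^esub> f x"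
  shows "linear_map R M N f"
  using assms by (auto simp: linear_map_def hom_def)

lemma linear_map_closed: "\<lbrakk>linear_map R M N f; x \<in> carrier M\<rbrakk> \<Longrightarrow> f x \<in> carrier N"
  by (auto simp: linear_map_def hom_def)

lemma linear_map_add:
  "\<lbrakk>linear_map R M N f; x \<in> carrier M; y \<in> carrier M\<rbrakk> \<Longrightarrow> f (x \<oplus>\<^bsub>M\<^esub> y) = f x \<oplus>\<^bsub>N\<^esub> f y"
  by (auto simp: linear_map_def hom_def)

lemma linear_map_smult:
  "\<lbrakk>linear_map R M N f; r \<in> carrier R; x \<in> carrier M\<rbrakk> \<Longrightarrow> f (r \<odot>\<^bsub>M\<^esub> x) = r \<odot>\<^bsub>N\<^esub> f x"
  by (auto simp: linear_map_def)

lemma linear_map_zero: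
  assumes "module R M" "module R N" "linear_map R M N f"
  shows "f \<zero>\<^bsub>M\<^esub> = \<zero>\<^bsub>N\<^esub>"
proof -
  interpret M: module R M by fact
  interpret N: module R N by fact
  have "f (\<zero>\<^bsub>R\<^esub> \<odot>\<^bsub>M\<^esub> \<zero>\<^bsub>M\<^esub>) = \<zero>\<^bsub>R\<^esub> \<odot>\<^bsub>N\<^esub> f \<zero>\<^bsub>M\<^esub>"
    using assms(3) by (rule linear_map_smult) simp_all
  then show ?thesis
    using linear_map_closed[OF assms(3)] by simp
qed

lemma linear_map_id: "linear_map R M M id" "linear_map R M M (\<lambda>x. x)"
  by (auto intro: linear_mapI)

lemma linear_map_comp:
  assumes "linear_map R M N f" "linear_map R N P g"
  shows "linear_map R M P (g \<circ> f)"
  using assms by (auto intro!: linear_mapI simp: linear_map_closed linear_map_add linear_map_smult)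

lemma linear_map_compose:
  assumes "linear_map R M N f" "linear_map R N P g"
  shows "linear_map R M P (\<lambda>x. g (f x))"
  using linear_map_comp[OF assms] by (simp add: comp_def)

text \<open>Maps are total HOL functions, while identities are known only on carriers; linearity has
  to transfer along such identities. That \<open>M\<close> is a module makes the equation usable at
  sums and multiples.\<close>

lemma linear_map_cong:
  assumes "linear_map R M N f" "module R M" "\<And>x. x \<in> carrier M \<Longrightarrow> f x = g x"
  shows "linear_map R M N g"
proof -
  interpret module R M by fact
  show ?thesis
    using assms(1) by (auto intro!: linear_mapI simp: assms(3)[symmetric] linear_map_closed
      linear_map_add linear_map_smult)
qed

definition bilinear ::
  "('r, 'q) ring_scheme \<Rightarrow> ('r, 'a, 'm) module_scheme \<Rightarrow> ('r, 'b, 'n) module_scheme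
    \<Rightarrow> ('r, 'c, 'o) module_scheme \<Rightarrow> ('a \<Rightarrow> 'b \<Rightarrow> 'c) \<Rightarrow> bool"
where
  "bilinear R A B M f \<longleftrightarrow>
     (\<forall>a\<in>carrier A. linear_map R B M (f a)) \<and> (\<forall>b\<in>carrier B. linear_map R A M (\<lambda>a. f a b))"

lemma bilinearI:
  assumes "\<And>a. a \<in> carrier A \<Longrightarrow> linear_map R B M (f a)"
    and "\<And>b. b \<in> carrier B \<Longrightarrow> linear_map R A M (\<lambda>a. f a b)"
  shows "bilinear R A B M f"
  using assms by (auto simp: bilinear_def)

lemma bilinear_right: "\<lbrakk>bilinear R A B M f; a \<in> carrier A\<rbrakk> \<Longrightarrow> linear_map R B M (f a)"
  and bilinear_left: "\<lbrakk>bilinear R A B M f; b \<in> carrier B\<rbrakk> \<Longrightarrow> linear_map R A M (\<lambda>a. f a b)"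
  by (auto simp: bilinear_def)

lemma bilinear_closed:
  "\<lbrakk>bilinear R A B M f; a \<in> carrier A; b \<in> carrier B\<rbrakk> \<Longrightarrow> f a b \<in> carrier M"
  by (rule linear_map_closed[OF bilinear_right])

section \<open>Free modules\<close>

lemma free_module_simps:
  "f \<in> carrier (free_module R S) \<longleftrightarrow>
     (\<forall>x. f x \<in> carrier R) \<and> finite {x. f x \<noteq> \<zero>\<^bsub>R\<^esub>} \<and> (\<forall>x. f x \<noteq> \<zero>\<^bsub>R\<^esub> \<longrightarrow> x \<in> S)"
  "\<zero>\<^bsub>free_module R S\<^esub> = (\<lambda>x. \<zero>\<^bsub>R\<^esub>)"
  "f \<oplus>\<^bsub>free_module R S\<^esub> g = (\<lambda>x. f x \<oplus>\<^bsub>R\<^esub> g x)"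
  "r \<odot>\<^bsub>free_module R S\<^esub> f = (\<lambda>x. r \<otimes>\<^bsub>R\<^esub> f x)"
  by (auto simp: free_module_def)

lemma free_module_module:
  assumes "cring R"
  shows "module R (free_module R S)"
proof -
  interpret cring R by fact
  show ?thesis
  proof (rule moduleI[OF assms])
    show "abelian_group (free_module R S)"
    proof (rule abelian_groupI)
      fix f g assume "f \<in> carrier (free_module R S)" "g \<in> carrier (free_module R S)"
      then show "f \<oplus>\<^bsub>free_module R S\<^esub> g \<in> carrier (free_module R S)"
        by (auto simp: free_module_simps
            intro: finite_subset[of _ "{x. f x \<noteq> \<zero>\<^bsub>R\<^esub>} \<union> {x. g x \<noteq> \<zero>\<^bsub>R\<^esub>}"]) (metis l_zero zero_closed)
    next
      fix f assume f: "f \<in> carrier (free_module R S)"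
      have "(\<lambda>x. \<ominus>\<^bsub>R\<^esub> f x) \<in> carrier (free_module R S)"
        using f by (auto simp: free_module_simps intro: finite_subset[of _ "{x. f x \<noteq> \<zero>\<^bsub>R\<^esub>}"])
      moreover have "(\<lambda>x. \<ominus>\<^bsub>R\<^esub> f x) \<oplus>\<^bsub>free_module R S\<^esub> f = \<zero>\<^bsub>free_module R S\<^esub>"
        using f by (simp add: free_module_simps l_neg)
      ultimately show "\<exists>g\<in>carrier (free_module R S). g \<oplus>\<^bsub>free_module R S\<^esub> f = \<zero>\<^bsub>free_module R S\<^esub>"
        by blast
    qed (simp_all add: free_module_simps a_ac)
  next
    fix r f assume "r \<in> carrier R" "f \<in> carrier (free_module R S)"
    then show "r \<odot>\<^bsub>free_module R S\<^esub> f \<in> carrier (free_module R S)"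
      by (auto simp: free_module_simps intro: finite_subset[of _ "{x. f x \<noteq> \<zero>\<^bsub>R\<^esub>}"])
        (metis r_null)
  qed (simp_all add: free_module_simps l_distr r_distr m_assoc)
qed

lemma single_closed: "\<lbrakk>cring R; x \<in> S\<rbrakk> \<Longrightarrow> single R x \<in> carrier (free_module R S)"
  by (auto simp: free_module_simps single_def cring.cring_simprules intro: finite_subset[of _ "{x}"])

text \<open>The linear extension of \<open>f\<close> to formal combinations. It is the sum inside
  \<open>tensor_lift\<close> for a fixed representative, with the pair of arguments merged into one
  index \<open>p\<close>.\<close>

definition free_lift ::
  "('r, 'q) ring_scheme \<Rightarrow> ('r, 'c, 'm) module_scheme \<Rightarrow> ('x \<Rightarrow> 'c) \<Rightarrow> ('x \<Rightarrow> 'r) \<Rightarrow> 'c"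
where
  "free_lift R M f c = (\<Oplus>\<^bsub>M\<^esub> p \<in> {p. c p \<noteq> \<zero>\<^bsub>R\<^esub>}. c p \<odot>\<^bsub>M\<^esub> f p)"

text \<open>Outside the support the summands vanish. A larger index set lets two combinations and
  their sum share one finite set, although the support of the sum may be smaller than the union of
  the supports.\<close>

lemma free_lift_superset:
  assumes "module R M" "f \<in> S \<rightarrow> carrier M" "c \<in> carrier (free_module R S)"
    and "finite T" "{p. c p \<noteq> \<zero>\<^bsub>R\<^esub>} \<subseteq> T" "T \<subseteq> S"
  shows "free_lift R M f c = (\<Oplus>\<^bsub>M\<^esub> p \<in> T. c p \<odot>\<^bsub>M\<^esub> f p)"
proof -
  interpret module R M by fact
  show ?thesis
    unfolding free_lift_def
    by (rule M.add.finprod_mono_neutral_cong_left[OF assms(4,5)])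
       (use assms(2,3,5,6) in \<open>auto simp: free_module_simps Pi_iff subset_iff\<close>)
qed

lemma free_lift_linear:
  assumes "module R M" "f \<in> S \<rightarrow> carrier M"
  shows "linear_map R (free_module R S) M (free_lift R M f)"
proof -
  interpret M: module R M by fact
  let ?F = "free_module R S"
  interpret F: module R ?F by (rule free_module_module) (rule M.is_cring)
  show ?thesis
  proof (rule linear_mapI)
    fix c assume "c \<in> carrier ?F"
    then show "free_lift R M f c \<in> carrier M"
      unfolding free_lift_def using assms(2)
      by (intro M.finsum_closed) (auto simp: free_module_simps Pi_iff)
  next
    fix c d assume cd: "c \<in> carrier ?F" "d \<in> carrier ?F"
    let ?T = "{p. c p \<noteq> \<zero>\<^bsub>R\<^esub>} \<union> {p. d p \<noteq> \<zero>\<^bsub>R\<^esub>}"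
    have T: "finite ?T" "?T \<subseteq> S" and S: "{p. (c \<oplus>\<^bsub>?F\<^esub> d) p \<noteq> \<zero>\<^bsub>R\<^esub>} \<subseteq> ?T"
      using cd by (auto simp: free_module_simps)
    have "free_lift R M f (c \<oplus>\<^bsub>?F\<^esub> d) = (\<Oplus>\<^bsub>M\<^esub> p \<in> ?T. (c \<oplus>\<^bsub>?F\<^esub> d) p \<odot>\<^bsub>M\<^esub> f p)"
      using S T cd by (intro free_lift_superset[OF assms]) auto
    also have "\<dots> = (\<Oplus>\<^bsub>M\<^esub> p \<in> ?T. c p \<odot>\<^bsub>M\<^esub> f p \<oplus>\<^bsub>M\<^esub> d p \<odot>\<^bsub>M\<^esub> f p)"
      using assms(2) T cd
      by (intro M.finsum_cong') (auto simp: free_module_simps Pi_iff intro!: M.smult_l_distr)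
    also have "\<dots> = (\<Oplus>\<^bsub>M\<^esub> p \<in> ?T. c p \<odot>\<^bsub>M\<^esub> f p) \<oplus>\<^bsub>M\<^esub> (\<Oplus>\<^bsub>M\<^esub> p \<in> ?T. d p \<odot>\<^bsub>M\<^esub> f p)"
      using assms(2) T cd by (intro M.finsum_addf) (auto simp: free_module_simps Pi_iff)
    also have "\<dots> = free_lift R M f c \<oplus>\<^bsub>M\<^esub> free_lift R M f d"
      using T cd by (subst (1 2) free_lift_superset[OF assms, where T = ?T]) auto
    finally show "free_lift R M f (c \<oplus>\<^bsub>?F\<^esub> d) = free_lift R M f c \<oplus>\<^bsub>M\<^esub> free_lift R M f d" .
  next
    fix r c assume rc: "r \<in> carrier R" "c \<in> carrier ?F"
    let ?T = "{p. c p \<noteq> \<zero>\<^bsub>R\<^esub>}"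
    have T: "finite ?T" "?T \<subseteq> S" and S: "{p. (r \<odot>\<^bsub>?F\<^esub> c) p \<noteq> \<zero>\<^bsub>R\<^esub>} \<subseteq> ?T"
      using rc by (auto simp: free_module_simps)
    have "free_lift R M f (r \<odot>\<^bsub>?F\<^esub> c) = (\<Oplus>\<^bsub>M\<^esub> p \<in> ?T. (r \<odot>\<^bsub>?F\<^esub> c) p \<odot>\<^bsub>M\<^esub> f p)"
      using S T rc by (intro free_lift_superset[OF assms]) auto
    also have "\<dots> = (\<Oplus>\<^bsub>M\<^esub> p \<in> ?T. r \<odot>\<^bsub>M\<^esub> (c p \<odot>\<^bsub>M\<^esub> f p))"
      using assms(2) T rc
      by (intro M.finsum_cong') (auto simp: free_module_simps Pi_iff intro!: M.smult_assoc1)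
    also have "\<dots> = r \<odot>\<^bsub>M\<^esub> free_lift R M f c"
      unfolding free_lift_def using assms(2) T rc
      by (intro M.finsum_smult_ldistr[symmetric]) (auto simp: free_module_simps Pi_iff)
    finally show "free_lift R M f (r \<odot>\<^bsub>?F\<^esub> c) = r \<odot>\<^bsub>M\<^esub> free_lift R M f c" .
  qed
qed

lemma free_lift_single:
  assumes "module R M" "f \<in> S \<rightarrow> carrier M" "x \<in> S"
  shows "free_lift R M f (single R x) = f x"
proof -
  interpret M: module R M by fact
  have "free_lift R M f (single R x) = (\<Oplus>\<^bsub>M\<^esub> p \<in> {x}. single R x p \<odot>\<^bsub>M\<^esub> f p)"
    using assms by (intro free_lift_superset[OF assms(1,2)] single_closed M.is_cring)
      (auto simp: single_def)
  also have "\<dots> = f x"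
    using funcset_mem[OF assms(2,3)] by (subst M.finsum_insert) (auto simp: single_def)
  finally show ?thesis .
qed

text \<open>Induction over a finite set containing the support, splitting off one coefficient at a
  time.\<close>

lemma free_module_induct [consumes 2, case_names zero single add]:
  assumes "cring R" "c \<in> carrier (free_module R S)"
    and "P \<zero>\<^bsub>free_module R S\<^esub>"
    and "\<And>r x. \<lbrakk>r \<in> carrier R; x \<in> S\<rbrakk> \<Longrightarrow> P (r \<odot>\<^bsub>free_module R S\<^esub> single R x)"
    and "\<And>c d. \<lbrakk>c \<in> carrier (free_module R S); d \<in> carrier (free_module R S); P c; P d\<rbrakk>
      \<Longrightarrow> P (c \<oplus>\<^bsub>free_module R S\<^esub> d)"
  shows "P c"
proof -
  interpret cring R by fact
  let ?F = "free_module R S"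
  interpret F: module R ?F by (rule free_module_module) (rule is_cring)
  have "\<forall>c. c \<in> carrier ?F \<longrightarrow> {x. c x \<noteq> \<zero>\<^bsub>R\<^esub>} \<subseteq> T \<longrightarrow> P c" if "finite T" for T
    using that
  proof (induction T)
    case empty
    have "c = \<zero>\<^bsub>?F\<^esub>" if "{x. c x \<noteq> \<zero>\<^bsub>R\<^esub>} \<subseteq> {}" for c
      using that by (auto simp: free_module_simps)
    then show ?case using assms(3) by auto
  next
    case (insert y T)
    show ?case
    proof (intro allI impI)
      fix c assume c: "c \<in> carrier ?F" "{x. c x \<noteq> \<zero>\<^bsub>R\<^esub>} \<subseteq> insert y T"
      let ?d = "c(y := \<zero>\<^bsub>R\<^esub>)"
      have d: "?d \<in> carrier ?F"
        using c(1) by (auto simp: free_module_simps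
            intro: finite_subset[of _ "{x. c x \<noteq> \<zero>\<^bsub>R\<^esub>}"])
      have Pd: "P ?d"
        using c(2) by (intro insert.IH[rule_format, OF d]) auto
      show "P c"
      proof (cases "y \<in> S")
        case True
        have "c = c y \<odot>\<^bsub>?F\<^esub> single R y \<oplus>\<^bsub>?F\<^esub> ?d"
          using c(1) by (auto simp: free_module_simps single_def fun_eq_iff)
        moreover have "P (c y \<odot>\<^bsub>?F\<^esub> single R y \<oplus>\<^bsub>?F\<^esub> ?d)"
          using c(1) True d Pd
          by (intro assms(4,5) F.smult_closed single_closed is_cring) (auto simp: free_module_simps)
        ultimately show ?thesis by simp
      next
        \<comment> \<open>The finite set is not assumed to lie in \<open>S\<close>; at a point
          outside \<open>S\<close> the coefficient is zero, so nothing is split off.\<close>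
        case False
        then have "c y = \<zero>\<^bsub>R\<^esub>"
          using c(1) by (auto simp: free_module_simps)
        then have "?d = c"
          by auto
        then show ?thesis using Pd by simp
      qed
    qed
  qed
  then show ?thesis
    using assms(2) by (auto simp: free_module_simps)
qed

section \<open>Quotient modules\<close>

lemma submodule_generated_submodule:
  assumes "module R M" "G \<subseteq> carrier M"
  shows "submodule (submodule_generated R M G) R M"
proof -
  interpret module R M by fact
  \<comment> \<open>The carrier itself belongs to the intersected family, which keeps the
    intersection inside the module.\<close>
  have *: "submodule (carrier M) R M" by (rule carrier_is_submodule)
  show ?thesis
    unfolding submodule_generated_def
  proof (rule submoduleI)
    show "\<Inter>{N. submodule N R M \<and> G \<subseteq> N} \<subseteq> carrier M" using * assms(2) by auto
    show "\<zero>\<^bsub>M\<^esub> \<in> \<Inter>{N. submodule N R M \<and> G \<subseteq> N}"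
      using subgroup.one_closed[OF submodule.axioms(1)] by fastforce
  next
    fix a assume "a \<in> \<Inter>{N. submodule N R M \<and> G \<subseteq> N}"
    then show "\<ominus>\<^bsub>M\<^esub> a \<in> \<Inter>{N. submodule N R M \<and> G \<subseteq> N}"
      by (simp add: submoduleE(3))
    fix b assume "b \<in> \<Inter>{N. submodule N R M \<and> G \<subseteq> N}"
    with \<open>a \<in> \<Inter>{N. submodule N R M \<and> G \<subseteq> N}\<close>
    show "a \<oplus>\<^bsub>M\<^esub> b \<in> \<Inter>{N. submodule N R M \<and> G \<subseteq> N}"
      by (simp add: submoduleE(5))
  qed (auto intro: submodule.smult_closed)
qed

lemma submodule_generated_superset: "G \<subseteq> submodule_generated R M G"
  by (auto simp: submodule_generated_def)

lemma submodule_generated_least: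
  "\<lbrakk>submodule N R M; G \<subseteq> N\<rbrakk> \<Longrightarrow> submodule_generated R M G \<subseteq> N"
  by (auto simp: submodule_generated_def)

lemma submodule_abelian_subgroup:
  assumes "module R M" "submodule N R M"
  shows "abelian_subgroup N M"
proof -
  interpret module R M by fact
  show ?thesis
    using assms(2) M.abelian_group_axioms
    by (intro abelian_subgroupI3 additive_subgroupI) (auto dest: submodule.axioms(1))
qed

lemma quotient_module_simps:
  "carrier (quotient_module M N) = a_rcosets\<^bsub>M\<^esub> N"
  "zero (quotient_module M N) = N"
  "X \<oplus>\<^bsub>quotient_module M N\<^esub> Y = X <+>\<^bsub>M\<^esub> Y"
  "r \<odot>\<^bsub>quotient_module M N\<^esub> X = (\<Union>x\<in>X. N +>\<^bsub>M\<^esub> (r \<odot>\<^bsub>M\<^esub> x))"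
  by (auto simp: quotient_module_def)

text \<open>Reduces computation in the quotient to representatives. The main argument concerns
  scalar multiplication: it is defined as a union over all elements of the coset, and these all
  contribute the same coset.\<close>

lemma quotient_module_coset:
  assumes "module R M" "submodule N R M"
  shows "x \<in> carrier M \<Longrightarrow> N +>\<^bsub>M\<^esub> x \<in> carrier (quotient_module M N)"
    and "\<lbrakk>x \<in> carrier M; y \<in> carrier M\<rbrakk>
      \<Longrightarrow> (N +>\<^bsub>M\<^esub> x) \<oplus>\<^bsub>quotient_module M N\<^esub> (N +>\<^bsub>M\<^esub> y) = N +>\<^bsub>M\<^esub> (x \<oplus>\<^bsub>M\<^esub> y)"
    and "\<lbrakk>r \<in> carrier R; x \<in> carrier M\<rbrakk>
      \<Longrightarrow> r \<odot>\<^bsub>quotient_module M N\<^esub> (N +>\<^bsub>M\<^esub> x) = N +>\<^bsub>M\<^esub> (r \<odot>\<^bsub>M\<^esub> x)"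
    and "X \<in> carrier (quotient_module M N) \<Longrightarrow> \<exists>x\<in>carrier M. X = N +>\<^bsub>M\<^esub> x"
    and "zero (quotient_module M N) = N +>\<^bsub>M\<^esub> \<zero>\<^bsub>M\<^esub>"
    and "x \<in> N \<Longrightarrow> N +>\<^bsub>M\<^esub> x = zero (quotient_module M N)"
proof -
  interpret module R M by fact
  interpret N: abelian_subgroup N M by (rule submodule_abelian_subgroup) fact+
  show "x \<in> carrier M \<Longrightarrow> N +>\<^bsub>M\<^esub> x \<in> carrier (quotient_module M N)"
    by (simp add: quotient_module_simps M.a_rcosetsI N.a_subset)
  show "\<lbrakk>x \<in> carrier M; y \<in> carrier M\<rbrakk>
      \<Longrightarrow> (N +>\<^bsub>M\<^esub> x) \<oplus>\<^bsub>quotient_module M N\<^esub> (N +>\<^bsub>M\<^esub> y) = N +>\<^bsub>M\<^esub> (x \<oplus>\<^bsub>M\<^esub> y)"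
    by (simp add: quotient_module_simps N.a_rcos_sum)
  show "X \<in> carrier (quotient_module M N) \<Longrightarrow> \<exists>x\<in>carrier M. X = N +>\<^bsub>M\<^esub> x"
    unfolding quotient_module_simps A_RCOSETS_def' a_r_coset_def' by blast
  show "zero (quotient_module M N) = N +>\<^bsub>M\<^esub> \<zero>\<^bsub>M\<^esub>"
    by (simp add: quotient_module_simps N.a_subset)
  show "x \<in> N \<Longrightarrow> N +>\<^bsub>M\<^esub> x = zero (quotient_module M N)"
    by (simp add: quotient_module_simps N.a_rcos_const)
  assume rx: "r \<in> carrier R" "x \<in> carrier M"
  have "N +>\<^bsub>M\<^esub> (r \<odot>\<^bsub>M\<^esub> y) = N +>\<^bsub>M\<^esub> (r \<odot>\<^bsub>M\<^esub> x)" if y: "y \<in> N +>\<^bsub>M\<^esub> x" for y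
  proof -
    obtain n where n: "n \<in> N" "y = n \<oplus>\<^bsub>M\<^esub> x"
      using y unfolding a_r_coset_def' by blast
    have "r \<odot>\<^bsub>M\<^esub> y = r \<odot>\<^bsub>M\<^esub> n \<oplus>\<^bsub>M\<^esub> r \<odot>\<^bsub>M\<^esub> x"
      using smult_r_distr[OF rx(1) _ rx(2), of n] n N.a_Hcarr by simp
    moreover have "r \<odot>\<^bsub>M\<^esub> n \<in> N"
      using submodule.smult_closed[OF assms(2) rx(1) n(1)] .
    ultimately have "r \<odot>\<^bsub>M\<^esub> y \<in> N +>\<^bsub>M\<^esub> (r \<odot>\<^bsub>M\<^esub> x)"
      unfolding a_r_coset_def' by blast
    then show ?thesis
      using M.a_repr_independence[OF _ _ N.a_subgroup] rx by simp
  qed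
  then have "(\<Union>y\<in>N +>\<^bsub>M\<^esub> x. N +>\<^bsub>M\<^esub> (r \<odot>\<^bsub>M\<^esub> y)) = (\<Union>y\<in>N +>\<^bsub>M\<^esub> x. N +>\<^bsub>M\<^esub> (r \<odot>\<^bsub>M\<^esub> x))"
    by (intro SUP_cong refl)
  also have "\<dots> = N +>\<^bsub>M\<^esub> (r \<odot>\<^bsub>M\<^esub> x)"
    using N.a_rcos_self[OF rx(2)] by blast
  finally show "r \<odot>\<^bsub>quotient_module M N\<^esub> (N +>\<^bsub>M\<^esub> x) = N +>\<^bsub>M\<^esub> (r \<odot>\<^bsub>M\<^esub> x)"
    by (simp add: quotient_module_simps)
qed

lemma quotient_module_module:
  assumes "module R M" "submodule N R M"
  shows "module R (quotient_module M N)"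
proof -
  interpret module R M by fact
  note q = quotient_module_coset[OF assms]
  let ?Q = "quotient_module M N"
  show ?thesis
  proof (rule moduleI[OF R.is_cring])
    show "abelian_group ?Q"
    proof (rule abelian_groupI)
      fix X assume "X \<in> carrier ?Q"
      then obtain x where x: "x \<in> carrier M" "X = N +>\<^bsub>M\<^esub> x" using q(4) by blast
      have "(N +>\<^bsub>M\<^esub> (\<ominus>\<^bsub>M\<^esub> x)) \<oplus>\<^bsub>?Q\<^esub> X = \<zero>\<^bsub>?Q\<^esub>"
        using x by (simp add: q(2,5) M.l_neg)
      then show "\<exists>Y\<in>carrier ?Q. Y \<oplus>\<^bsub>?Q\<^esub> X = \<zero>\<^bsub>?Q\<^esub>"
        using x q(1) by blast
      show "\<zero>\<^bsub>?Q\<^esub> \<oplus>\<^bsub>?Q\<^esub> X = X" using x by (simp add: q(2,5))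
    next
      fix X Y assume "X \<in> carrier ?Q" "Y \<in> carrier ?Q"
      then obtain x y where x: "x \<in> carrier M" "X = N +>\<^bsub>M\<^esub> x" and y: "y \<in> carrier M" "Y = N +>\<^bsub>M\<^esub> y"
        using q(4)[of X] q(4)[of Y] by blast
      show "X \<oplus>\<^bsub>?Q\<^esub> Y \<in> carrier ?Q" "X \<oplus>\<^bsub>?Q\<^esub> Y = Y \<oplus>\<^bsub>?Q\<^esub> X"
        using x y by (simp_all add: q(1,2) M.a_comm)
      fix Z assume "Z \<in> carrier ?Q"
      then obtain z where z: "z \<in> carrier M" "Z = N +>\<^bsub>M\<^esub> z" using q(4) by blast
      show "X \<oplus>\<^bsub>?Q\<^esub> Y \<oplus>\<^bsub>?Q\<^esub> Z = X \<oplus>\<^bsub>?Q\<^esub> (Y \<oplus>\<^bsub>?Q\<^esub> Z)"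
        using x y z by (simp add: q(1,2) M.a_assoc)
    qed (simp add: q(1,5))
  next
    fix r X assume r: "r \<in> carrier R" and "X \<in> carrier ?Q"
    then obtain x where x: "x \<in> carrier M" "X = N +>\<^bsub>M\<^esub> x"
      using q(4) by blast
    show "r \<odot>\<^bsub>?Q\<^esub> X \<in> carrier ?Q"
      using x r by (simp add: q(1,3))
    fix s assume s: "s \<in> carrier R"
    show "(r \<oplus>\<^bsub>R\<^esub> s) \<odot>\<^bsub>?Q\<^esub> X = r \<odot>\<^bsub>?Q\<^esub> X \<oplus>\<^bsub>?Q\<^esub> s \<odot>\<^bsub>?Q\<^esub> X"
      using x r s by (simp add: q(1,2,3) smult_l_distr)
    show "(r \<otimes>\<^bsub>R\<^esub> s) \<odot>\<^bsub>?Q\<^esub> X = r \<odot>\<^bsub>?Q\<^esub> (s \<odot>\<^bsub>?Q\<^esub> X)"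
      using x r s by (simp add: q(1,2,3) smult_assoc1)
  next
    fix r X Y assume r: "r \<in> carrier R" and "X \<in> carrier ?Q" "Y \<in> carrier ?Q"
    then obtain x y where x: "x \<in> carrier M" "X = N +>\<^bsub>M\<^esub> x" and y: "y \<in> carrier M" "Y = N +>\<^bsub>M\<^esub> y"
      using q(4)[of X] q(4)[of Y] by blast
    show "r \<odot>\<^bsub>?Q\<^esub> (X \<oplus>\<^bsub>?Q\<^esub> Y) = r \<odot>\<^bsub>?Q\<^esub> X \<oplus>\<^bsub>?Q\<^esub> r \<odot>\<^bsub>?Q\<^esub> Y"
      using x y r by (simp add: q(1,2,3) smult_r_distr)
  next
    fix X assume "X \<in> carrier ?Q"
    then obtain x where x: "x \<in> carrier M" "X = N +>\<^bsub>M\<^esub> x"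
      using q(4) by blast
    then show "\<one>\<^bsub>R\<^esub> \<odot>\<^bsub>?Q\<^esub> X = X"
      by (simp add: q(3))
  qed
qed

section \<open>Tensor products\<close>

lemma tensor_relators_closed:
  assumes "module R A" "module R B"
  shows "tensor_relators R A B \<subseteq> carrier (free_module R (carrier A \<times> carrier B))"
proof -
  interpret A: module R A by fact
  interpret B: module R B by fact
  let ?F = "free_module R (carrier A \<times> carrier B)"
  interpret F: module R ?F by (rule free_module_module) (rule A.is_cring)
  have [simp]: "single R (a, b) \<in> carrier ?F" if "a \<in> carrier A" "b \<in> carrier B" for a b
    using that by (intro single_closed A.is_cring) simp
  show ?thesis
    unfolding tensor_relators_def Let_def by auto
qed

section \<open>Construction and universal property of the tensor product\<close>

lemma tensor_null_submodule:
  assumes "module R A" "module R B"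
  shows "submodule (tensor_null R A B) R (free_module R (carrier A \<times> carrier B))"
  unfolding tensor_null_def
  by (intro submodule_generated_submodule tensor_relators_closed free_module_module
      module.axioms(1)[OF assms(1)] assms)

lemma tensor_module:
  assumes "module R A" "module R B"
  shows "module R (tensor R A B)"
  unfolding tensor_def
  by (intro quotient_module_module tensor_null_submodule free_module_module
      module.axioms(1)[OF assms(1)] assms)

lemma tensor_coset:
  assumes "module R A" "module R B"
  defines "F \<equiv> free_module R (carrier A \<times> carrier B)"
  defines "N \<equiv> tensor_null R A B"
  shows "x \<in> carrier F \<Longrightarrow> N +>\<^bsub>F\<^esub> x \<in> carrier (tensor R A B)"
    and "\<lbrakk>x \<in> carrier F; y \<in> carrier F\<rbrakk>
      \<Longrightarrow> (N +>\<^bsub>F\<^esub> x) \<oplus>\<^bsub>tensor R A B\<^esub> (N +>\<^bsub>F\<^esub> y) = N +>\<^bsub>F\<^esub> (x \<oplus>\<^bsub>F\<^esub> y)"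
    and "\<lbrakk>r \<in> carrier R; x \<in> carrier F\<rbrakk>
      \<Longrightarrow> r \<odot>\<^bsub>tensor R A B\<^esub> (N +>\<^bsub>F\<^esub> x) = N +>\<^bsub>F\<^esub> (r \<odot>\<^bsub>F\<^esub> x)"
    and "X \<in> carrier (tensor R A B) \<Longrightarrow> \<exists>x\<in>carrier F. X = N +>\<^bsub>F\<^esub> x"
    and "zero (tensor R A B) = N +>\<^bsub>F\<^esub> \<zero>\<^bsub>F\<^esub>"
    and "\<lbrakk>x \<in> carrier F; y \<in> carrier F; x \<ominus>\<^bsub>F\<^esub> y \<in> N\<rbrakk> \<Longrightarrow> N +>\<^bsub>F\<^esub> x = N +>\<^bsub>F\<^esub> y"
proof -
  have F: "module R F"
    unfolding F_def by (rule free_module_module) (rule module.axioms(1)[OF assms(1)])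
  have N: "submodule N R F"
    unfolding F_def N_def by (rule tensor_null_submodule) fact+
  note q = quotient_module_coset[OF F N, folded tensor_def]
  have T: "quotient_module F N = tensor R A B"
    by (simp add: tensor_def F_def N_def)
  show "x \<in> carrier F \<Longrightarrow> N +>\<^bsub>F\<^esub> x \<in> carrier (tensor R A B)"
    "\<lbrakk>x \<in> carrier F; y \<in> carrier F\<rbrakk>
      \<Longrightarrow> (N +>\<^bsub>F\<^esub> x) \<oplus>\<^bsub>tensor R A B\<^esub> (N +>\<^bsub>F\<^esub> y) = N +>\<^bsub>F\<^esub> (x \<oplus>\<^bsub>F\<^esub> y)"
    "\<lbrakk>r \<in> carrier R; x \<in> carrier F\<rbrakk>
      \<Longrightarrow> r \<odot>\<^bsub>tensor R A B\<^esub> (N +>\<^bsub>F\<^esub> x) = N +>\<^bsub>F\<^esub> (r \<odot>\<^bsub>F\<^esub> x)"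
    "X \<in> carrier (tensor R A B) \<Longrightarrow> \<exists>x\<in>carrier F. X = N +>\<^bsub>F\<^esub> x"
    "zero (tensor R A B) = N +>\<^bsub>F\<^esub> \<zero>\<^bsub>F\<^esub>"
    using q(1-5) unfolding T by blast+
  interpret N: abelian_subgroup N F by (rule submodule_abelian_subgroup) fact+
  show "\<lbrakk>x \<in> carrier F; y \<in> carrier F; x \<ominus>\<^bsub>F\<^esub> y \<in> N\<rbrakk> \<Longrightarrow> N +>\<^bsub>F\<^esub> x = N +>\<^bsub>F\<^esub> y"
    unfolding a_minus_def using N.a_rcos_module_rev N.a_repr_independence' by blast
qed

text \<open>Bilinearity of \<open>f\<close> puts every relator into the kernel of the linear
  extension \<open>?l\<close>; the kernel is a submodule, so it contains all of
  \<open>tensor_null\<close>. The representative chosen by \<open>SOME\<close> differs from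
  \<open>c\<close> by a null element and has the same image.\<close>

lemma tensor_lift_coset:
  assumes "module R A" "module R B" "module R M" "bilinear R A B M f"
    and "c \<in> carrier (free_module R (carrier A \<times> carrier B))"
  shows "tensor_lift R M f (tensor_null R A B +>\<^bsub>free_module R (carrier A \<times> carrier B)\<^esub> c) =
    free_lift R M (\<lambda>p. f (fst p) (snd p)) c"
proof -
  interpret A: module R A by fact
  interpret B: module R B by fact
  interpret M: module R M by fact
  let ?S = "carrier A \<times> carrier B"
  let ?F = "free_module R ?S"
  let ?N = "tensor_null R A B"
  let ?f = "\<lambda>p. f (fst p) (snd p)"
  let ?l = "free_lift R M ?f"
  interpret F: module R ?F by (rule free_module_module) (rule A.is_cring)
  interpret N: abelian_subgroup ?N ?F
    by (rule submodule_abelian_subgroup[OF F.module_axioms tensor_null_submodule]) fact+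
  have f: "?f \<in> ?S \<rightarrow> carrier M"
    using bilinear_closed[OF assms(4)] by auto
  have l: "linear_map R ?F M ?l"
    by (rule free_lift_linear[OF assms(3) f])
  have single [simp]: "single R (a, b) \<in> carrier ?F" "?l (single R (a, b)) = f a b"
    if "a \<in> carrier A" "b \<in> carrier B" for a b
    using that free_lift_single[OF assms(3) f, of "(a, b)"]
    by (auto intro: single_closed A.is_cring)
  have lminus: "?l (x \<ominus>\<^bsub>?F\<^esub> y) = ?l x \<ominus>\<^bsub>M\<^esub> ?l y" if "x \<in> carrier ?F" "y \<in> carrier ?F" for x y
  proof -
    have "?l (x \<ominus>\<^bsub>?F\<^esub> y) = ?l x \<oplus>\<^bsub>M\<^esub> ?l ((\<ominus>\<^bsub>R\<^esub> \<one>\<^bsub>R\<^esub>) \<odot>\<^bsub>?F\<^esub> y)"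
      using that by (simp add: a_minus_def linear_map_add[OF l] F.smult_l_minus)
    also have "\<dots> = ?l x \<ominus>\<^bsub>M\<^esub> ?l y"
      using that linear_map_closed[OF l that(2)]
      by (subst linear_map_smult[OF l]) (simp_all add: M.smult_l_minus a_minus_def)
    finally show ?thesis .
  qed
  have self: "x \<ominus>\<^bsub>M\<^esub> x = \<zero>\<^bsub>M\<^esub>" if "x \<in> carrier M" for x
    using that by (simp add: a_minus_def M.r_neg)
  note lin = bilinear_left[OF assms(4)] bilinear_right[OF assms(4)]
  let ?K = "{c \<in> carrier ?F. ?l c = \<zero>\<^bsub>M\<^esub>}"
  have K: "submodule ?K R ?F"
  proof (rule F.submoduleI)
    show "\<zero>\<^bsub>?F\<^esub> \<in> ?K" using linear_map_zero[OF F.module_axioms assms(3) l] by simp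
    fix a assume a: "a \<in> ?K"
    have "?l (\<zero>\<^bsub>?F\<^esub> \<ominus>\<^bsub>?F\<^esub> a) = \<zero>\<^bsub>M\<^esub>"
      using a linear_map_zero[OF F.module_axioms assms(3) l] by (simp add: lminus self)
    then show "\<ominus>\<^bsub>?F\<^esub> a \<in> ?K" using a by (simp add: a_minus_def)
  qed (auto simp: linear_map_add[OF l] linear_map_smult[OF l])
  have "tensor_relators R A B \<subseteq> ?K"
  proof
    fix x assume x: "x \<in> tensor_relators R A B"
    then have "x \<in> carrier ?F"
      using tensor_relators_closed[OF assms(1,2)] by blast
    moreover have "?l x = \<zero>\<^bsub>M\<^esub>"
      using x unfolding tensor_relators_def Let_def
      by (auto simp: lminus linear_map_add[OF l] linear_map_smult[OF l] self bilinear_closed[OF assms(4)]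
          linear_map_add[OF lin(1)] linear_map_add[OF lin(2)]
          linear_map_smult[OF lin(1)] linear_map_smult[OF lin(2)])
    ultimately show "x \<in> ?K" by simp
  qed
  then have NK: "?N \<subseteq> ?K"
    unfolding tensor_null_def by (rule submodule_generated_least[OF K])
  let ?X = "?N +>\<^bsub>?F\<^esub> c"
  have "(SOME c. c \<in> ?X) \<in> ?X"
    using N.a_rcos_self[OF assms(5)] by (rule someI[of "\<lambda>c. c \<in> ?X"])
  then obtain n where n: "n \<in> ?N" "(SOME c. c \<in> ?X) = n \<oplus>\<^bsub>?F\<^esub> c"
    unfolding a_r_coset_def' by blast
  have "tensor_lift R M f ?X = ?l (SOME c. c \<in> ?X)"
    by (simp add: tensor_lift_def free_lift_def Let_def)
  also have "\<dots> = ?l c"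
    using n NK assms(5) linear_map_closed[OF l assms(5)] by (auto simp: linear_map_add[OF l])
  finally show ?thesis .
qed

lemma tensor_lift_linear:
  assumes "module R A" "module R B" "module R M" "bilinear R A B M f"
  shows "linear_map R (tensor R A B) M (tensor_lift R M f)"
proof -
  interpret A: module R A by fact
  let ?S = "carrier A \<times> carrier B"
  let ?F = "free_module R ?S"
  interpret F: module R ?F by (rule free_module_module) (rule A.is_cring)
  have f: "(\<lambda>p. f (fst p) (snd p)) \<in> ?S \<rightarrow> carrier M"
    using bilinear_closed[OF assms(4)] by auto
  note l = free_lift_linear[OF assms(3) f]
  note q = tensor_coset[OF assms(1,2)]
  note tl = tensor_lift_coset[OF assms]
  show ?thesis
  proof (rule linear_mapI)
    fix X assume "X \<in> carrier (tensor R A B)"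
    then obtain x where x: "x \<in> carrier ?F" "X = tensor_null R A B +>\<^bsub>?F\<^esub> x"
      using q(4) by blast
    then show "tensor_lift R M f X \<in> carrier M"
      by (simp add: tl linear_map_closed[OF l])
    show "tensor_lift R M f (r \<odot>\<^bsub>tensor R A B\<^esub> X) = r \<odot>\<^bsub>M\<^esub> tensor_lift R M f X"
      if "r \<in> carrier R" for r
      using x that by (simp add: tl q(3) linear_map_smult[OF l])
    fix Y assume "Y \<in> carrier (tensor R A B)"
    then obtain y where y: "y \<in> carrier ?F" "Y = tensor_null R A B +>\<^bsub>?F\<^esub> y"
      using q(4) by blast
    then show "tensor_lift R M f (X \<oplus>\<^bsub>tensor R A B\<^esub> Y) = tensor_lift R M f X \<oplus>\<^bsub>M\<^esub> tensor_lift R M f Y"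
      using x by (simp add: tl q(2) linear_map_add[OF l])
  qed
qed

lemma tensor_lift_pure:
  assumes "module R A" "module R B" "module R M" "bilinear R A B M f"
    and "a \<in> carrier A" "b \<in> carrier B"
  shows "tensor_lift R M f (pure R A B a b) = f a b"
proof -
  have f: "(\<lambda>p. f (fst p) (snd p)) \<in> carrier A \<times> carrier B \<rightarrow> carrier M"
    using bilinear_closed[OF assms(4)] by auto
  show ?thesis
    unfolding pure_def
    using assms(5,6) free_lift_single[OF assms(3) f, of "(a, b)"]
    by (simp add: tensor_lift_coset[OF assms(1-4)] single_closed module.axioms(1)[OF assms(1)])
qed

text \<open>Each relator is the difference of the two sides of one law of bilinearity, so the cosets
  of the two sides coincide.\<close>

lemma pure_bilinear:
  assumes "module R A" "module R B"
  shows "bilinear R A B (tensor R A B) (pure R A B)"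
proof -
  interpret A: module R A by fact
  interpret B: module R B by fact
  let ?F = "free_module R (carrier A \<times> carrier B)"
  interpret F: module R ?F by (rule free_module_module) (rule A.is_cring)
  note q = tensor_coset[OF assms]
  have [simp]: "single R (a, b) \<in> carrier ?F" if "a \<in> carrier A" "b \<in> carrier B" for a b
    using that by (intro single_closed A.is_cring) simp
  have rel: "x \<in> tensor_null R A B" if "x \<in> tensor_relators R A B" for x
    using subsetD[OF submodule_generated_superset that] unfolding tensor_null_def .
  note rel = rel[unfolded tensor_relators_def Let_def]
  have add_left: "single R (a \<oplus>\<^bsub>A\<^esub> a', b) \<ominus>\<^bsub>?F\<^esub> (single R (a, b) \<oplus>\<^bsub>?F\<^esub> single R (a', b))
      \<in> tensor_null R A B"
    if "a \<in> carrier A" "a' \<in> carrier A" "b \<in> carrier B" for a a' b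
    by (rule rel, rule UnI1, rule UnI1, rule UnI1) (use that in blast)
  have add_right: "single R (a, b \<oplus>\<^bsub>B\<^esub> b') \<ominus>\<^bsub>?F\<^esub> (single R (a, b) \<oplus>\<^bsub>?F\<^esub> single R (a, b'))
      \<in> tensor_null R A B"
    if "a \<in> carrier A" "b \<in> carrier B" "b' \<in> carrier B" for a b b'
    by (rule rel, rule UnI1, rule UnI1, rule UnI2) (use that in blast)
  have smult_left: "single R (r \<odot>\<^bsub>A\<^esub> a, b) \<ominus>\<^bsub>?F\<^esub> r \<odot>\<^bsub>?F\<^esub> single R (a, b) \<in> tensor_null R A B"
    if "r \<in> carrier R" "a \<in> carrier A" "b \<in> carrier B" for r a b
    by (rule rel, rule UnI1, rule UnI2) (use that in blast)
  have smult_right: "single R (a, r \<odot>\<^bsub>B\<^esub> b) \<ominus>\<^bsub>?F\<^esub> r \<odot>\<^bsub>?F\<^esub> single R (a, b) \<in> tensor_null R A B"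
    if "r \<in> carrier R" "a \<in> carrier A" "b \<in> carrier B" for r a b
    by (rule rel, rule UnI2) (use that in blast)
  show ?thesis
    unfolding pure_def
  proof (intro bilinearI linear_mapI, goal_cases)
    case (2 a x y)
    then show ?case by (subst q(2)) (simp_all add: q(6)[OF _ _ add_right])
  next
    case (5 b x y)
    then show ?case by (subst q(2)) (simp_all add: q(6)[OF _ _ add_left])
  next
    case (3 a r x)
    then show ?case by (subst q(3)) (simp_all add: q(6)[OF _ _ smult_right])
  next
    case (6 b r x)
    then show ?case by (subst q(3)) (simp_all add: q(6)[OF _ _ smult_left])
  qed (auto intro: q(1))
qed

text \<open>Scalars are absorbed into the first leg, r(a \<otimes> b) = (r a) \<otimes> b, and zero
  is 0 times a pure tensor. Pure tensors therefore generate everything under addition alone.\<close>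

lemma tensor_induct [consumes 3, case_names pure add]:
  assumes "module R A" "module R B" "t \<in> carrier (tensor R A B)"
    and pure: "\<And>a b. \<lbrakk>a \<in> carrier A; b \<in> carrier B\<rbrakk> \<Longrightarrow> P (pure R A B a b)"
    and add: "\<And>s t. \<lbrakk>s \<in> carrier (tensor R A B); t \<in> carrier (tensor R A B); P s; P t\<rbrakk>
      \<Longrightarrow> P (s \<oplus>\<^bsub>tensor R A B\<^esub> t)"
  shows "P t"
proof -
  interpret A: module R A by fact
  interpret B: module R B by fact
  interpret T: module R "tensor R A B" by (rule tensor_module) fact+
  let ?F = "free_module R (carrier A \<times> carrier B)"
  let ?c = "\<lambda>x. tensor_null R A B +>\<^bsub>?F\<^esub> x"
  note q = tensor_coset[OF assms(1,2)]
  note lin = bilinear_left[OF pure_bilinear[OF assms(1,2)]]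
  obtain x where x: "x \<in> carrier ?F" "t = ?c x"
    using q(4) assms(3) by blast
  have smult: "P (r \<odot>\<^bsub>tensor R A B\<^esub> pure R A B a b)"
    if "r \<in> carrier R" "a \<in> carrier A" "b \<in> carrier B" for r a b
    using that pure[of "r \<odot>\<^bsub>A\<^esub> a" b] by (simp add: linear_map_smult[OF lin])
  have "P (?c x)"
    using A.is_cring x(1)
  proof (induction rule: free_module_induct)
    case zero
    have "P (\<zero>\<^bsub>R\<^esub> \<odot>\<^bsub>tensor R A B\<^esub> pure R A B \<zero>\<^bsub>A\<^esub> \<zero>\<^bsub>B\<^esub>)"
      by (rule smult) auto
    then show ?case
      by (simp add: q(5)[symmetric] linear_map_closed[OF lin])
  next
    case (single r p)
    then obtain a b where "p = (a, b)" "a \<in> carrier A" "b \<in> carrier B" by auto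
    then show ?case
      using smult[of r a b] single
      by (simp add: pure_def q(3) single_closed A.is_cring)
  next
    case (add c d)
    then show ?case
      using assms(5)[of "?c c" "?c d"] by (simp add: q(1,2))
  qed
  then show ?thesis using x by simp
qed

lemma tensor_ext:
  assumes "module R A" "module R B" "linear_map R (tensor R A B) M f" "linear_map R (tensor R A B) M g"
    and "\<And>a b. \<lbrakk>a \<in> carrier A; b \<in> carrier B\<rbrakk> \<Longrightarrow> f (pure R A B a b) = g (pure R A B a b)"
    and "t \<in> carrier (tensor R A B)"
  shows "f t = g t"
  using assms(1,2,6)
  by (induction t rule: tensor_induct)
    (simp_all add: assms(5) linear_map_add[OF assms(3)] linear_map_add[OF assms(4)])

lemma tensor_ext2:
  assumes "module R A" "module R B" "module R C" "module R D"
    and f: "bilinear R (tensor R A B) (tensor R C D) M f" and g: "bilinear R (tensor R A B) (tensor R C D) M g"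
    and eq: "\<And>a b c d. \<lbrakk>a \<in> carrier A; b \<in> carrier B; c \<in> carrier C; d \<in> carrier D\<rbrakk> \<Longrightarrow>
      f (pure R A B a b) (pure R C D c d) = g (pure R A B a b) (pure R C D c d)"
    and s: "s \<in> carrier (tensor R A B)" and t: "t \<in> carrier (tensor R C D)"
  shows "f s t = g s t"
proof (rule tensor_ext[OF assms(1,2) bilinear_left[OF f t] bilinear_left[OF g t] _ s])
  fix a b assume ab: "a \<in> carrier A" "b \<in> carrier B"
  then have "pure R A B a b \<in> carrier (tensor R A B)"
    by (rule bilinear_closed[OF pure_bilinear[OF assms(1,2)]])
  note lin = bilinear_right[OF f this] bilinear_right[OF g this]
  show "f (pure R A B a b) t = g (pure R A B a b) t"
    by (rule tensor_ext[OF assms(3,4) lin eq[OF ab] t])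
qed

section \<open>Closure properties of bilinear maps\<close>

lemma bilinear_compose:
  assumes "bilinear R C D M h" "linear_map R A C f" "linear_map R B D g"
  shows "bilinear R A B M (\<lambda>a b. h (f a) (g b))"
  by (intro bilinearI linear_map_compose[OF assms(2) bilinear_left[OF assms(1)]]
      linear_map_compose[OF assms(3) bilinear_right[OF assms(1)]] linear_map_closed[OF assms(2)]
      linear_map_closed[OF assms(3)])

lemma bilinear_postcompose:
  assumes "bilinear R A B M h" "linear_map R M N k"
  shows "bilinear R A B N (\<lambda>a b. k (h a b))"
  by (intro bilinearI linear_map_compose[OF bilinear_right[OF assms(1)] assms(2)]
      linear_map_compose[OF bilinear_left[OF assms(1)] assms(2)])

lemma bilinear_flip: "bilinear R A B M f \<Longrightarrow> bilinear R B A M (\<lambda>b a. f a b)"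
  by (auto simp: bilinear_def)

lemma linear_map_sum:
  assumes "module R M" "module R N" "linear_map R M N f" "linear_map R M N g"
  shows "linear_map R M N (\<lambda>x. f x \<oplus>\<^bsub>N\<^esub> g x)"
proof -
  interpret M: module R M by fact
  interpret N: module R N by fact
  note [simp] = linear_map_closed[OF assms(3)] linear_map_closed[OF assms(4)]
  show ?thesis
    by (rule linear_mapI) (simp_all add: linear_map_add[OF assms(3)] linear_map_add[OF assms(4)]
      linear_map_smult[OF assms(3)] linear_map_smult[OF assms(4)] N.smult_r_distr N.a_ac)
qed

text \<open>Induction on \<open>t\<close>: on a pure tensor the lift is \<open>f c a b\<close>,
  which is linear in \<open>c\<close>, and sums of linear maps are linear. Nested lifts, such as
  those defining \<open>assoc\<close>, owe their bilinearity to this.\<close>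

lemma tensor_lift_parameter:
  assumes "module R A" "module R B" "module R C" "module R M"
    and "\<And>c. c \<in> carrier C \<Longrightarrow> bilinear R A B M (f c)"
    and "\<And>a b. \<lbrakk>a \<in> carrier A; b \<in> carrier B\<rbrakk> \<Longrightarrow> linear_map R C M (\<lambda>c. f c a b)"
    and "t \<in> carrier (tensor R A B)"
  shows "linear_map R C M (\<lambda>c. tensor_lift R M (f c) t)"
  using assms(1,2,7)
proof (induction t rule: tensor_induct)
  case (pure a b)
  show ?case
    by (rule linear_map_cong[OF assms(6)[OF pure] assms(3)])
      (simp add: tensor_lift_pure[OF assms(1,2,4,5)] pure)
next
  case (add s t)
  show ?case
    by (rule linear_map_cong[OF linear_map_sum[OF assms(3,4) add(3,4)] assms(3)])
      (simp add: linear_map_add[OF tensor_lift_linear[OF assms(1,2,4,5)]] add)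
qed

lemma tensor_lift_nested_left:
  assumes "module R A" "module R B" "module R C" "module R M"
    and "\<And>c. c \<in> carrier C \<Longrightarrow> bilinear R A B M (\<lambda>a b. f a b c)"
    and "\<And>a b. \<lbrakk>a \<in> carrier A; b \<in> carrier B\<rbrakk> \<Longrightarrow> linear_map R C M (f a b)"
  shows "bilinear R (tensor R A B) C M (\<lambda>x c. tensor_lift R M (\<lambda>a b. f a b c) x)"
  by (intro bilinearI tensor_lift_parameter[OF assms] tensor_lift_linear[OF assms(1,2,4,5)])

lemma tensor_lift_nested_right:
  assumes "module R A" "module R B" "module R C" "module R M"
    and "\<And>a. a \<in> carrier A \<Longrightarrow> bilinear R B C M (f a)"
    and "\<And>b c. \<lbrakk>b \<in> carrier B; c \<in> carrier C\<rbrakk> \<Longrightarrow> linear_map R A M (\<lambda>a. f a b c)"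
  shows "bilinear R A (tensor R B C) M (\<lambda>a y. tensor_lift R M (f a) y)"
  by (intro bilinearI tensor_lift_parameter[OF assms(2,3,1,4,5,6)] tensor_lift_linear[OF assms(2,3,4,5)])

lemmas pure_closed = bilinear_closed[OF pure_bilinear]
lemmas pure_left_linear = bilinear_left[OF pure_bilinear]
lemmas pure_right_linear = bilinear_right[OF pure_bilinear]

subsection \<open>Canonical maps\<close>

lemma tensor_map_linear:
  assumes "module R A" "module R B" "module R C" "module R D"
    and "linear_map R A C f" "linear_map R B D g"
  shows "linear_map R (tensor R A B) (tensor R C D) (tensor_map R C D f g)"
  unfolding tensor_map_def
  by (intro tensor_lift_linear tensor_module bilinear_compose[OF pure_bilinear] assms)

lemma tensor_map_pure:
  assumes "module R A" "module R B" "module R C" "module R D"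
    and "linear_map R A C f" "linear_map R B D g" "a \<in> carrier A" "b \<in> carrier B"
  shows "tensor_map R C D f g (pure R A B a b) = pure R C D (f a) (g b)"
  unfolding tensor_map_def
  by (intro tensor_lift_pure tensor_module bilinear_compose[OF pure_bilinear] assms)

lemma tensor_map_comp:
  assumes "module R A" "module R B" "module R C" "module R D" "module R E" "module R F"
    and "linear_map R A C f" "linear_map R B D g" "linear_map R C E h" "linear_map R D F k"
    and "t \<in> carrier (tensor R A B)"
  shows "tensor_map R E F h k (tensor_map R C D f g t) = tensor_map R E F (h \<circ> f) (k \<circ> g) t"
proof (rule tensor_ext[OF assms(1,2) _ _ _ assms(11)])
  show "linear_map R (tensor R A B) (tensor R E F) (\<lambda>t. tensor_map R E F h k (tensor_map R C D f g t))"
    by (rule linear_map_compose[OF tensor_map_linear[OF assms(1-4,7,8)] tensor_map_linear[OF assms(3-6,9,10)]])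
  show "linear_map R (tensor R A B) (tensor R E F) (tensor_map R E F (h \<circ> f) (k \<circ> g))"
    by (intro tensor_map_linear linear_map_comp[OF assms(7,9)] linear_map_comp[OF assms(8,10)] assms)
qed (simp add: tensor_map_pure[OF assms(1-4,7,8)] tensor_map_pure[OF assms(3-6,9,10)]
    tensor_map_pure[OF assms(1,2,5,6) linear_map_comp[OF assms(7,9)] linear_map_comp[OF assms(8,10)], unfolded comp_def]
    comp_def linear_map_closed[OF assms(7)] linear_map_closed[OF assms(8)])

lemma tensor_map_cong:
  assumes "module R A" "module R B" "module R C" "module R D"
    and "linear_map R A C f" "linear_map R B D g"
    and "\<And>a. a \<in> carrier A \<Longrightarrow> f a = f' a" "\<And>b. b \<in> carrier B \<Longrightarrow> g b = g' b"
    and "t \<in> carrier (tensor R A B)"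
  shows "tensor_map R C D f g t = tensor_map R C D f' g' t"
proof -
  have f': "linear_map R A C f'" by (rule linear_map_cong[OF assms(5,1,7)])
  have g': "linear_map R B D g'" by (rule linear_map_cong[OF assms(6,2,8)])
  show ?thesis
    by (rule tensor_ext[OF assms(1,2) tensor_map_linear[OF assms(1-6)] tensor_map_linear[OF assms(1-4) f' g'] _ assms(9)])
      (simp add: tensor_map_pure[OF assms(1-6)] tensor_map_pure[OF assms(1-4) f' g'] assms(7,8))
qed

lemma assoc_trilinear:
  assumes "module R A" "module R B" "module R C"
  defines "T \<equiv> tensor R A (tensor R B C)"
  shows "c \<in> carrier C \<Longrightarrow> bilinear R A B T (\<lambda>a b. pure R A (tensor R B C) a (pure R B C b c))"
    and "\<lbrakk>a \<in> carrier A; b \<in> carrier B\<rbrakk> \<Longrightarrow>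
      linear_map R C T (\<lambda>c. pure R A (tensor R B C) a (pure R B C b c))"
  unfolding T_def
  by (intro bilinear_compose[OF pure_bilinear linear_map_id(2) pure_left_linear] tensor_module assms; assumption?)
    (intro linear_map_compose[OF pure_right_linear pure_right_linear] tensor_module assms; assumption?)

lemma assoc_linear:
  assumes "module R A" "module R B" "module R C"
  shows "linear_map R (tensor R (tensor R A B) C) (tensor R A (tensor R B C)) (assoc R A B C)"
  unfolding assoc_def Let_def
  by (intro tensor_lift_linear tensor_lift_nested_left assoc_trilinear tensor_module assms)

lemma assoc_pure:
  assumes "module R A" "module R B" "module R C" "a \<in> carrier A" "b \<in> carrier B" "c \<in> carrier C"
  shows "assoc R A B C (pure R (tensor R A B) C (pure R A B a b) c) =
    pure R A (tensor R B C) a (pure R B C b c)"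
  unfolding assoc_def Let_def
  by (subst tensor_lift_pure[OF _ _ _ tensor_lift_nested_left])
    (simp_all add: assoc_trilinear tensor_lift_pure tensor_module pure_closed assms)

lemma assoc_inv_trilinear:
  assumes "module R A" "module R B" "module R C"
  defines "T \<equiv> tensor R (tensor R A B) C"
  shows "a \<in> carrier A \<Longrightarrow> bilinear R B C T (\<lambda>b c. pure R (tensor R A B) C (pure R A B a b) c)"
    and "\<lbrakk>b \<in> carrier B; c \<in> carrier C\<rbrakk> \<Longrightarrow>
      linear_map R A T (\<lambda>a. pure R (tensor R A B) C (pure R A B a b) c)"
  unfolding T_def
  by (intro bilinear_compose[OF pure_bilinear pure_right_linear linear_map_id(2)] tensor_module assms; assumption?)
    (intro linear_map_compose[OF pure_left_linear pure_left_linear] tensor_module assms; assumption?)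

lemma assoc_inv_linear:
  assumes "module R A" "module R B" "module R C"
  shows "linear_map R (tensor R A (tensor R B C)) (tensor R (tensor R A B) C) (assoc_inv R A B C)"
  unfolding assoc_inv_def Let_def
  by (intro tensor_lift_linear tensor_lift_nested_right assoc_inv_trilinear tensor_module assms)

lemma assoc_inv_pure:
  assumes "module R A" "module R B" "module R C" "a \<in> carrier A" "b \<in> carrier B" "c \<in> carrier C"
  shows "assoc_inv R A B C (pure R A (tensor R B C) a (pure R B C b c)) =
    pure R (tensor R A B) C (pure R A B a b) c"
  unfolding assoc_inv_def Let_def
  by (subst tensor_lift_pure[OF _ _ _ tensor_lift_nested_right])
    (simp_all add: assoc_inv_trilinear tensor_lift_pure tensor_module pure_closed assms)

lemma tensor_ext_left:
  assumes "module R A" "module R B" "module R C" "module R M"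
    and "linear_map R (tensor R (tensor R A B) C) M f" "linear_map R (tensor R (tensor R A B) C) M g"
    and "\<And>a b c. \<lbrakk>a \<in> carrier A; b \<in> carrier B; c \<in> carrier C\<rbrakk> \<Longrightarrow>
      f (pure R (tensor R A B) C (pure R A B a b) c) = g (pure R (tensor R A B) C (pure R A B a b) c)"
    and "t \<in> carrier (tensor R (tensor R A B) C)"
  shows "f t = g t"
proof (rule tensor_ext[OF tensor_module[OF assms(1,2)] assms(3,5,6) _ assms(8)])
  fix x c assume "x \<in> carrier (tensor R A B)" and c: "c \<in> carrier C"
  note lin = linear_map_compose[OF pure_left_linear[OF tensor_module[OF assms(1,2)] assms(3) c]]
  show "f (pure R (tensor R A B) C x c) = g (pure R (tensor R A B) C x c)"
    by (rule tensor_ext[OF assms(1,2) lin[OF assms(5)] lin[OF assms(6)]]) (fact | simp add: assms(7) c)+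
qed

lemma tensor_ext_right:
  assumes "module R A" "module R B" "module R C" "module R M"
    and "linear_map R (tensor R A (tensor R B C)) M f" "linear_map R (tensor R A (tensor R B C)) M g"
    and "\<And>a b c. \<lbrakk>a \<in> carrier A; b \<in> carrier B; c \<in> carrier C\<rbrakk> \<Longrightarrow>
      f (pure R A (tensor R B C) a (pure R B C b c)) = g (pure R A (tensor R B C) a (pure R B C b c))"
    and "t \<in> carrier (tensor R A (tensor R B C))"
  shows "f t = g t"
proof (rule tensor_ext[OF assms(1) tensor_module[OF assms(2,3)] assms(5,6) _ assms(8)])
  fix a y assume a: "a \<in> carrier A" and "y \<in> carrier (tensor R B C)"
  note lin = linear_map_compose[OF pure_right_linear[OF assms(1) tensor_module[OF assms(2,3)] a]]
  show "f (pure R A (tensor R B C) a y) = g (pure R A (tensor R B C) a y)"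
    by (rule tensor_ext[OF assms(2,3) lin[OF assms(5)] lin[OF assms(6)]]) (fact | simp add: assms(7) a)+
qed

lemma assoc_inv_assoc:
  assumes "module R A" "module R B" "module R C" "t \<in> carrier (tensor R (tensor R A B) C)"
  shows "assoc_inv R A B C (assoc R A B C t) = t"
  by (rule tensor_ext_left[OF assms(1-3) _ linear_map_compose[OF assoc_linear assoc_inv_linear]
        linear_map_id(2) _ assms(4)])
    (simp_all add: assms assoc_pure assoc_inv_pure tensor_module)

lemma assoc_natural:
  assumes "module R A" "module R B" "module R C" "module R A'" "module R B'" "module R C'"
    and "linear_map R A A' f" "linear_map R B B' g" "linear_map R C C' h"
    and "t \<in> carrier (tensor R (tensor R A B) C)"
  shows "assoc R A' B' C' (tensor_map R (tensor R A' B') C' (tensor_map R A' B' f g) h t) =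
    tensor_map R A' (tensor R B' C') f (tensor_map R B' C' g h) (assoc R A B C t)"
  by (rule tensor_ext_left[OF assms(1-3) _ linear_map_compose[OF tensor_map_linear assoc_linear]
        linear_map_compose[OF assoc_linear tensor_map_linear] _ assms(10)])
    (simp_all add: assms assoc_pure tensor_module tensor_map_linear tensor_map_pure[OF tensor_module]
      tensor_map_pure[OF assms(1) tensor_module] tensor_map_pure[OF assms(1,2,4,5,7,8)]
      tensor_map_pure[OF assms(2,3,5,6,8,9)] pure_closed linear_map_closed[OF assms(7)]
      linear_map_closed[OF assms(8)] linear_map_closed[OF assms(9)])

lemma twist_linear:
  assumes "module R A" "module R B"
  shows "linear_map R (tensor R A B) (tensor R B A) (twist R A B)"
  unfolding twist_def
  by (intro tensor_lift_linear tensor_module bilinear_flip[OF pure_bilinear] assms)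

lemma twist_pure:
  assumes "module R A" "module R B" "a \<in> carrier A" "b \<in> carrier B"
  shows "twist R A B (pure R A B a b) = pure R B A b a"
  unfolding twist_def
  by (intro tensor_lift_pure tensor_module bilinear_flip[OF pure_bilinear] assms)

lemma regular_module_simps [simp]:
  "carrier (regular_module R) = carrier R"
  "a \<oplus>\<^bsub>regular_module R\<^esub> b = a \<oplus>\<^bsub>R\<^esub> b"
  "a \<otimes>\<^bsub>regular_module R\<^esub> b = a \<otimes>\<^bsub>R\<^esub> b"
  "\<zero>\<^bsub>regular_module R\<^esub> = \<zero>\<^bsub>R\<^esub>"
  "a \<odot>\<^bsub>regular_module R\<^esub> b = a \<otimes>\<^bsub>R\<^esub> b"
  by (simp_all add: regular_module_def)

lemma regular_module_module:
  assumes "cring R"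
  shows "module R (regular_module R)"
proof -
  interpret cring R by fact
  show ?thesis
  proof (rule moduleI[OF assms])
    show "abelian_group (regular_module R)"
    proof (rule abelian_groupI)
      fix x assume "x \<in> carrier (regular_module R)"
      then show "\<exists>y\<in>carrier (regular_module R). y \<oplus>\<^bsub>regular_module R\<^esub> x = \<zero>\<^bsub>regular_module R\<^esub>"
        by (auto intro!: bexI[of _ "\<ominus>\<^bsub>R\<^esub> x"] simp: l_neg)
    qed (simp_all add: a_ac)
  qed (simp_all add: l_distr r_distr m_assoc)
qed

lemma smult_bilinear:
  assumes "module R M"
  shows "bilinear R (regular_module R) M M (\<lambda>r x. r \<odot>\<^bsub>M\<^esub> x)"
proof -
  interpret module R M by fact
  show ?thesis
    by (intro bilinearI linear_mapI)
      (simp_all add: smult_l_distr smult_r_distr smult_assoc1[symmetric] R.m_comm)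
qed

lemma lunit_linear:
  assumes "module R M"
  shows "linear_map R (tensor R (regular_module R) M) M (lunit R M)"
  unfolding lunit_def
  by (intro tensor_lift_linear regular_module_module module.axioms(1)[OF assms] smult_bilinear assms)

lemma lunit_pure:
  assumes "module R M" "r \<in> carrier R" "x \<in> carrier M"
  shows "lunit R M (pure R (regular_module R) M r x) = r \<odot>\<^bsub>M\<^esub> x"
  unfolding lunit_def
  by (rule tensor_lift_pure[OF regular_module_module[OF module.axioms(1)[OF assms(1)]] _ _ smult_bilinear])
    (simp_all add: assms)

lemma runit_linear:
  assumes "module R M"
  shows "linear_map R (tensor R M (regular_module R)) M (runit R M)"
  unfolding runit_def
  by (intro tensor_lift_linear regular_module_module module.axioms(1)[OF assms]
      bilinear_flip[OF smult_bilinear] assms)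

lemma runit_pure:
  assumes "module R M" "r \<in> carrier R" "x \<in> carrier M"
  shows "runit R M (pure R M (regular_module R) x r) = r \<odot>\<^bsub>M\<^esub> x"
  unfolding runit_def
  by (rule tensor_lift_pure[OF _ regular_module_module[OF module.axioms(1)[OF assms(1)]] _
        bilinear_flip[OF smult_bilinear]])
    (simp_all add: assms)

lemma middle_map_linear:
  assumes "module R A" "module R B" "module R C" "module R D" "module R E" "module R F"
    and "linear_map R (tensor R B C) (tensor R E F) f"
  shows "linear_map R (tensor R (tensor R A B) (tensor R C D)) (tensor R (tensor R A E) (tensor R F D))
    (middle_map R A B C D E F f)"
  unfolding middle_map_def
  by (rule linear_map_comp[OF assoc_linear linear_map_comp[OF tensor_map_linear assoc_inv_linear]]
      linear_map_comp[OF assoc_inv_linear linear_map_comp[OF tensor_map_linear assoc_linear]]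
      tensor_module linear_map_id(1) assms)+

text \<open>The value of \<open>f\<close> on a pure tensor is in general not pure, so the
  reassociations around it cannot be evaluated here and stay in the formula.\<close>

lemma middle_map_pure:
  assumes "module R A" "module R B" "module R C" "module R D" "module R E" "module R F"
    and "linear_map R (tensor R B C) (tensor R E F) f"
    and "a \<in> carrier A" "b \<in> carrier B" "c \<in> carrier C" "d \<in> carrier D"
  shows "middle_map R A B C D E F f (pure R (tensor R A B) (tensor R C D) (pure R A B a b) (pure R C D c d)) =
    assoc_inv R A E (tensor R F D) (pure R A (tensor R E (tensor R F D)) a
      (assoc R E F D (pure R (tensor R E F) D (f (pure R B C b c)) d)))"
proof -
  note lin = linear_map_comp[OF assoc_inv_linear[OF assms(2-4)] linear_map_comp[OF
      tensor_map_linear[OF tensor_module[OF assms(2,3)] assms(4) tensor_module[OF assms(5,6)] assms(4)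
        assms(7) linear_map_id(1)] assoc_linear[OF assms(5,6,4)]]]
  show ?thesis
    unfolding middle_map_def
    by (simp add: assms assoc_pure tensor_module pure_closed
        tensor_map_pure[OF assms(1) tensor_module[OF assms(2) tensor_module[OF assms(3,4)]] assms(1)
          tensor_module[OF assms(5) tensor_module[OF assms(6,4)]] linear_map_id(1) lin]
        tensor_map_pure[OF tensor_module[OF assms(2,3)] assms(4) tensor_module[OF assms(5,6)] assms(4)
        assms(7) linear_map_id(1)] assoc_inv_pure[OF assms(2-4)])
qed

lemma middle_map_twist_pure:
  assumes "module R A" "module R B" "module R C" "module R D"
    and "a \<in> carrier A" "b \<in> carrier B" "c \<in> carrier C" "d \<in> carrier D"
  shows "middle_map R A B C D C B (twist R B C)
      (pure R (tensor R A B) (tensor R C D) (pure R A B a b) (pure R C D c d)) =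
    pure R (tensor R A C) (tensor R B D) (pure R A C a c) (pure R B D b d)"
  by (simp add: middle_map_pure assms twist_linear twist_pure assoc_pure assoc_inv_pure tensor_module
      pure_closed)

section \<open>Tensor products of algebras\<close>

text \<open>\<open>tensor\<close> and \<open>pure\<close> read only carrier, addition and scalar
  multiplication. Structures that differ in product or unit have literally the same tensor products,
  so \<open>tensor_algebra\<close> may be replaced by \<open>tensor\<close> inside nested tensor
  products.\<close>

lemma tensor_cong:
  assumes "carrier A = carrier A'" "add A = add A'" "smult A = smult A'"
    and "carrier B = carrier B'" "add B = add B'" "smult B = smult B'"
  shows "tensor R A B = tensor R A' B'" "pure R A B = pure R A' B'"
proof -
  have null: "tensor_null R A B = tensor_null R A' B'"
    unfolding tensor_null_def tensor_relators_def Let_def assms ..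
  show "tensor R A B = tensor R A' B'"
    unfolding tensor_def null assms ..
  show "pure R A B = pure R A' B'"
    unfolding pure_def null assms ..
qed

lemma linear_map_cong_module:
  assumes "carrier A = carrier A'" "add A = add A'" "smult A = smult A'"
    and "carrier B = carrier B'" "add B = add B'" "smult B = smult B'"
  shows "linear_map R A B f = linear_map R A' B' f"
  unfolding linear_map_def hom_def assms monoid.simps partial_object.simps ..

lemma tensor_algebra_simps [simp]:
  "carrier (tensor_algebra R A B) = carrier (tensor R A B)"
  "add (tensor_algebra R A B) = add (tensor R A B)"
  "smult (tensor_algebra R A B) = smult (tensor R A B)"
  "zero (tensor_algebra R A B) = zero (tensor R A B)"
  "one (tensor_algebra R A B) = pure R A B \<one>\<^bsub>A\<^esub> \<one>\<^bsub>B\<^esub>"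
  by (simp_all add: tensor_algebra_def)

lemma tensor_of_tensor_algebra [simp]:
  "tensor R (tensor_algebra R A B) C = tensor R (tensor R A B) C"
  "tensor R C (tensor_algebra R A B) = tensor R C (tensor R A B)"
  "pure R (tensor_algebra R A B) C = pure R (tensor R A B) C"
  "pure R C (tensor_algebra R A B) = pure R C (tensor R A B)"
  "linear_map R (tensor_algebra R A B) C f = linear_map R (tensor R A B) C f"
  "linear_map R C (tensor_algebra R A B) g = linear_map R C (tensor R A B) g"
  by (rule tensor_cong linear_map_cong_module; simp)+

lemma tensor_map_tensor_algebra [simp]:
  "tensor_map R (tensor_algebra R A B) C = tensor_map R (tensor R A B) C"
  "tensor_map R C (tensor_algebra R A B) = tensor_map R C (tensor R A B)"
  by (intro ext; simp add: tensor_map_def)+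

lemma module_tensor_algebra:
  assumes "module R A" "module R B"
  shows "module R (tensor_algebra R A B)"
proof -
  interpret module R "tensor R A B" by (rule tensor_module) fact+
  show ?thesis
    by (intro moduleI abelian_groupI is_cring)
      (auto simp: a_ac smult_l_distr smult_r_distr smult_assoc1 intro!: exI[of _ "\<ominus>\<^bsub>tensor R A B\<^esub> _"]
        bexI[of _ "\<ominus>\<^bsub>tensor R A B\<^esub> _"] l_neg)
qed

lemma assoc_algebraI:
  assumes "module R A" "bilinear R A A A (mult A)" "\<one>\<^bsub>A\<^esub> \<in> carrier A"
    and "\<And>x y z. \<lbrakk>x \<in> carrier A; y \<in> carrier A; z \<in> carrier A\<rbrakk> \<Longrightarrow>
      (x \<otimes>\<^bsub>A\<^esub> y) \<otimes>\<^bsub>A\<^esub> z = x \<otimes>\<^bsub>A\<^esub> (y \<otimes>\<^bsub>A\<^esub> z)"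
    and "\<And>x. x \<in> carrier A \<Longrightarrow> \<one>\<^bsub>A\<^esub> \<otimes>\<^bsub>A\<^esub> x = x" "\<And>x. x \<in> carrier A \<Longrightarrow> x \<otimes>\<^bsub>A\<^esub> \<one>\<^bsub>A\<^esub> = x"
  shows "assoc_algebra R A"
proof -
  interpret module R A by fact
  note lin = bilinear_left[OF assms(2)] bilinear_right[OF assms(2)]
  have "ring A"
    by (intro ringI M.abelian_group_axioms monoidI)
      (simp_all add: assms bilinear_closed[OF assms(2)] linear_map_add[OF lin(1)] linear_map_add[OF lin(2)])
  then show ?thesis
    by (intro assoc_algebra.intro assoc_algebra_axioms.intro assms)
      (simp_all add: linear_map_smult[OF lin(1)] linear_map_smult[OF lin(2)])
qed

lemma assoc_algebra_module: "assoc_algebra R A \<Longrightarrow> module R A"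
  by (simp add: assoc_algebra_def)

lemma assoc_algebra_ring: "assoc_algebra R A \<Longrightarrow> ring A"
  by (simp add: assoc_algebra_def)

lemma mult_bilinear:
  assumes "assoc_algebra R A"
  shows "bilinear R A A A (mult A)"
proof -
  interpret assoc_algebra R A by fact
  show ?thesis
    by (intro bilinearI linear_mapI)
      (simp_all add: A.l_distr A.r_distr smult_mult_left smult_mult_right)
qed

lemmas mult_left_linear = bilinear_left[OF mult_bilinear]
lemmas mult_right_linear = bilinear_right[OF mult_bilinear]

lemma mult_map_linear:
  assumes "assoc_algebra R A"
  shows "linear_map R (tensor R A A) A (mult_map R A)"
  unfolding mult_map_def
  by (intro tensor_lift_linear mult_bilinear assoc_algebra_module assms)

lemma mult_map_pure:
  assumes "assoc_algebra R A" "x \<in> carrier A" "y \<in> carrier A"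
  shows "mult_map R A (pure R A A x y) = x \<otimes>\<^bsub>A\<^esub> y"
  unfolding mult_map_def
  by (intro tensor_lift_pure mult_bilinear assoc_algebra_module assms)

lemma tensor_algebra_mult_bilinear:
  assumes "assoc_algebra R A" "assoc_algebra R B"
  shows "bilinear R (tensor R A B) (tensor R A B) (tensor R A B) (mult (tensor_algebra R A B))"
proof -
  note m = assoc_algebra_module[OF assms(1)] assoc_algebra_module[OF assms(2)]
  have "linear_map R (tensor R (tensor R A B) (tensor R A B)) (tensor R A B)
    (tensor_map R A B (mult_map R A) (mult_map R B) \<circ> middle_map R A B A B A B (twist R B A))"
    by (intro linear_map_comp[OF middle_map_linear tensor_map_linear] tensor_module mult_map_linear
        twist_linear m assms)
  then show ?thesis
    unfolding tensor_algebra_def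
    using bilinear_postcompose[OF pure_bilinear[OF tensor_module[OF m] tensor_module[OF m]]] by fastforce
qed

lemma tensor_algebra_mult_pure:
  assumes "assoc_algebra R A" "assoc_algebra R B"
    and "a \<in> carrier A" "b \<in> carrier B" "a' \<in> carrier A" "b' \<in> carrier B"
  shows "pure R A B a b \<otimes>\<^bsub>tensor_algebra R A B\<^esub> pure R A B a' b' =
    pure R A B (a \<otimes>\<^bsub>A\<^esub> a') (b \<otimes>\<^bsub>B\<^esub> b')"
proof -
  note m = assoc_algebra_module[OF assms(1)] assoc_algebra_module[OF assms(2)]
  show ?thesis
    by (simp add: tensor_algebra_def middle_map_twist_pure m assms mult_map_pure
        tensor_map_pure[OF tensor_module[OF m(1,1)] tensor_module[OF m(2,2)] m mult_map_linear[OF assms(1)]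
          mult_map_linear[OF assms(2)]] pure_closed)
qed

lemma tensor_algebra_assoc_algebra:
  assumes "assoc_algebra R A" "assoc_algebra R B"
  shows "assoc_algebra R (tensor_algebra R A B)"
proof -
  interpret A: assoc_algebra R A by fact
  interpret B: assoc_algebra R B by fact
  let ?T = "tensor_algebra R A B"
  note m = A.module_axioms B.module_axioms
  note bil = tensor_algebra_mult_bilinear[OF assms]
  note left = bilinear_left[OF bil] and right = bilinear_right[OF bil]
  note closed [simp] = bilinear_closed[OF bil] bilinear_closed[OF pure_bilinear[OF m]]
  note [simp] = tensor_algebra_mult_pure[OF assms]
  show ?thesis
  proof (rule assoc_algebraI[OF module_tensor_algebra[OF m]])
    show "bilinear R ?T ?T ?T (mult ?T)"
      using bil by (simp add: bilinear_def)
    fix x assume "x \<in> carrier ?T"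
    then have x: "x \<in> carrier (tensor R A B)" by simp
    show "\<one>\<^bsub>?T\<^esub> \<otimes>\<^bsub>?T\<^esub> x = x"
      by (rule tensor_ext[OF m right linear_map_id(2) _ x]) simp_all
    show "x \<otimes>\<^bsub>?T\<^esub> \<one>\<^bsub>?T\<^esub> = x"
      by (rule tensor_ext[OF m left linear_map_id(2) _ x]) simp_all
    fix y assume "y \<in> carrier ?T"
    then have y: "y \<in> carrier (tensor R A B)" by simp
    fix z assume "z \<in> carrier ?T"
    then have z: "z \<in> carrier (tensor R A B)" by simp
    show "(x \<otimes>\<^bsub>?T\<^esub> y) \<otimes>\<^bsub>?T\<^esub> z = x \<otimes>\<^bsub>?T\<^esub> (y \<otimes>\<^bsub>?T\<^esub> z)"
    proof (rule tensor_ext[OF m linear_map_compose[OF left left] left _ x])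
      fix a b assume ab: "a \<in> carrier A" "b \<in> carrier B"
      show "(pure R A B a b \<otimes>\<^bsub>?T\<^esub> y) \<otimes>\<^bsub>?T\<^esub> z = pure R A B a b \<otimes>\<^bsub>?T\<^esub> (y \<otimes>\<^bsub>?T\<^esub> z)"
      proof (rule tensor_ext[OF m linear_map_compose[OF right left] linear_map_compose[OF left right] _ y])
        fix a' b' assume ab': "a' \<in> carrier A" "b' \<in> carrier B"
        show "(pure R A B a b \<otimes>\<^bsub>?T\<^esub> pure R A B a' b') \<otimes>\<^bsub>?T\<^esub> z =
          pure R A B a b \<otimes>\<^bsub>?T\<^esub> (pure R A B a' b' \<otimes>\<^bsub>?T\<^esub> z)"
          by (rule tensor_ext[OF m right linear_map_compose[OF right right] _ z])
            (simp_all add: ab ab' A.A.m_assoc B.A.m_assoc)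
      qed (simp_all add: ab z)
    qed (simp_all add: y z)
  qed simp
qed

definition algebra_hom ::
  "('r, 'q) ring_scheme \<Rightarrow> ('r, 'a, 'm) module_scheme \<Rightarrow> ('r, 'b, 'n) module_scheme \<Rightarrow> ('a \<Rightarrow> 'b) \<Rightarrow> bool"
where
  "algebra_hom R A B f \<longleftrightarrow> linear_map R A B f \<and> f \<one>\<^bsub>A\<^esub> = \<one>\<^bsub>B\<^esub> \<and>
    (\<forall>x\<in>carrier A. \<forall>y\<in>carrier A. f (x \<otimes>\<^bsub>A\<^esub> y) = f x \<otimes>\<^bsub>B\<^esub> f y)"

lemma algebra_hom_linear: "algebra_hom R A B f \<Longrightarrow> linear_map R A B f"
  and algebra_hom_one: "algebra_hom R A B f \<Longrightarrow> f \<one>\<^bsub>A\<^esub> = \<one>\<^bsub>B\<^esub>"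
  and algebra_hom_mult: "\<lbrakk>algebra_hom R A B f; x \<in> carrier A; y \<in> carrier A\<rbrakk> \<Longrightarrow>
    f (x \<otimes>\<^bsub>A\<^esub> y) = f x \<otimes>\<^bsub>B\<^esub> f y"
  by (auto simp: algebra_hom_def)

lemmas algebra_hom_closed = linear_map_closed[OF algebra_hom_linear]

text \<open>Both sides are bilinear in \<open>x\<close> and \<open>y\<close>, so multiplicativity is
  decided on pure tensors.\<close>

lemma mult_preserving_tensor:
  assumes "assoc_algebra R A" "assoc_algebra R B" "assoc_algebra R C"
    and "linear_map R (tensor R A B) C f"
    and "\<And>a b a' b'. \<lbrakk>a \<in> carrier A; b \<in> carrier B; a' \<in> carrier A; b' \<in> carrier B\<rbrakk> \<Longrightarrow>
      f (pure R A B (a \<otimes>\<^bsub>A\<^esub> a') (b \<otimes>\<^bsub>B\<^esub> b')) = f (pure R A B a b) \<otimes>\<^bsub>C\<^esub> f (pure R A B a' b')"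
    and x: "x \<in> carrier (tensor R A B)" and y: "y \<in> carrier (tensor R A B)"
  shows "f (x \<otimes>\<^bsub>tensor_algebra R A B\<^esub> y) = f x \<otimes>\<^bsub>C\<^esub> f y"
proof -
  note m = assoc_algebra_module[OF assms(1)] assoc_algebra_module[OF assms(2)]
  show ?thesis
    by (rule tensor_ext2[OF m m bilinear_postcompose[OF tensor_algebra_mult_bilinear[OF assms(1,2)] assms(4)]
          bilinear_compose[OF mult_bilinear[OF assms(3)] assms(4,4)] _ x y])
      (simp add: tensor_algebra_mult_pure assms(1,2,5))
qed

lemma algebra_hom_tensorI:
  assumes "assoc_algebra R A" "assoc_algebra R B" "assoc_algebra R C"
    and "linear_map R (tensor R A B) C f" "f (pure R A B \<one>\<^bsub>A\<^esub> \<one>\<^bsub>B\<^esub>) = \<one>\<^bsub>C\<^esub>"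
    and "\<And>a b a' b'. \<lbrakk>a \<in> carrier A; b \<in> carrier B; a' \<in> carrier A; b' \<in> carrier B\<rbrakk> \<Longrightarrow>
      f (pure R A B (a \<otimes>\<^bsub>A\<^esub> a') (b \<otimes>\<^bsub>B\<^esub> b')) = f (pure R A B a b) \<otimes>\<^bsub>C\<^esub> f (pure R A B a' b')"
  shows "algebra_hom R (tensor_algebra R A B) C f"
  using mult_preserving_tensor[OF assms(1-4,6)] assms(4,5) by (simp add: algebra_hom_def)

lemma algebra_hom_compose:
  assumes "algebra_hom R A B f" "algebra_hom R B C g"
  shows "algebra_hom R A C (\<lambda>x. g (f x))"
  using assms linear_map_compose[OF algebra_hom_linear[OF assms(1)] algebra_hom_linear[OF assms(2)]]
  by (simp add: algebra_hom_def linear_map_closed[OF algebra_hom_linear[OF assms(1)]])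

lemma tensor_map_algebra_hom:
  assumes "assoc_algebra R A" "assoc_algebra R B" "assoc_algebra R C" "assoc_algebra R D"
    and "algebra_hom R A C f" "algebra_hom R B D g"
  shows "algebra_hom R (tensor_algebra R A B) (tensor_algebra R C D) (tensor_map R C D f g)"
proof -
  interpret A: assoc_algebra R A by fact
  interpret B: assoc_algebra R B by fact
  note m = assms(1-4)[THEN assoc_algebra_module]
  note lin = assms(5,6)[THEN algebra_hom_linear]
  note [simp] = tensor_map_pure[OF m lin] linear_map_closed[OF lin(1)] linear_map_closed[OF lin(2)]
    algebra_hom_one[OF assms(5)] algebra_hom_one[OF assms(6)] algebra_hom_mult[OF assms(5)]
    algebra_hom_mult[OF assms(6)] tensor_algebra_mult_pure[OF assms(3,4)]
  show ?thesis
    by (rule algebra_hom_tensorI[OF assms(1,2) tensor_algebra_assoc_algebra[OF assms(3,4)]])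
      (simp_all add: tensor_map_linear[OF m lin])
qed

lemma pure_one_algebra_hom:
  assumes "assoc_algebra R A" "assoc_algebra R B"
  shows "algebra_hom R A (tensor_algebra R A B) (\<lambda>a. pure R A B a \<one>\<^bsub>B\<^esub>)"
    and "algebra_hom R B (tensor_algebra R A B) (\<lambda>b. pure R A B \<one>\<^bsub>A\<^esub> b)"
proof -
  interpret A: assoc_algebra R A by fact
  interpret B: assoc_algebra R B by fact
  show "algebra_hom R A (tensor_algebra R A B) (\<lambda>a. pure R A B a \<one>\<^bsub>B\<^esub>)"
    "algebra_hom R B (tensor_algebra R A B) (\<lambda>b. pure R A B \<one>\<^bsub>A\<^esub> b)"
    by (simp_all add: algebra_hom_def tensor_algebra_mult_pure assms pure_left_linear pure_right_linear
        A.module_axioms B.module_axioms)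
qed

text \<open>Products are formed leg by leg under either bracketing. The reduction to pure tensors
  has two stages: \<open>algebra_hom_tensorI\<close> leaves the factors \<open>y\<close> and
  \<open>y'\<close> in the inner tensor product arbitrary, and \<open>tensor_ext2\<close> splits
  these.\<close>

lemma tensor_algebra_assoc_hom:
  assumes "assoc_algebra R A" "assoc_algebra R B" "assoc_algebra R C"
  shows "algebra_hom R (tensor_algebra R A (tensor_algebra R B C))
      (tensor_algebra R (tensor_algebra R A B) C) (assoc_inv R A B C)"
    and "algebra_hom R (tensor_algebra R (tensor_algebra R A B) C)
      (tensor_algebra R A (tensor_algebra R B C)) (assoc R A B C)"
proof -
  interpret A: assoc_algebra R A by fact
  interpret B: assoc_algebra R B by fact
  interpret C: assoc_algebra R C by fact
  note m = assms[THEN assoc_algebra_module]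
  let ?AB = "tensor_algebra R A B" and ?BC = "tensor_algebra R B C"
  have AB: "assoc_algebra R ?AB" and BC: "assoc_algebra R ?BC"
    using assms by (auto intro: tensor_algebra_assoc_algebra)
  have L: "assoc_algebra R (tensor_algebra R ?AB C)" and RR: "assoc_algebra R (tensor_algebra R A ?BC)"
    using assms AB BC by (auto intro: tensor_algebra_assoc_algebra)
  note mult [simp] = tensor_algebra_mult_pure[OF AB assms(3), simplified]
    tensor_algebra_mult_pure[OF assms(1) BC, simplified]
    tensor_algebra_mult_pure[OF assms(1,2)] tensor_algebra_mult_pure[OF assms(2,3)]
    bilinear_closed[OF pure_bilinear[OF m(1,2)]] bilinear_closed[OF pure_bilinear[OF m(2,3)]]
    assoc_pure[OF m] assoc_inv_pure[OF m]
  note closed [simp] = bilinear_closed[OF tensor_algebra_mult_bilinear[OF assms(1,2)]]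
    bilinear_closed[OF tensor_algebra_mult_bilinear[OF assms(2,3)]]
  let ?f = "assoc_inv R A B C" and ?g = "assoc R A B C"
  let ?pr = "pure R A (tensor R B C)" and ?pl = "pure R (tensor R A B) C"
  note lin = assoc_inv_linear[OF m] assoc_linear[OF m]
  have f: "?f (?pr (a \<otimes>\<^bsub>A\<^esub> a') (y \<otimes>\<^bsub>?BC\<^esub> y')) =
      ?f (?pr a y) \<otimes>\<^bsub>tensor_algebra R ?AB C\<^esub> ?f (?pr a' y')"
    if "a \<in> carrier A" "a' \<in> carrier A" "y \<in> carrier (tensor R B C)" "y' \<in> carrier (tensor R B C)" for a a' y y'
  proof -
    note p = pure_right_linear[OF m(1) tensor_module[OF m(2,3)]]
    note bil = tensor_algebra_mult_bilinear[OF assms(2,3)]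
    note q = linear_map_compose[OF p lin(1)]
    show ?thesis
      by (rule tensor_ext2[OF m(2,3) m(2,3) bilinear_postcompose[OF bil q]
            bilinear_compose[OF tensor_algebra_mult_bilinear[OF AB assms(3), simplified] q q] _ that(3,4)])
        (use that in \<open>simp_all add: pure_closed tensor_module m\<close>)
  qed
  show "algebra_hom R (tensor_algebra R A ?BC) (tensor_algebra R ?AB C) ?f"
    by (rule algebra_hom_tensorI[OF assms(1) BC L]) (simp_all add: lin f)
  have g: "?g (?pl (y \<otimes>\<^bsub>?AB\<^esub> y') (c \<otimes>\<^bsub>C\<^esub> c')) =
      ?g (?pl y c) \<otimes>\<^bsub>tensor_algebra R A ?BC\<^esub> ?g (?pl y' c')"
    if "c \<in> carrier C" "c' \<in> carrier C" "y \<in> carrier (tensor R A B)" "y' \<in> carrier (tensor R A B)" for c c' y y'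
  proof -
    note p = pure_left_linear[OF tensor_module[OF m(1,2)] m(3)]
    note bil = tensor_algebra_mult_bilinear[OF assms(1,2)]
    note q = linear_map_compose[OF p lin(2)]
    show ?thesis
      by (rule tensor_ext2[OF m(1,2) m(1,2) bilinear_postcompose[OF bil q]
            bilinear_compose[OF tensor_algebra_mult_bilinear[OF assms(1) BC, simplified] q q] _ that(3,4)])
        (use that in \<open>simp_all add: pure_closed tensor_module m\<close>)
  qed
  show "algebra_hom R (tensor_algebra R ?AB C) (tensor_algebra R A ?BC) ?g"
    by (rule algebra_hom_tensorI[OF AB assms(3) RR]) (simp_all add: lin g)
qed

section \<open>The algebra of a weak distributive law\<close>

locale weak_distributive = A: assoc_algebra R A + B: assoc_algebra R B
  for R :: "('r, 'q) ring_scheme" (structure)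
    and A :: "('r, 'a, 'm) module_scheme" and B :: "('r, 'b, 'n) module_scheme" +
  fixes \<psi> :: "('r, 'a, 'b) tens \<Rightarrow> ('r, 'b, 'a) tens"
  assumes weak_distributive_law: "weak_distributive_law R A B \<psi>"
begin

abbreviation X where "X \<equiv> tensor R B A"
abbreviation Y where "Y \<equiv> tensor R A B"
abbreviation pX where "pX \<equiv> pure R B A"
abbreviation pY where "pY \<equiv> pure R A B"

text \<open>\<open>B\<close> acts on the left leg and \<open>A\<close> on the right leg of
  \<open>B \<otimes> A\<close>. These commuting actions take the place of the associators in the
  axioms of a weak distributive law and in the formula for the product.\<close>

definition lact where "lact b = tensor_map R B A (\<lambda>x. b \<otimes>\<^bsub>B\<^esub> x) id"
definition ract where "ract a = tensor_map R B A id (\<lambda>x. x \<otimes>\<^bsub>A\<^esub> a)"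
text \<open>The multiplication of the weak wreath product before restriction to the image. Its
  values lie in the image of multiplication by \<open>j\<close>, so on all of
  \<open>B \<otimes> A\<close> there is in general no unit.\<close>

definition wprod (infixl \<open>\<bullet>\<close> 70) where
  "x \<bullet> y = (tensor_map R B A (mult_map R B) (mult_map R A) \<circ> middle_map R B A B A B A \<psi>) (pure R X X x y)"
definition j where "j = pX \<one>\<^bsub>B\<^esub> \<one>\<^bsub>A\<^esub>"
definition iA where "iA a = \<psi> (pY a \<one>\<^bsub>B\<^esub>)"
definition iB where "iB b = \<psi> (pY \<one>\<^bsub>A\<^esub> b)"

lemmas mA = A.module_axioms and mB = B.module_axioms
lemmas aA = A.assoc_algebra_axioms and aB = B.assoc_algebra_axioms
lemmas mX = tensor_module[OF mB mA] and mY = tensor_module[OF mA mB]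

lemma psi_linear: "linear_map R Y X \<psi>"
  using weak_distributive_law by (simp add: weak_distributive_law_def)

lemmas psi_closed [simp] = linear_map_closed[OF psi_linear]
lemmas pX_closed [simp] = pure_closed[OF mB mA]
lemmas pY_closed [simp] = pure_closed[OF mA mB]

section \<open>Commuting module actions on B \<otimes> A\<close>

lemma B_left_linear: "b \<in> carrier B \<Longrightarrow> linear_map R B B (\<lambda>x. b \<otimes>\<^bsub>B\<^esub> x)"
  and A_right_linear: "a \<in> carrier A \<Longrightarrow> linear_map R A A (\<lambda>x. x \<otimes>\<^bsub>A\<^esub> a)"
  by (rule mult_right_linear[OF aB] mult_left_linear[OF aA]; assumption)+

lemma lact_linear: "b \<in> carrier B \<Longrightarrow> linear_map R X X (lact b)"
  unfolding lact_def by (intro tensor_map_linear B_left_linear linear_map_id mA mB)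

lemma ract_linear: "a \<in> carrier A \<Longrightarrow> linear_map R X X (ract a)"
  unfolding ract_def by (intro tensor_map_linear A_right_linear linear_map_id mA mB)

lemmas lact_closed [simp] = linear_map_closed[OF lact_linear]
lemmas ract_closed [simp] = linear_map_closed[OF ract_linear]

lemma lact_pure [simp]:
  "\<lbrakk>b \<in> carrier B; b' \<in> carrier B; a \<in> carrier A\<rbrakk> \<Longrightarrow> lact b (pX b' a) = pX (b \<otimes>\<^bsub>B\<^esub> b') a"
  unfolding lact_def by (simp add: tensor_map_pure[OF mB mA mB mA B_left_linear linear_map_id(1)])

lemma ract_pure [simp]:
  "\<lbrakk>a \<in> carrier A; b' \<in> carrier B; a' \<in> carrier A\<rbrakk> \<Longrightarrow> ract a (pX b' a') = pX b' (a' \<otimes>\<^bsub>A\<^esub> a)"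
  unfolding ract_def by (simp add: tensor_map_pure[OF mB mA mB mA linear_map_id(1) A_right_linear])

lemma lact_lact:
  assumes "b \<in> carrier B" "b' \<in> carrier B" "x \<in> carrier X"
  shows "lact b (lact b' x) = lact (b \<otimes>\<^bsub>B\<^esub> b') x"
  by (rule tensor_ext[OF mB mA linear_map_compose[OF lact_linear lact_linear] lact_linear _ assms(3)])
    (simp_all add: assms B.A.m_assoc)

lemma ract_ract:
  assumes "a \<in> carrier A" "a' \<in> carrier A" "x \<in> carrier X"
  shows "ract a (ract a' x) = ract (a' \<otimes>\<^bsub>A\<^esub> a) x"
  by (rule tensor_ext[OF mB mA linear_map_compose[OF ract_linear ract_linear] ract_linear _ assms(3)])
    (simp_all add: assms A.A.m_assoc)

lemma lact_ract:
  assumes "b \<in> carrier B" "a \<in> carrier A" "x \<in> carrier X"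
  shows "lact b (ract a x) = ract a (lact b x)"
  by (rule tensor_ext[OF mB mA linear_map_compose[OF ract_linear lact_linear]
        linear_map_compose[OF lact_linear ract_linear] _ assms(3)])
    (simp_all add: assms)

lemma lact_one [simp]: "x \<in> carrier X \<Longrightarrow> lact \<one>\<^bsub>B\<^esub> x = x"
  and ract_one [simp]: "x \<in> carrier X \<Longrightarrow> ract \<one>\<^bsub>A\<^esub> x = x"
  by (rule tensor_ext[OF mB mA lact_linear linear_map_id(2)]
      tensor_ext[OF mB mA ract_linear linear_map_id(2)]; simp)+

text \<open>Recognises a reassociation followed by a multiplication, as it ends the axioms for
  \<psi>, as the right action; both sides are linear in \<open>x\<close>.
  \<open>lact_assoc_inv\<close> is the mirror image.\<close>

lemma ract_assoc:
  assumes "a \<in> carrier A" "x \<in> carrier X"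
  shows "tensor_map R B A id (mult_map R A) (assoc R B A A (pure R X A x a)) = ract a x"
  by (rule tensor_ext[OF mB mA linear_map_compose[OF linear_map_compose[OF pure_left_linear[OF mX mA assms(1)]
          assoc_linear[OF mB mA mA]] tensor_map_linear[OF mB tensor_module[OF mA mA] mB mA linear_map_id(1)
          mult_map_linear[OF aA]]] ract_linear[OF assms(1)] _ assms(2)])
    (simp add: assms(1) assoc_pure mA mB tensor_map_pure[OF mB tensor_module[OF mA mA] mB mA linear_map_id(1)
      mult_map_linear[OF aA]] pure_closed mult_map_pure aA)

lemma lact_assoc_inv:
  assumes "b \<in> carrier B" "x \<in> carrier X"
  shows "tensor_map R B A (mult_map R B) id (assoc_inv R B B A (pure R B X b x)) = lact b x"
  by (rule tensor_ext[OF mB mA linear_map_compose[OF linear_map_compose[OF pure_right_linear[OF mB mX assms(1)]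
          assoc_inv_linear[OF mB mB mA]] tensor_map_linear[OF tensor_module[OF mB mB] mA mB mA
          mult_map_linear[OF aB] linear_map_id(1)]] lact_linear[OF assms(1)] _ assms(2)])
    (simp add: assms(1) assoc_inv_pure mA mB tensor_map_pure[OF tensor_module[OF mB mB] mA mB mA
          mult_map_linear[OF aB] linear_map_id(1)] pure_closed mult_map_pure aB)

section \<open>The associative product on B \<otimes> A\<close>

lemma wprod_bilinear: "bilinear R X X X (\<bullet>)"
proof -
  have "linear_map R (tensor R X X) X
    (tensor_map R B A (mult_map R B) (mult_map R A) \<circ> middle_map R B A B A B A \<psi>)"
    by (intro linear_map_comp[OF middle_map_linear tensor_map_linear] tensor_module mult_map_linear
        psi_linear mA mB aA aB)
  from bilinear_postcompose[OF pure_bilinear[OF mX mX] this] show ?thesis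
    unfolding wprod_def[abs_def] .
qed

lemmas wprod_left_linear = bilinear_left[OF wprod_bilinear]
lemmas wprod_right_linear = bilinear_right[OF wprod_bilinear]
lemmas wprod_closed [simp] = bilinear_closed[OF wprod_bilinear]

lemma wprod_pure:
  assumes "b \<in> carrier B" "a \<in> carrier A" "b' \<in> carrier B" "a' \<in> carrier A"
  shows "pX b a \<bullet> pX b' a' = lact b (ract a' (\<psi> (pY a b')))"
proof -
  \<comment> \<open>Stated for arbitrary \<open>x\<close> because it is applied to x = \<psi>(a
    \<otimes> b'), which need not be pure; linearity reduces it to pure tensors.\<close>
  have "tensor_map R B A (mult_map R B) (mult_map R A) (assoc_inv R B B (tensor R A A)
      (pure R B (tensor R B (tensor R A A)) b (assoc R B A A (pure R X A x a')))) = lact b (ract a' x)"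
    if x: "x \<in> carrier X" for x
  proof (rule tensor_ext[OF mB mA _ _ _ x])
    show "linear_map R X X (\<lambda>x. tensor_map R B A (mult_map R B) (mult_map R A)
      (assoc_inv R B B (tensor R A A)
      (pure R B (tensor R B (tensor R A A)) b (assoc R B A A (pure R X A x a')))))"
      by (rule linear_map_compose[OF linear_map_compose[OF linear_map_compose[OF linear_map_compose[OF
            pure_left_linear assoc_linear] pure_right_linear] assoc_inv_linear] tensor_map_linear])
        (intro tensor_module mA mB assms mult_map_linear aA aB)+
    show "linear_map R X X (\<lambda>x. lact b (ract a' x))"
      by (intro linear_map_compose[OF ract_linear lact_linear] assms)
  qed (simp add: assms assoc_pure assoc_inv_pure tensor_module mA mB pure_closed mult_map_pure aA aB
        tensor_map_pure[OF tensor_module[OF mB mB] tensor_module[OF mA mA] mB mA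
          mult_map_linear[OF aB] mult_map_linear[OF aA]])
  then show ?thesis
    by (simp add: wprod_def middle_map_pure mA mB psi_linear assms)
qed

lemma wprod_lact:
  assumes "b \<in> carrier B" "x \<in> carrier X" "y \<in> carrier X"
  shows "lact b x \<bullet> y = lact b (x \<bullet> y)"
  by (rule tensor_ext2[OF mB mA mB mA bilinear_compose[OF wprod_bilinear lact_linear linear_map_id(2)]
        bilinear_postcompose[OF wprod_bilinear lact_linear] _ assms(2,3)])
    (simp_all add: assms wprod_pure lact_lact)

lemma wprod_ract:
  assumes "a \<in> carrier A" "x \<in> carrier X" "y \<in> carrier X"
  shows "x \<bullet> ract a y = ract a (x \<bullet> y)"
  by (rule tensor_ext2[OF mB mA mB mA bilinear_compose[OF wprod_bilinear linear_map_id(2) ract_linear]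
        bilinear_postcompose[OF wprod_bilinear ract_linear] _ assms(2,3)])
    (simp_all add: assms wprod_pure ract_ract lact_ract)

lemma tensor_psi_id:
  "linear_map R (tensor R Y A) (tensor R X A) (tensor_map R X A \<psi> id)"
  "\<lbrakk>y \<in> carrier Y; a \<in> carrier A\<rbrakk> \<Longrightarrow> tensor_map R X A \<psi> id (pure R Y A y a) = pure R X A (\<psi> y) a"
  "linear_map R (tensor R Y B) (tensor R X B) (tensor_map R X B \<psi> id)"
  "\<lbrakk>y \<in> carrier Y; b \<in> carrier B\<rbrakk> \<Longrightarrow> tensor_map R X B \<psi> id (pure R Y B y b) = pure R X B (\<psi> y) b"
  "linear_map R (tensor R A Y) (tensor R A X) (tensor_map R A X id \<psi>)"
  "\<lbrakk>y \<in> carrier Y; a \<in> carrier A\<rbrakk> \<Longrightarrow> tensor_map R A X id \<psi> (pure R A Y a y) = pure R A X a (\<psi> y)"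
  "linear_map R (tensor R B Y) (tensor R B X) (tensor_map R B X id \<psi>)"
  "\<lbrakk>y \<in> carrier Y; b \<in> carrier B\<rbrakk> \<Longrightarrow> tensor_map R B X id \<psi> (pure R B Y b y) = pure R B X b (\<psi> y)"
  by (simp_all add: tensor_map_linear tensor_map_pure[OF _ _ _ _ psi_linear linear_map_id(1)]
      tensor_map_pure[OF _ _ _ _ linear_map_id(1) psi_linear] mA mB mX mY psi_linear linear_map_id)

text \<open>The first axiom of the law at (a \<otimes> a') \<otimes> b. Applying \<psi> to the inner
  pair gives some \<open>x\<close>, and the remaining maps, collected in \<open>?K\<close>, multiply
  every \<open>x\<close> on the left by 1 \<otimes> a.\<close>

lemma psi_mult_left:
  assumes "a \<in> carrier A" "a' \<in> carrier A" "b \<in> carrier B"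
  shows "\<psi> (pY (a \<otimes>\<^bsub>A\<^esub> a') b) = pX \<one>\<^bsub>B\<^esub> a \<bullet> \<psi> (pY a' b)"
proof -
  let ?K = "\<lambda>x. tensor_map R B A id (mult_map R A) (assoc R B A A
         (tensor_map R X A \<psi> id (assoc_inv R A B A (pure R A X a x))))"
  have K: "?K x = pX \<one>\<^bsub>B\<^esub> a \<bullet> x" if x: "x \<in> carrier X" for x
  proof (rule tensor_ext[OF mB mA _ _ _ x])
    show "linear_map R X X ?K"
      by (rule linear_map_compose[OF linear_map_compose[OF linear_map_compose[OF linear_map_compose[OF
            pure_right_linear assoc_inv_linear] tensor_psi_id(1)] assoc_linear] tensor_map_linear])
        (intro tensor_module mA mB assms mult_map_linear aA linear_map_id)+
    show "linear_map R X X (\<lambda>x. pX \<one>\<^bsub>B\<^esub> a \<bullet> x)"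
      by (rule wprod_right_linear) (simp add: assms)
  qed (simp add: assms assoc_inv_pure mA mB tensor_psi_id ract_assoc wprod_pure del: id_apply)
  have "(\<psi> \<circ> tensor_map R A B (mult_map R A) id) (pure R (tensor R A A) B (pure R A A a a') b) =
        (tensor_map R B A id (mult_map R A) \<circ> assoc R B A A \<circ>
         tensor_map R (tensor R B A) A \<psi> id \<circ> assoc_inv R A B A \<circ>
         tensor_map R A (tensor R B A) id \<psi> \<circ> assoc R A A B) (pure R (tensor R A A) B (pure R A A a a') b)"
    using weak_distributive_law assms
    by (auto simp: weak_distributive_law_def pure_closed tensor_module mA mB)
  then show ?thesis
    by (simp add: K assms assoc_pure mA mB tensor_psi_id mult_map_pure aA pure_closed tensor_module
        tensor_map_pure[OF tensor_module[OF mA mA] mB mA mB mult_map_linear[OF aA] linear_map_id(1)])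
qed

lemma psi_mult_right:
  assumes "a \<in> carrier A" "b \<in> carrier B" "b' \<in> carrier B"
  shows "\<psi> (pY a (b \<otimes>\<^bsub>B\<^esub> b')) = \<psi> (pY a b) \<bullet> pX b' \<one>\<^bsub>A\<^esub>"
proof -
  let ?K = "\<lambda>x. tensor_map R B A (mult_map R B) id (assoc_inv R B B A
         (tensor_map R B X id \<psi> (assoc R B A B (pure R X B x b'))))"
  have K: "?K x = x \<bullet> pX b' \<one>\<^bsub>A\<^esub>" if x: "x \<in> carrier X" for x
  proof (rule tensor_ext[OF mB mA _ _ _ x])
    show "linear_map R X X ?K"
      by (rule linear_map_compose[OF linear_map_compose[OF linear_map_compose[OF linear_map_compose[OF
            pure_left_linear assoc_linear] tensor_psi_id(7)] assoc_inv_linear] tensor_map_linear])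
        (intro tensor_module mA mB assms mult_map_linear aB linear_map_id)+
    show "linear_map R X X (\<lambda>x. x \<bullet> pX b' \<one>\<^bsub>A\<^esub>)"
      by (rule wprod_left_linear) (simp add: assms)
  qed (simp add: assms assoc_pure mA mB tensor_psi_id lact_assoc_inv wprod_pure del: id_apply)
  have "(\<psi> \<circ> tensor_map R A B id (mult_map R B)) (pure R A (tensor R B B) a (pure R B B b b')) =
        (tensor_map R B A (mult_map R B) id \<circ> assoc_inv R B B A \<circ>
         tensor_map R B (tensor R B A) id \<psi> \<circ> assoc R B A B \<circ>
         tensor_map R (tensor R B A) B \<psi> id \<circ> assoc_inv R A B B) (pure R A (tensor R B B) a (pure R B B b b'))"
    using weak_distributive_law assms
    by (auto simp: weak_distributive_law_def pure_closed tensor_module mA mB)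
  then show ?thesis
    by (simp add: K assms assoc_inv_pure mA mB tensor_psi_id mult_map_pure aB pure_closed tensor_module
        tensor_map_pure[OF mA tensor_module[OF mB mB] mA mB linear_map_id(1) mult_map_linear[OF aB]])
qed

lemma psi_one_left:
  assumes "b \<in> carrier B"
  shows "\<psi> (pY \<one>\<^bsub>A\<^esub> b) = lact b (\<psi> (pY \<one>\<^bsub>A\<^esub> \<one>\<^bsub>B\<^esub>))"
proof -
  have "\<psi> (pY \<one>\<^bsub>A\<^esub> b) = (tensor_map R B A (mult_map R B) id \<circ> assoc_inv R B B A \<circ> tensor_map R B X id \<psi>)
      (pure R B Y b (pY \<one>\<^bsub>A\<^esub> \<one>\<^bsub>B\<^esub>))"
    using weak_distributive_law assms unfolding weak_distributive_law_def by (elim conjE) (erule bspec)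
  also have "\<dots> = lact b (\<psi> (pY \<one>\<^bsub>A\<^esub> \<one>\<^bsub>B\<^esub>))"
    by (simp add: tensor_psi_id lact_assoc_inv assms)
  finally show ?thesis .
qed

lemma psi_one_right:
  assumes "a \<in> carrier A"
  shows "\<psi> (pY a \<one>\<^bsub>B\<^esub>) = ract a (\<psi> (pY \<one>\<^bsub>A\<^esub> \<one>\<^bsub>B\<^esub>))"
proof -
  have "\<psi> (pY a \<one>\<^bsub>B\<^esub>) = (tensor_map R B A id (mult_map R A) \<circ> assoc R B A A \<circ> tensor_map R X A \<psi> id)
      (pure R Y A (pY \<one>\<^bsub>A\<^esub> \<one>\<^bsub>B\<^esub>) a)"
    using weak_distributive_law assms unfolding weak_distributive_law_def by (elim conjE) (erule bspec)
  also have "\<dots> = ract a (\<psi> (pY \<one>\<^bsub>A\<^esub> \<one>\<^bsub>B\<^esub>))"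
    by (simp add: tensor_psi_id ract_assoc assms)
  finally show ?thesis .
qed

text \<open>The left side is the composite prescribed for \<psi>\<phi> in the definition of a weak
  inverse. Recognising it as multiplication by \<open>j\<close> connects \<phi> with the
  product.\<close>

lemma wprod_j_eq:
  assumes "x \<in> carrier X"
  shows "tensor_map R B A (mult_map R B) id (assoc_inv R B B A
    (tensor_map R B X id \<psi> (assoc R B A B (pure R X B x \<one>\<^bsub>B\<^esub>)))) = x \<bullet> j"
proof (rule tensor_ext[OF mB mA _ wprod_left_linear _ assms])
  show "linear_map R X X (\<lambda>x. tensor_map R B A (mult_map R B) id (assoc_inv R B B A
    (tensor_map R B X id \<psi> (assoc R B A B (pure R X B x \<one>\<^bsub>B\<^esub>)))))"
    by (rule linear_map_compose[OF linear_map_compose[OF linear_map_compose[OF linear_map_compose[OF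
            pure_left_linear assoc_linear] tensor_psi_id(7)] assoc_inv_linear] tensor_map_linear])
        (intro tensor_module mA mB mult_map_linear aB linear_map_id B.A.one_closed)+
qed (simp_all add: j_def assoc_pure mA mB tensor_psi_id lact_assoc_inv wprod_pure del: id_apply)

lemma j_closed [simp]: "j \<in> carrier X"
  by (simp add: j_def)

text \<open>Both bracketings reduce to \<open>b (\<psi>(a \<otimes> b') \<bullet> \<psi>(a' \<otimes> b'')) a''\<close>: this is what the two
  multiplicativity axioms of a weak distributive law say about the product \<open>b \<psi>(a \<otimes> b') a'\<close>.\<close>

lemma wprod_assoc:
  assumes "x \<in> carrier X" "y \<in> carrier X" "z \<in> carrier X"
  shows "(x \<bullet> y) \<bullet> z = x \<bullet> (y \<bullet> z)"
proof -
  have left: "ract a x \<bullet> pX b \<one>\<^bsub>A\<^esub> = x \<bullet> \<psi> (pY a b)"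
    if "a \<in> carrier A" "b \<in> carrier B" "x \<in> carrier X" for a b x
  proof (rule tensor_ext[OF mB mA linear_map_compose[OF ract_linear wprod_left_linear] wprod_left_linear _ that(3)])
    fix b' a' assume [simp]: "b' \<in> carrier B" "a' \<in> carrier A"
    have "pX b' a' \<bullet> \<psi> (pY a b) = lact b' (pX \<one>\<^bsub>B\<^esub> a') \<bullet> \<psi> (pY a b)" by simp
    then show "ract a (pX b' a') \<bullet> pX b \<one>\<^bsub>A\<^esub> = pX b' a' \<bullet> \<psi> (pY a b)"
      using that by (simp add: wprod_pure psi_mult_left wprod_lact del: lact_pure)
  qed (simp_all add: that)
  have right: "pX \<one>\<^bsub>B\<^esub> a \<bullet> lact b x = \<psi> (pY a b) \<bullet> x"
    if "a \<in> carrier A" "b \<in> carrier B" "x \<in> carrier X" for a b x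
  proof (rule tensor_ext[OF mB mA linear_map_compose[OF lact_linear wprod_right_linear] wprod_right_linear _ that(3)])
    fix b' a' assume [simp]: "b' \<in> carrier B" "a' \<in> carrier A"
    have "\<psi> (pY a b) \<bullet> pX b' a' = \<psi> (pY a b) \<bullet> ract a' (pX b' \<one>\<^bsub>A\<^esub>)" by simp
    then show "pX \<one>\<^bsub>B\<^esub> a \<bullet> lact b (pX b' a') = \<psi> (pY a b) \<bullet> pX b' a'"
      using that by (simp add: wprod_pure psi_mult_right wprod_ract del: ract_pure)
  qed (simp_all add: that)
  show ?thesis
  proof (rule tensor_ext[OF mB mA linear_map_compose[OF wprod_left_linear wprod_left_linear] wprod_left_linear _ assms(1)])
    fix b a assume ba [simp]: "b \<in> carrier B" "a \<in> carrier A"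
    show "(pX b a \<bullet> y) \<bullet> z = pX b a \<bullet> (y \<bullet> z)"
    proof (rule tensor_ext[OF mB mA linear_map_compose[OF wprod_right_linear wprod_left_linear]
          linear_map_compose[OF wprod_left_linear wprod_right_linear] _ assms(2)])
      fix b' a' assume ba' [simp]: "b' \<in> carrier B" "a' \<in> carrier A"
      show "(pX b a \<bullet> pX b' a') \<bullet> z = pX b a \<bullet> (pX b' a' \<bullet> z)"
      proof (rule tensor_ext[OF mB mA wprod_right_linear linear_map_compose[OF wprod_right_linear wprod_right_linear] _ assms(3)])
        fix b'' a'' assume ba'' [simp]: "b'' \<in> carrier B" "a'' \<in> carrier A"
        let ?x = "\<psi> (pY a b')" and ?y = "\<psi> (pY a' b'')"
        have "(pX b a \<bullet> pX b' a') \<bullet> pX b'' a'' = lact b (ract a' ?x) \<bullet> ract a'' (pX b'' \<one>\<^bsub>A\<^esub>)"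
          by (simp add: wprod_pure)
        also have "\<dots> = lact b (ract a'' (?x \<bullet> ?y))"
          by (simp add: wprod_lact wprod_ract lact_ract left del: ract_pure)
        also have "\<dots> = lact b (pX \<one>\<^bsub>B\<^esub> a) \<bullet> lact b' (ract a'' ?y)"
          by (simp add: wprod_lact wprod_ract lact_ract right del: lact_pure)
        also have "\<dots> = pX b a \<bullet> (pX b' a' \<bullet> pX b'' a'')"
          by (simp add: wprod_pure)
        finally show "(pX b a \<bullet> pX b' a') \<bullet> pX b'' a'' = pX b a \<bullet> (pX b' a' \<bullet> pX b'' a'')" .
      qed simp_all
    qed (simp_all add: assms)
  qed (simp_all add: assms)
qed

section \<open>The central element 1 \<otimes> 1 and its idempotent action\<close>

lemma wprod_pure_j:
  "\<lbrakk>b \<in> carrier B; a \<in> carrier A\<rbrakk> \<Longrightarrow> pX b a \<bullet> j = lact b (ract a (\<psi> (pY \<one>\<^bsub>A\<^esub> \<one>\<^bsub>B\<^esub>)))"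
  by (simp add: j_def wprod_pure psi_one_right[of a])

text \<open>The unit axioms give \<psi>(1 \<otimes> b) = b u and \<psi>(a \<otimes> 1) = u a with u
  = \<psi>(1 \<otimes> 1). Hence both products of \<open>j\<close> with b \<otimes> a equal b u
  a.\<close>

lemma j_commute:
  assumes "x \<in> carrier X"
  shows "j \<bullet> x = x \<bullet> j"
proof (rule tensor_ext[OF mB mA wprod_right_linear wprod_left_linear _ assms])
  fix b a assume ba: "b \<in> carrier B" "a \<in> carrier A"
  then have "j \<bullet> pX b a = ract a (\<psi> (pY \<one>\<^bsub>A\<^esub> b))"
    by (simp add: j_def wprod_pure)
  also have "\<dots> = pX b a \<bullet> j"
    unfolding psi_one_left[OF ba(1)] using ba by (simp add: wprod_pure_j lact_ract)
  finally show "j \<bullet> pX b a = pX b a \<bullet> j" .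
qed simp_all

text \<open>With first factor 1, multiplicativity in \<open>A\<close> says that \<open>j\<close>
  fixes \<psi>(a \<otimes> b) from the left, and \<open>j\<close> is central.\<close>

lemma psi_j:
  assumes "y \<in> carrier Y"
  shows "\<psi> y \<bullet> j = \<psi> y"
proof (rule tensor_ext[OF mA mB linear_map_compose[OF psi_linear wprod_left_linear] psi_linear _ assms])
  fix a b assume [simp]: "a \<in> carrier A" "b \<in> carrier B"
  show "\<psi> (pY a b) \<bullet> j = \<psi> (pY a b)"
    using psi_mult_left[of "\<one>\<^bsub>A\<^esub>" a b] by (simp flip: j_commute) (simp add: j_def)
qed simp

lemma lact_j: "\<lbrakk>b \<in> carrier B; x \<in> carrier X\<rbrakk> \<Longrightarrow> lact b x \<bullet> j = lact b (x \<bullet> j)"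
  by (simp add: wprod_lact)

lemma ract_j: "\<lbrakk>a \<in> carrier A; x \<in> carrier X\<rbrakk> \<Longrightarrow> ract a x \<bullet> j = ract a (x \<bullet> j)"
  by (simp add: wprod_ract flip: j_commute)

text \<open>For pure x = b \<otimes> a the product with \<open>j\<close> is b u a with u = \<psi>(1
  \<otimes> 1); \<open>j\<close> slides past the actions and is absorbed by u. So \<open>j\<close>
  acts as an idempotent without being a unit in general.\<close>

lemma j_j:
  assumes "x \<in> carrier X"
  shows "x \<bullet> j \<bullet> j = x \<bullet> j"
  by (rule tensor_ext[OF mB mA linear_map_compose[OF wprod_left_linear wprod_left_linear] wprod_left_linear _ assms])
    (simp_all add: wprod_pure_j lact_j ract_j psi_j)

lemma wprod_j_wprod: "\<lbrakk>x \<in> carrier X; y \<in> carrier X\<rbrakk> \<Longrightarrow> (x \<bullet> j) \<bullet> (y \<bullet> j) = x \<bullet> y \<bullet> j"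
  by (simp add: wprod_assoc j_commute[of "y \<bullet> j"]) (simp add: wprod_assoc[symmetric] j_j)

section \<open>The maps from the two factors into the image\<close>

lemma iA_closed [simp]: "a \<in> carrier A \<Longrightarrow> iA a \<in> carrier X"
  and iB_closed [simp]: "b \<in> carrier B \<Longrightarrow> iB b \<in> carrier X"
  by (simp_all add: iA_def iB_def)

lemma iA_eq: "a \<in> carrier A \<Longrightarrow> iA a = pX \<one>\<^bsub>B\<^esub> a \<bullet> j"
  and iB_eq: "b \<in> carrier B \<Longrightarrow> iB b = pX b \<one>\<^bsub>A\<^esub> \<bullet> j"
  unfolding iA_def iB_def by (subst psi_one_right psi_one_left; simp add: wprod_pure_j)+

text \<open>The two factors \<open>j\<close> merge into one, which \<psi>(a \<otimes> b)
  absorbs.\<close>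

lemma iA_iB: "\<lbrakk>a \<in> carrier A; b \<in> carrier B\<rbrakk> \<Longrightarrow> iA a \<bullet> iB b = \<psi> (pY a b)"
  by (simp add: iA_eq iB_eq wprod_j_wprod) (simp add: wprod_pure psi_j)

lemma iB_iA: "\<lbrakk>a \<in> carrier A; b \<in> carrier B\<rbrakk> \<Longrightarrow> iB b \<bullet> iA a = pX b a \<bullet> j"
  by (simp add: iA_eq iB_eq wprod_j_wprod) (simp add: wprod_pure wprod_pure_j lact_j ract_j psi_j)

lemma iA_mult: "\<lbrakk>a \<in> carrier A; a' \<in> carrier A\<rbrakk> \<Longrightarrow> iA (a \<otimes>\<^bsub>A\<^esub> a') = iA a \<bullet> iA a'"
  by (simp add: iA_eq wprod_j_wprod) (simp add: wprod_assoc flip: iA_eq, simp add: iA_def psi_mult_left)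

lemma iB_mult: "\<lbrakk>b \<in> carrier B; b' \<in> carrier B\<rbrakk> \<Longrightarrow> iB (b \<otimes>\<^bsub>B\<^esub> b') = iB b \<bullet> iB b'"
proof -
  assume [simp]: "b \<in> carrier B" "b' \<in> carrier B"
  have "iB b \<bullet> iB b' = iB b \<bullet> j \<bullet> pX b' \<one>\<^bsub>A\<^esub>"
    by (simp add: iB_eq[of b'] wprod_assoc j_commute)
  also have "\<dots> = iB (b \<otimes>\<^bsub>B\<^esub> b')"
    by (simp add: iB_def psi_j psi_mult_right)
  finally show ?thesis ..
qed

lemma iA_one: "iA \<one>\<^bsub>A\<^esub> = \<psi> (pY \<one>\<^bsub>A\<^esub> \<one>\<^bsub>B\<^esub>)" and iB_one: "iB \<one>\<^bsub>B\<^esub> = \<psi> (pY \<one>\<^bsub>A\<^esub> \<one>\<^bsub>B\<^esub>)"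
  by (simp_all add: iA_def iB_def)

end

section \<open>The weak wreath product algebra\<close>

locale weak_inverse_pair = A: assoc_algebra R A + B: assoc_algebra R B
  for R :: "('r, 'q) ring_scheme" (structure)
    and A :: "('r, 'a, 'm) bialgebra_data_scheme" and B :: "('r, 'b, 'n) bialgebra_data_scheme" +
  fixes \<psi> :: "('r, 'a, 'b) tens \<Rightarrow> ('r, 'b, 'a) tens" and \<phi> :: "('r, 'b, 'a) tens \<Rightarrow> ('r, 'a, 'b) tens"
  assumes mutually_weak_inverse: "mutually_weak_inverse R A B \<psi> \<phi>"
begin

sublocale P: weak_distributive R A B \<psi>
  using mutually_weak_inverse unfolding mutually_weak_inverse_def by unfold_locales (elim conjE)

sublocale Q: weak_distributive R B A \<phi>
  using mutually_weak_inverse unfolding mutually_weak_inverse_def by unfold_locales (elim conjE)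

abbreviation X where "X \<equiv> tensor R B A"
abbreviation Y where "Y \<equiv> tensor R A B"
abbreviation pX where "pX \<equiv> pure R B A"
abbreviation pY where "pY \<equiv> pure R A B"
abbreviation iA where "iA \<equiv> P.iA"
abbreviation iB where "iB \<equiv> P.iB"

definition e where "e = \<psi> \<circ> \<phi>"
definition H where "H = weak_wreath_product R A B \<psi> \<phi>"

lemma e_eq:
  assumes "x \<in> carrier X"
  shows "e x = P.wprod x P.j"
proof -
  have "(\<psi> \<circ> \<phi>) x = (tensor_map R B A (mult_map R B) id \<circ> assoc_inv R B B A \<circ>
      tensor_map R B X id \<psi> \<circ> assoc R B A B) (pure R X B x \<one>\<^bsub>B\<^esub>)"
    using mutually_weak_inverse assms unfolding mutually_weak_inverse_def by (elim conjE) (erule bspec)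
  then show ?thesis
    by (simp add: e_def P.wprod_j_eq assms)
qed

lemma phi_psi_eq:
  assumes "y \<in> carrier Y"
  shows "\<phi> (\<psi> y) = Q.wprod y Q.j"
proof -
  have "(\<phi> \<circ> \<psi>) y = (tensor_map R A B (mult_map R A) id \<circ> assoc_inv R A A B \<circ>
      tensor_map R A Y id \<phi> \<circ> assoc R A B A) (pure R Y A y \<one>\<^bsub>A\<^esub>)"
    using mutually_weak_inverse assms unfolding mutually_weak_inverse_def by (elim conjE) (erule bspec)
  then show ?thesis
    by (simp add: Q.wprod_j_eq assms)
qed

lemma e_linear: "linear_map R X X e"
  unfolding e_def by (rule linear_map_comp[OF Q.psi_linear P.psi_linear])

lemmas e_closed [simp] = linear_map_closed[OF e_linear]

lemma psi_phi [simp]: "\<psi> (\<phi> x) = e x"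
  by (simp add: e_def)

lemma e_psi [simp]: "y \<in> carrier Y \<Longrightarrow> e (\<psi> y) = \<psi> y"
  by (simp add: e_eq P.psi_j)

lemma e_e [simp]: "x \<in> carrier X \<Longrightarrow> e (e x) = e x"
  using e_psi[of "\<phi> x"] by simp

lemma carrier_H: "carrier H = e ` carrier X"
  and H_ops [simp]: "add H = add X" "zero H = zero X" "smult H = smult X"
  unfolding H_def weak_wreath_product_def e_def[symmetric]
  by (simp_all add: wreath_along_def image_module_def)

lemma in_H: "x \<in> carrier H \<longleftrightarrow> x \<in> carrier X \<and> e x = x"
  by (auto simp: carrier_H intro: rev_image_eqI)

lemma H_in_X: "x \<in> carrier H \<Longrightarrow> x \<in> carrier X"
  by (simp add: in_H)

lemma e_in_H [simp]: "x \<in> carrier X \<Longrightarrow> e x \<in> carrier H"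
  by (simp add: in_H)

lemma psi_in_H [simp]: "y \<in> carrier Y \<Longrightarrow> \<psi> y \<in> carrier H"
  by (simp add: in_H)

lemma mH: "module R H"
proof -
  interpret X: module R X by (rule P.mX)
  have sub: "submodule (e ` carrier X) R X"
  proof (rule X.submoduleI)
    show "\<zero>\<^bsub>X\<^esub> \<in> e ` carrier X"
      using linear_map_zero[OF P.mX P.mX e_linear] by (metis X.M.zero_closed image_eqI)
    fix a assume a: "a \<in> e ` carrier X"
    \<comment> \<open>Negation is multiplication by the scalar -1, with which the linear map
      \<open>e\<close> commutes.\<close>
    have "e ((\<ominus>\<^bsub>R\<^esub> \<one>\<^bsub>R\<^esub>) \<odot>\<^bsub>X\<^esub> a) = (\<ominus>\<^bsub>R\<^esub> \<one>\<^bsub>R\<^esub>) \<odot>\<^bsub>X\<^esub> e a"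
      using a by (intro linear_map_smult[OF e_linear]) auto
    moreover have "a \<in> carrier X" "e a = a"
      using a by auto
    ultimately have "e (\<ominus>\<^bsub>X\<^esub> a) = \<ominus>\<^bsub>X\<^esub> a" "\<ominus>\<^bsub>X\<^esub> a \<in> carrier X"
      by (simp_all add: X.smult_l_minus)
    then show "\<ominus>\<^bsub>X\<^esub> a \<in> e ` carrier X"
      by (metis imageI)
    fix b assume "b \<in> e ` carrier X"
    then show "a \<oplus>\<^bsub>X\<^esub> b \<in> e ` carrier X"
      using a by (auto simp: linear_map_add[OF e_linear] intro: rev_image_eqI)
  next
    fix r x assume "r \<in> carrier R" "x \<in> e ` carrier X"
    then show "r \<odot>\<^bsub>X\<^esub> x \<in> e ` carrier X"
      by (auto simp: linear_map_smult[OF e_linear] intro: rev_image_eqI)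
  qed auto
  interpret W: module R "X\<lparr>carrier := e ` carrier X\<rparr>"
    by (rule submodule.submodule_is_module[OF sub P.mX])
  have "abelian_group H"
  proof (rule abelian_groupI)
    fix x assume "x \<in> carrier H"
    then show "\<exists>y\<in>carrier H. y \<oplus>\<^bsub>H\<^esub> x = \<zero>\<^bsub>H\<^esub>"
      using W.M.add.l_inv_ex[of x] by (simp add: carrier_H)
  qed (use W.M.a_closed W.M.zero_closed W.M.a_assoc W.M.a_comm W.M.l_zero in \<open>simp_all add: carrier_H\<close>)
  then show ?thesis
    using W.smult_closed W.smult_l_distr W.smult_r_distr W.smult_assoc1 W.smult_one
    by (intro moduleI module.axioms(1)[OF P.mA]) (simp_all add: carrier_H)
qed

lemma H_linear: "linear_map R H X (\<lambda>x. x)" "linear_map R H X id"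
  and e_linear_H: "linear_map R X H e"
  and psi_linear_H: "linear_map R Y H \<psi>"
  by (rule linear_mapI; simp add: H_in_X linear_map_add[OF e_linear] linear_map_smult[OF e_linear]
      linear_map_add[OF P.psi_linear] linear_map_smult[OF P.psi_linear])+

text \<open>\<open>wreath_along\<close> forms tensor products over the bare image module, while
  later statements concern the full record \<open>H\<close>; their module data coincide.\<close>

lemma tensor_image_module:
  "tensor R (image_module X e) (image_module X e) = tensor R H H"
  "pure R (image_module X e) (image_module X e) = pure R H H"
  "tensor_map R (image_module X e) (image_module X e) = tensor_map R H H"
proof -
  have "add (image_module X e) = add X" "smult (image_module X e) = smult X"
    "carrier (image_module X e) = e ` carrier X"
    by (simp_all add: image_module_def)
  then show *: "tensor R (image_module X e) (image_module X e) = tensor R H H"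
    "pure R (image_module X e) (image_module X e) = pure R H H"
    by (intro tensor_cong; simp add: carrier_H)+
  show "tensor_map R (image_module X e) (image_module X e) = tensor_map R H H"
    by (intro ext) (simp add: tensor_map_def *)
qed

text \<open>\<open>e\<close> is right multiplication by \<open>j\<close>, so associativity moves the
  outer projection onto \<open>y\<close>, which it fixes.\<close>

lemma H_mult:
  assumes "x \<in> carrier H" "y \<in> carrier H"
  shows "x \<otimes>\<^bsub>H\<^esub> y = P.wprod x y"
proof -
  have "x \<otimes>\<^bsub>H\<^esub> y = e (P.wprod x y)"
    unfolding H_def weak_wreath_product_def e_def[symmetric]
    by (simp add: wreath_along_def tensor_image_module P.wprod_def
        tensor_map_pure[OF mH mH P.mX P.mX H_linear(2) H_linear(2)] assms)
  also have "\<dots> = P.wprod x (e y)"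
    using assms by (simp add: e_eq P.wprod_assoc H_in_X)
  finally show ?thesis
    using assms by (simp add: in_H)
qed

lemma H_one: "\<one>\<^bsub>H\<^esub> = \<psi> (pY \<one>\<^bsub>A\<^esub> \<one>\<^bsub>B\<^esub>)"
proof -
  have "\<one>\<^bsub>H\<^esub> = e (\<psi> (pY \<one>\<^bsub>A\<^esub> \<one>\<^bsub>B\<^esub>))"
    unfolding H_def weak_wreath_product_def e_def[symmetric] by (simp add: wreath_along_def)
  then show ?thesis by simp
qed

lemma iA_in_H [simp]: "a \<in> carrier A \<Longrightarrow> iA a \<in> carrier H"
  and iB_in_H [simp]: "b \<in> carrier B \<Longrightarrow> iB b \<in> carrier H"
  by (simp_all add: P.iA_def P.iB_def)

lemma iA_iB: "\<lbrakk>a \<in> carrier A; b \<in> carrier B\<rbrakk> \<Longrightarrow> iA a \<otimes>\<^bsub>H\<^esub> iB b = \<psi> (pY a b)"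
  by (simp add: H_mult P.iA_iB)

lemma iB_iA: "\<lbrakk>a \<in> carrier A; b \<in> carrier B\<rbrakk> \<Longrightarrow> iB b \<otimes>\<^bsub>H\<^esub> iA a = e (pX b a)"
  by (simp add: H_mult P.iB_iA e_eq)

lemma H_algebra: "assoc_algebra R H"
proof (rule assoc_algebraI[OF mH])
  have closed: "P.wprod x y \<in> carrier H" if "x \<in> carrier H" "y \<in> carrier H" for x y
  proof -
    have "e (P.wprod x y) = P.wprod x (e y)"
      using that by (simp add: e_eq P.wprod_assoc H_in_X)
    then show ?thesis using that by (simp add: in_H)
  qed
  show "bilinear R H H H (\<otimes>\<^bsub>H\<^esub>)"
    using closed by (intro bilinearI linear_mapI)
      (simp_all add: module.smult_closed[OF mH, simplified] abelian_monoid.a_closed[OF abelian_group.axioms(1)[OF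
          module.axioms(2)[OF mH]], simplified]
        H_mult linear_map_add[OF P.wprod_left_linear] linear_map_add[OF P.wprod_right_linear]
        linear_map_smult[OF P.wprod_left_linear] linear_map_smult[OF P.wprod_right_linear] H_in_X)
  show "\<one>\<^bsub>H\<^esub> \<in> carrier H" by (simp add: H_one)
  show "x \<otimes>\<^bsub>H\<^esub> y \<otimes>\<^bsub>H\<^esub> z = x \<otimes>\<^bsub>H\<^esub> (y \<otimes>\<^bsub>H\<^esub> z)"
    if "x \<in> carrier H" "y \<in> carrier H" "z \<in> carrier H" for x y z
    using that closed by (simp add: H_mult P.wprod_assoc H_in_X)
  \<comment> \<open>The unit \<psi>(1 \<otimes> 1) is the square of \<open>j\<close>. As
    \<open>j\<close> fixes every element of \<open>H\<close> from either side, so does its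
    square.\<close>
  have one: "\<one>\<^bsub>H\<^esub> = P.wprod P.j P.j"
    by (simp add: H_one P.j_def P.wprod_pure)
  fix x assume x: "x \<in> carrier H"
  then have xj: "P.wprod x P.j = x"
    by (metis in_H e_eq)
  have jx: "P.wprod P.j x = x"
    using x xj by (simp add: P.j_commute H_in_X)
  have 1: "\<one>\<^bsub>H\<^esub> \<in> carrier H" by (simp add: H_one)
  have "P.wprod x (P.wprod P.j P.j) = x" "P.wprod (P.wprod P.j P.j) x = x"
    using x by (simp_all add: xj H_in_X flip: P.wprod_assoc) (simp add: jx P.wprod_assoc H_in_X)
  then show "x \<otimes>\<^bsub>H\<^esub> \<one>\<^bsub>H\<^esub> = x" "\<one>\<^bsub>H\<^esub> \<otimes>\<^bsub>H\<^esub> x = x"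
    using H_mult[OF x 1] H_mult[OF 1 x] by (simp_all add: one)
qed

lemma iA_hom: "algebra_hom R A H iA" and iB_hom: "algebra_hom R B H iB"
proof -
  have "linear_map R A H iA"
    unfolding P.iA_def by (intro linear_map_compose[OF pure_left_linear psi_linear_H] P.mA P.mB B.A.one_closed)
  then show "algebra_hom R A H iA"
    by (simp add: algebra_hom_def P.iA_one H_one H_mult P.iA_mult)
  have "linear_map R B H iB"
    unfolding P.iB_def by (intro linear_map_compose[OF pure_right_linear psi_linear_H] P.mA P.mB A.A.one_closed)
  then show "algebra_hom R B H iB"
    by (simp add: algebra_hom_def P.iB_one H_one H_mult P.iB_mult)
qed

end

text \<open>Composition of tensor maps when the simplified composites are known only on carriers.
  Its typical use is the absorption of an idempotent into a neighbouring map.\<close>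

lemma tensor_map_fuse:
  assumes "module R A" "module R B" "module R C" "module R D" "module R E" "module R F"
    and "linear_map R A C f" "linear_map R B D g" "linear_map R C E h" "linear_map R D F k"
    and "\<And>a. a \<in> carrier A \<Longrightarrow> h (f a) = h' a" "\<And>b. b \<in> carrier B \<Longrightarrow> k (g b) = k' b"
    and "t \<in> carrier (tensor R A B)"
  shows "tensor_map R E F h k (tensor_map R C D f g t) = tensor_map R E F h' k' t"
  unfolding tensor_map_comp[OF assms(1-10,13)]
  by (rule tensor_map_cong[OF assms(1,2,5,6) linear_map_comp[OF assms(7,9)] linear_map_comp[OF assms(8,10)]
        _ _ assms(13)]) (simp_all add: assms(11,12))

lemma assoc_inv_natural:
  assumes "module R A" "module R B" "module R C" "module R A'" "module R B'" "module R C'"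
    and "linear_map R A A' f" "linear_map R B B' g" "linear_map R C C' h"
    and "t \<in> carrier (tensor R A (tensor R B C))"
  shows "tensor_map R (tensor R A' B') C' (tensor_map R A' B' f g) h (assoc_inv R A B C t) =
    assoc_inv R A' B' C' (tensor_map R A' (tensor R B' C') f (tensor_map R B' C' g h) t)"
  by (rule tensor_ext_right[OF assms(1-3) _ linear_map_compose[OF assoc_inv_linear tensor_map_linear]
        linear_map_compose[OF tensor_map_linear assoc_inv_linear] _ assms(10)])
    (simp_all add: assms assoc_inv_pure tensor_module tensor_map_linear tensor_map_pure[OF tensor_module]
      tensor_map_pure[OF assms(1) tensor_module] tensor_map_pure[OF assms(1,2,4,5,7,8)]
      tensor_map_pure[OF assms(2,3,5,6,8,9)] pure_closed linear_map_closed[OF assms(7)]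
      linear_map_closed[OF assms(8)] linear_map_closed[OF assms(9)])

section \<open>Comultiplications along products of maps\<close>

text \<open>The flip turns (m \<otimes> m') \<otimes> (n \<otimes> n') into (m \<otimes> n)
  \<otimes> (m' \<otimes> n'), and \<open>h \<otimes> h\<close> makes this f(m) g(n) \<otimes> f(m')
  g(n'), a product in the tensor square. With \<open>h\<close> equal to \<psi> or \<psi>\<phi> a
  tensor product comultiplication thereby becomes a product of two comultiplications.\<close>

lemma middle_map_product:
  assumes "assoc_algebra R H" "module R M" "module R N"
    and "linear_map R M H f" "linear_map R N H g" "linear_map R (tensor R M N) H h"
    and "\<And>m n. \<lbrakk>m \<in> carrier M; n \<in> carrier N\<rbrakk> \<Longrightarrow> h (pure R M N m n) = f m \<otimes>\<^bsub>H\<^esub> g n"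
    and s: "s \<in> carrier (tensor R M M)" and t: "t \<in> carrier (tensor R N N)"
  shows "tensor_map R H H h h (middle_map R M M N N N M (twist R M N)
      (pure R (tensor R M M) (tensor R N N) s t)) =
    tensor_map R H H f f s \<otimes>\<^bsub>tensor_algebra R H H\<^esub> tensor_map R H H g g t"
proof -
  note mH = assoc_algebra_module[OF assms(1)]
  note mMM = tensor_module[OF assms(2,2)] and mNN = tensor_module[OF assms(3,3)]
    and mMN = tensor_module[OF assms(2,3)]
  note lin = linear_map_compose[OF middle_map_linear[OF assms(2,2,3,3,3,2) twist_linear[OF assms(2,3)]]
      tensor_map_linear[OF mMN mMN mH mH assms(6,6)]]
  note F = tensor_map_linear[OF assms(2,2) mH mH assms(4,4)]
    and G = tensor_map_linear[OF assms(3,3) mH mH assms(5,5)]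
  note bil = tensor_algebra_mult_bilinear[OF assms(1,1)]
  show ?thesis
    by (rule tensor_ext2[OF assms(2,2,3,3) bilinear_postcompose[OF pure_bilinear[OF mMM mNN] lin]
          bilinear_compose[OF bil F G] _ s t])
      (simp add: middle_map_twist_pure assms(1,2,3,7) pure_closed mH
        tensor_map_pure[OF assms(2,2) mH mH assms(4,4)] tensor_map_pure[OF assms(3,3) mH mH assms(5,5)]
        tensor_map_pure[OF mMN mMN mH mH assms(6,6)] linear_map_closed[OF assms(4)]
        linear_map_closed[OF assms(5)] tensor_algebra_mult_pure)
qed

text \<open>For s = m \<otimes> m' and t = n \<otimes> n' the left side is D(f(m) g(n)) \<otimes>
  f(m') g(n'), and the hypothesis on \<open>D\<close> splits the first leg into the same two
  factors. Used for iterated comultiplications, among them that of 1.\<close>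

lemma comult_product_left:
  assumes "assoc_algebra R H" "module R M" "module R N"
    and "linear_map R M H f" "linear_map R N H g"
    and "linear_map R M (tensor R M M) d" "linear_map R N (tensor R N N) d'"
    and "linear_map R H (tensor R H H) D"
    and "\<And>m n. \<lbrakk>m \<in> carrier M; n \<in> carrier N\<rbrakk> \<Longrightarrow> D (f m \<otimes>\<^bsub>H\<^esub> g n) =
      tensor_map R H H f f (d m) \<otimes>\<^bsub>tensor_algebra R H H\<^esub> tensor_map R H H g g (d' n)"
    and s: "s \<in> carrier (tensor R M M)" and t: "t \<in> carrier (tensor R N N)"
  defines "HH \<equiv> tensor R H H"
  shows "tensor_map R HH H D id
      (tensor_map R H H f f s \<otimes>\<^bsub>tensor_algebra R H H\<^esub> tensor_map R H H g g t) =
    tensor_map R HH H (tensor_map R H H f f) f (tensor_map R (tensor R M M) M d id s)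
      \<otimes>\<^bsub>tensor_algebra R (tensor_algebra R H H) H\<^esub>
    tensor_map R HH H (tensor_map R H H g g) g (tensor_map R (tensor R N N) N d' id t)"
proof -
  note mH = assoc_algebra_module[OF assms(1)]
  note mMM = tensor_module[OF assms(2,2)] and mNN = tensor_module[OF assms(3,3)]
    and mHH = tensor_module[OF mH mH]
  note aHH = tensor_algebra_assoc_algebra[OF assms(1,1)]
  note F = tensor_map_linear[OF assms(2,2) mH mH assms(4,4)]
    and G = tensor_map_linear[OF assms(3,3) mH mH assms(5,5)]
  note dM = tensor_map_linear[OF assms(2,2) mMM assms(2) assms(6) linear_map_id(1)]
    and dN = tensor_map_linear[OF assms(3,3) mNN assms(3) assms(7) linear_map_id(1)]
    and dH = tensor_map_linear[OF mH mH mHH mH assms(8) linear_map_id(1)]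
    and FF = tensor_map_linear[OF mMM assms(2) mHH mH F assms(4)]
    and GG = tensor_map_linear[OF mNN assms(3) mHH mH G assms(5)]
  note bil = tensor_algebra_mult_bilinear[OF assms(1,1)]
    and bil3 = tensor_algebra_mult_bilinear[OF aHH assms(1), simplified]
  note [simp] = tensor_map_pure[OF assms(2,2) mH mH assms(4,4)] tensor_map_pure[OF assms(3,3) mH mH assms(5,5)]
    tensor_map_pure[OF assms(2,2) mMM assms(2) assms(6) linear_map_id(1)]
    tensor_map_pure[OF assms(3,3) mNN assms(3) assms(7) linear_map_id(1)]
    tensor_map_pure[OF mH mH mHH mH assms(8) linear_map_id(1)]
    tensor_map_pure[OF mMM assms(2) mHH mH F assms(4)] tensor_map_pure[OF mNN assms(3) mHH mH G assms(5)]
    linear_map_closed[OF assms(4)] linear_map_closed[OF assms(5)] linear_map_closed[OF assms(6)]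
    linear_map_closed[OF assms(7)] linear_map_closed[OF F] linear_map_closed[OF G]
    tensor_algebra_mult_pure[OF assms(1,1)] tensor_algebra_mult_pure[OF aHH assms(1), simplified]
    bilinear_closed[OF mult_bilinear[OF assms(1)]]
  show ?thesis
    unfolding HH_def
    by (rule tensor_ext2[OF assms(2,2,3,3) bilinear_postcompose[OF bilinear_compose[OF bil F G] dH]
          bilinear_compose[OF bil3 linear_map_compose[OF dM FF] linear_map_compose[OF dN GG]] _ s t])
      (simp add: assms(9))
qed

lemma comult_product_right:
  assumes "assoc_algebra R H" "module R M" "module R N"
    and "linear_map R M H f" "linear_map R N H g"
    and "linear_map R M (tensor R M M) d" "linear_map R N (tensor R N N) d'"
    and "linear_map R H (tensor R H H) D"
    and "\<And>m n. \<lbrakk>m \<in> carrier M; n \<in> carrier N\<rbrakk> \<Longrightarrow> D (f m \<otimes>\<^bsub>H\<^esub> g n) =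
      tensor_map R H H f f (d m) \<otimes>\<^bsub>tensor_algebra R H H\<^esub> tensor_map R H H g g (d' n)"
    and s: "s \<in> carrier (tensor R M M)" and t: "t \<in> carrier (tensor R N N)"
  defines "HH \<equiv> tensor R H H"
  shows "tensor_map R H HH id D
      (tensor_map R H H f f s \<otimes>\<^bsub>tensor_algebra R H H\<^esub> tensor_map R H H g g t) =
    tensor_map R H HH f (tensor_map R H H f f) (tensor_map R M (tensor R M M) id d s)
      \<otimes>\<^bsub>tensor_algebra R H (tensor_algebra R H H)\<^esub>
    tensor_map R H HH g (tensor_map R H H g g) (tensor_map R N (tensor R N N) id d' t)"
proof -
  note mH = assoc_algebra_module[OF assms(1)]
  note mMM = tensor_module[OF assms(2,2)] and mNN = tensor_module[OF assms(3,3)]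
    and mHH = tensor_module[OF mH mH]
  note aHH = tensor_algebra_assoc_algebra[OF assms(1,1)]
  note F = tensor_map_linear[OF assms(2,2) mH mH assms(4,4)]
    and G = tensor_map_linear[OF assms(3,3) mH mH assms(5,5)]
  note dM = tensor_map_linear[OF assms(2,2,2) mMM linear_map_id(1) assms(6)]
    and dN = tensor_map_linear[OF assms(3,3,3) mNN linear_map_id(1) assms(7)]
    and dH = tensor_map_linear[OF mH mH mH mHH linear_map_id(1) assms(8)]
    and FF = tensor_map_linear[OF assms(2) mMM mH mHH assms(4) F]
    and GG = tensor_map_linear[OF assms(3) mNN mH mHH assms(5) G]
  note bil = tensor_algebra_mult_bilinear[OF assms(1,1)]
    and bil3 = tensor_algebra_mult_bilinear[OF assms(1) aHH, simplified]
  note [simp] = tensor_map_pure[OF assms(2,2) mH mH assms(4,4)] tensor_map_pure[OF assms(3,3) mH mH assms(5,5)]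
    tensor_map_pure[OF assms(2,2,2) mMM linear_map_id(1) assms(6)]
    tensor_map_pure[OF assms(3,3,3) mNN linear_map_id(1) assms(7)]
    tensor_map_pure[OF mH mH mH mHH linear_map_id(1) assms(8)]
    tensor_map_pure[OF assms(2) mMM mH mHH assms(4) F] tensor_map_pure[OF assms(3) mNN mH mHH assms(5) G]
    linear_map_closed[OF assms(4)] linear_map_closed[OF assms(5)] linear_map_closed[OF assms(6)]
    linear_map_closed[OF assms(7)] linear_map_closed[OF F] linear_map_closed[OF G]
    tensor_algebra_mult_pure[OF assms(1,1)] tensor_algebra_mult_pure[OF assms(1) aHH, simplified]
    bilinear_closed[OF mult_bilinear[OF assms(1)]]
  show ?thesis
    unfolding HH_def
    by (rule tensor_ext2[OF assms(2,2,3,3) bilinear_postcompose[OF bilinear_compose[OF bil F G] dH]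
          bilinear_compose[OF bil3 linear_map_compose[OF dM FF] linear_map_compose[OF dN GG]] _ s t])
      (simp add: assms(9))
qed

text \<open>\<open>F \<otimes> f\<close> is an algebra map between threefold tensor powers carrying
  \<Delta>(1) \<otimes> 1 to \<open>l\<close> and 1 \<otimes> \<Delta>(1) to \<open>r\<close>; the
  axioms of \<open>K\<close> on \<Delta>(1) are transported along it.\<close>

lemma algebra_hom_comult_one:
  assumes "weak_bialgebra R K" "assoc_algebra R H" "algebra_hom R K H f"
  defines "F \<equiv> tensor_map R H H f f" and "HHH \<equiv> tensor_algebra R (tensor_algebra R H H) H"
  defines "F3 \<equiv> tensor_map R (tensor R H H) H F f (tensor_map R (tensor R K K) K (comult K) id (comult K \<one>\<^bsub>K\<^esub>))"
  defines "l \<equiv> pure R (tensor R H H) H (F (comult K \<one>\<^bsub>K\<^esub>)) \<one>\<^bsub>H\<^esub>"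
    and "r \<equiv> assoc_inv R H H H (pure R H (tensor R H H) \<one>\<^bsub>H\<^esub> (F (comult K \<one>\<^bsub>K\<^esub>)))"
  shows "l \<otimes>\<^bsub>HHH\<^esub> r = F3" "r \<otimes>\<^bsub>HHH\<^esub> l = F3"
proof -
  interpret K: weak_bialgebra R K by fact
  have aK: "assoc_algebra R K" by unfold_locales
  note mK = K.module_axioms and mH = assoc_algebra_module[OF assms(2)]
  note mKK = tensor_module[OF mK mK] and mHH = tensor_module[OF mH mH]
  note aKK = tensor_algebra_assoc_algebra[OF aK aK] and aHH = tensor_algebra_assoc_algebra[OF assms(2,2)]
  note F = tensor_map_algebra_hom[OF aK aK assms(2,2,3,3), folded F_def]
  note FF = tensor_map_algebra_hom[OF aKK aK aHH assms(2) F assms(3), simplified, folded HHH_def]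
  note f = algebra_hom_linear[OF assms(3)] and Fl = algebra_hom_linear[OF F, simplified]
  let ?d = "comult K \<one>\<^bsub>K\<^esub>"
  have one: "\<one>\<^bsub>K\<^esub> \<in> carrier K" by simp
  have d: "?d \<in> carrier (tensor R K K)" using linear_map_closed[OF K.comult_linear one] .
  let ?l = "pure R (tensor R K K) K ?d \<one>\<^bsub>K\<^esub>" and ?r = "assoc_inv R K K K (pure R K (tensor R K K) \<one>\<^bsub>K\<^esub> ?d)"
  have l: "?l \<in> carrier (tensor R (tensor R K K) K)" and r': "pure R K (tensor R K K) \<one>\<^bsub>K\<^esub> ?d \<in> carrier (tensor R K (tensor R K K))"
    using d one by (simp_all add: pure_closed mK mKK)
  have r: "?r \<in> carrier (tensor R (tensor R K K) K)"
    using linear_map_closed[OF assoc_inv_linear[OF mK mK mK] r'] .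
  have Fl: "tensor_map R (tensor R H H) H F f ?l = l"
    using d by (simp add: l_def tensor_map_pure[OF mKK mK mHH mH Fl f] algebra_hom_one[OF assms(3)])
  have Fr: "tensor_map R (tensor R H H) H F f ?r = r"
    using d assoc_inv_natural[OF mK mK mK mH mH mH f f f r']
    by (simp add: r_def F_def tensor_map_pure[OF mK mKK mH mHH f tensor_map_linear[OF mK mK mH mH f f]]
        algebra_hom_one[OF assms(3)])
  show "l \<otimes>\<^bsub>HHH\<^esub> r = F3"
    using algebra_hom_mult[OF FF, of ?l ?r] l r unfolding K.comult_one_left F3_def by (simp add: Fl Fr)
  show "r \<otimes>\<^bsub>HHH\<^esub> l = F3"
    using algebra_hom_mult[OF FF, of ?r ?l] l r unfolding K.comult_one_right F3_def by (simp add: Fl Fr)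
qed

section \<open>Tensor products of coalgebras\<close>

lemma tensor_comult_linear:
  assumes "coalgebra R A" "coalgebra R B"
  shows "linear_map R (tensor R A B) (tensor R (tensor R A B) (tensor R A B)) (tensor_comult R A B)"
proof -
  interpret A: coalgebra R A by fact
  interpret B: coalgebra R B by fact
  note m = A.module_axioms B.module_axioms
  show ?thesis
    unfolding tensor_comult_def
    by (intro linear_map_comp[OF tensor_map_linear middle_map_linear] tensor_module twist_linear m
        A.comult_linear B.comult_linear)
qed

lemma tensor_comult_pure:
  assumes "coalgebra R A" "coalgebra R B" "a \<in> carrier A" "b \<in> carrier B"
  shows "tensor_comult R A B (pure R A B a b) = middle_map R A A B B B A (twist R A B)
    (pure R (tensor R A A) (tensor R B B) (comult A a) (comult B b))"
proof -
  interpret A: coalgebra R A by fact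
  interpret B: coalgebra R B by fact
  note m = A.module_axioms B.module_axioms
  show ?thesis
    by (simp add: tensor_comult_def tensor_map_pure[OF m tensor_module[OF m(1,1)] tensor_module[OF m(2,2)]
        A.comult_linear B.comult_linear] assms)
qed

lemma tensor_counit_linear:
  assumes "coalgebra R A" "coalgebra R B"
  shows "linear_map R (tensor R A B) (regular_module R) (tensor_counit R A B)"
proof -
  interpret A: coalgebra R A by fact
  interpret B: coalgebra R B by fact
  note m = A.module_axioms B.module_axioms and mR = regular_module_module[OF A.is_cring]
  show ?thesis
    unfolding tensor_counit_def
    by (intro linear_map_comp[OF tensor_map_linear lunit_linear] m mR A.counit_linear B.counit_linear)
qed

lemma tensor_counit_pure:
  assumes "coalgebra R A" "coalgebra R B" "a \<in> carrier A" "b \<in> carrier B"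
  shows "tensor_counit R A B (pure R A B a b) = counit A a \<otimes>\<^bsub>R\<^esub> counit B b"
proof -
  interpret A: coalgebra R A by fact
  interpret B: coalgebra R B by fact
  note m = A.module_axioms B.module_axioms and mR = regular_module_module[OF A.is_cring]
  show ?thesis
    using linear_map_closed[OF A.counit_linear assms(3)] linear_map_closed[OF B.counit_linear assms(4)]
    by (simp add: tensor_counit_def tensor_map_pure[OF m mR mR A.counit_linear B.counit_linear] assms(3,4)
        lunit_pure[OF mR])
qed

text \<open>After the flip the counit of each factor meets the comultiplication of the same factor,
  so the law splits into those of \<open>A\<close> and \<open>B\<close>. The splitting
  \<open>mid_eq\<close> is stated for arbitrary \<open>s\<close> and \<open>t\<close>, since
  comultiplications need not be pure.\<close>

lemma tensor_counit_unit:
  assumes "coalgebra R A" "coalgebra R B" "x \<in> carrier (tensor R A B)"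
  shows "lunit R (tensor R A B) (tensor_map R (regular_module R) (tensor R A B) (tensor_counit R A B) id
      (tensor_comult R A B x)) = x"
    and "runit R (tensor R A B) (tensor_map R (tensor R A B) (regular_module R) id (tensor_counit R A B)
      (tensor_comult R A B x)) = x"
proof -
  let ?T = "tensor R A B" and ?k = "regular_module R"
  interpret A: coalgebra R A by fact
  interpret B: coalgebra R B by fact
  note mA = A.module_axioms and mB = B.module_axioms
  note mk = regular_module_module[OF A.is_cring]
  note mT = tensor_module[OF mA mB] and mAA = tensor_module[OF mA mA] and mBB = tensor_module[OF mB mB]
  interpret T: module R "tensor R A B" by (rule mT)
  note eT = tensor_counit_linear[OF assms(1,2)]
  let ?mid = "middle_map R A A B B B A (twist R A B)"
  let ?L = "\<lambda>z. lunit R ?T (tensor_map R ?k ?T (tensor_counit R A B) id z)"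
  let ?R = "\<lambda>z. runit R ?T (tensor_map R ?T ?k id (tensor_counit R A B) z)"
  note mid = middle_map_linear[OF mA mA mB mB mB mA twist_linear[OF mA mB]]
  have L: "linear_map R (tensor R ?T ?T) ?T ?L"
    by (rule linear_map_compose[OF tensor_map_linear[OF mT mT mk mT eT linear_map_id(1)] lunit_linear[OF mT]])
  have R: "linear_map R (tensor R ?T ?T) ?T ?R"
    by (rule linear_map_compose[OF tensor_map_linear[OF mT mT mT mk linear_map_id(1) eT] runit_linear[OF mT]])
  let ?lA = "\<lambda>s. lunit R A (tensor_map R ?k A (counit A) id s)"
    and ?lB = "\<lambda>s. lunit R B (tensor_map R ?k B (counit B) id s)"
  let ?rA = "\<lambda>s. runit R A (tensor_map R A ?k id (counit A) s)"
    and ?rB = "\<lambda>s. runit R B (tensor_map R B ?k id (counit B) s)"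
  have lA: "linear_map R (tensor R A A) A ?lA" and lB: "linear_map R (tensor R B B) B ?lB"
    and rA: "linear_map R (tensor R A A) A ?rA" and rB: "linear_map R (tensor R B B) B ?rB"
    by (rule linear_map_compose[OF tensor_map_linear lunit_linear] linear_map_compose[OF tensor_map_linear runit_linear];
        intro mA mB mk A.counit_linear B.counit_linear linear_map_id)+
  note [simp] = linear_map_closed[OF A.counit_linear, simplified] linear_map_closed[OF B.counit_linear, simplified]
    tensor_counit_pure[OF assms(1,2)] pure_closed[OF mA mB]
    tensor_map_pure[OF mT mT mk mT eT linear_map_id(1)] tensor_map_pure[OF mT mT mT mk linear_map_id(1) eT]
    tensor_map_pure[OF mA mA mk mA A.counit_linear linear_map_id(1)]
    tensor_map_pure[OF mB mB mk mB B.counit_linear linear_map_id(1)]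
    tensor_map_pure[OF mA mA mA mk linear_map_id(1) A.counit_linear]
    tensor_map_pure[OF mB mB mB mk linear_map_id(1) B.counit_linear]
    lunit_pure[OF mA] lunit_pure[OF mB] lunit_pure[OF mT] runit_pure[OF mA] runit_pure[OF mB] runit_pure[OF mT]
    linear_map_smult[OF pure_left_linear[OF mA mB]] linear_map_smult[OF pure_right_linear[OF mA mB]]
  note pb = pure_bilinear[OF mA mB] and mb = pure_bilinear[OF mAA mBB]
  have mid_eq: "?L (?mid (pure R (tensor R A A) (tensor R B B) s t)) = pure R A B (?lA s) (?lB t) \<and>
      ?R (?mid (pure R (tensor R A A) (tensor R B B) s t)) = pure R A B (?rA s) (?rB t)"
    if s: "s \<in> carrier (tensor R A A)" and t: "t \<in> carrier (tensor R B B)" for s t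
    by (intro conjI tensor_ext2[OF mA mA mB mB bilinear_postcompose[OF mb linear_map_compose[OF mid L]]
          bilinear_compose[OF pb lA lB] _ s t]
        tensor_ext2[OF mA mA mB mB bilinear_postcompose[OF mb linear_map_compose[OF mid R]]
          bilinear_compose[OF pb rA rB] _ s t])
      (simp_all add: middle_map_twist_pure mA mB A.m_comm flip: T.smult_assoc1)
  note D = tensor_comult_linear[OF assms(1,2)]
  show "?L (tensor_comult R A B x) = x"
    by (rule tensor_ext[OF mA mB linear_map_compose[OF D L] linear_map_id(2) _ assms(3)])
      (use A.counit_left B.counit_left in \<open>simp add: tensor_comult_pure[OF assms(1,2)] mid_eq
        linear_map_closed[OF A.comult_linear] linear_map_closed[OF B.comult_linear]\<close>)
  show "?R (tensor_comult R A B x) = x"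
    by (rule tensor_ext[OF mA mB linear_map_compose[OF D R] linear_map_id(2) _ assms(3)])
      (use A.counit_right B.counit_right in \<open>simp add: tensor_comult_pure[OF assms(1,2)] mid_eq
        linear_map_closed[OF A.comult_linear] linear_map_closed[OF B.comult_linear]\<close>)
qed

section \<open>The coalgebra structure of the weak wreath product\<close>

locale weak_wreath_bialgebra = weak_inverse_pair R A B \<psi> \<phi> + KA: weak_bialgebra R A + KB: weak_bialgebra R B
  for R :: "('r, 'q) ring_scheme" (structure)
    and A :: "('r, 'a, 'm) bialgebra_data_scheme" and B :: "('r, 'b, 'n) bialgebra_data_scheme"
    and \<psi> \<phi> +
  assumes weakly_comonoidal: "weakly_comonoidal R A B \<psi> \<phi>"
begin

lemmas aA = P.aA and aB = P.aB and mA = P.mA and mB = P.mB and mX = P.mX and mY = P.mY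
lemmas cA = KA.coalgebra_axioms and cB = KB.coalgebra_axioms
lemmas aHH = tensor_algebra_assoc_algebra[OF H_algebra H_algebra]
lemmas aHHH = tensor_algebra_assoc_algebra[OF aHH H_algebra]
lemmas mHH = tensor_module[OF mH mH]

abbreviation HH where "HH \<equiv> tensor_algebra R H H"
abbreviation pH where "pH \<equiv> pure R H H"
abbreviation \<Delta>H where "\<Delta>H \<equiv> comult H"
definition AA where "AA = tensor_map R H H iA iA"
definition BB where "BB = tensor_map R H H iB iB"

lemmas iA_linear = algebra_hom_linear[OF iA_hom] and iB_linear = algebra_hom_linear[OF iB_hom]

lemma AA_hom: "algebra_hom R (tensor_algebra R A A) HH AA"
  and BB_hom: "algebra_hom R (tensor_algebra R B B) HH BB"
  unfolding AA_def BB_def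
  by (intro tensor_map_algebra_hom aA aB H_algebra iA_hom iB_hom)+

lemmas AA_closed [simp] = algebra_hom_closed[OF AA_hom, simplified]
lemmas BB_closed [simp] = algebra_hom_closed[OF BB_hom, simplified]
lemmas AA_linear = algebra_hom_linear[OF AA_hom, simplified]
lemmas BB_linear = algebra_hom_linear[OF BB_hom, simplified]
lemmas comult_A_closed [simp] = linear_map_closed[OF KA.comult_linear]
lemmas comult_B_closed [simp] = linear_map_closed[OF KB.comult_linear]

lemma H_comult: "\<Delta>H w = tensor_map R H H e e (tensor_comult R B A w)"
  and H_counit: "counit H w = tensor_counit R B A w"
proof -
  have "\<Delta>H = tensor_map R (image_module X e) (image_module X e) e e \<circ> tensor_comult R B A \<circ> id"
    "counit H = tensor_counit R B A \<circ> id"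
    unfolding H_def weak_wreath_product_def e_def[symmetric] by (simp_all add: wreath_along_def)
  then show "\<Delta>H w = tensor_map R H H e e (tensor_comult R B A w)" "counit H w = tensor_counit R B A w"
    by (simp_all add: tensor_image_module)
qed

lemma comult_H_linear: "linear_map R H (tensor R H H) \<Delta>H"
  unfolding H_comult
  by (rule linear_map_compose[OF linear_map_compose[OF H_linear(1) tensor_comult_linear[OF cB cA]]
        tensor_map_linear[OF mX mX mH mH e_linear_H e_linear_H]])

lemma counit_H_linear: "linear_map R H (regular_module R) (counit H)"
  unfolding H_counit
  by (rule linear_map_compose[OF H_linear(1) tensor_counit_linear[OF cB cA]])

lemmas comult_H_closed [simp] = linear_map_closed[OF comult_H_linear]
lemmas counit_H_closed [simp] = linear_map_closed[OF counit_H_linear, simplified]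

lemmas tensor_comult_X_closed = linear_map_closed[OF tensor_comult_linear[OF cB cA]]
lemmas tensor_comult_Y_closed = linear_map_closed[OF tensor_comult_linear[OF cA cB]]

lemma comonoidal_psi:
  assumes "y \<in> carrier Y"
  shows "tensor_map R X X e id (tensor_comult R B A (\<psi> y)) = tensor_map R X X \<psi> \<psi> (tensor_comult R A B y)"
    and "tensor_map R X X id e (tensor_comult R B A (\<psi> y)) = tensor_map R X X \<psi> \<psi> (tensor_comult R A B y)"
  using weakly_comonoidal assms unfolding weakly_comonoidal_def e_def[symmetric] comp_apply by metis+

lemma comonoidal_phi:
  assumes "x \<in> carrier X"
  shows "tensor_map R Y Y (\<phi> \<circ> \<psi>) id (tensor_comult R A B (\<phi> x)) = tensor_map R Y Y \<phi> \<phi> (tensor_comult R B A x)"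
  using weakly_comonoidal assms unfolding weakly_comonoidal_def comp_apply by metis

lemma comonoidal_counit:
  assumes "y \<in> carrier Y"
  shows "tensor_counit R B A (\<psi> y) = tensor_counit R A B (\<phi> (\<psi> y))"
  using weakly_comonoidal assms unfolding weakly_comonoidal_def comp_apply by metis

text \<open>The two projections \<psi>\<phi> in the comultiplication of \<open>H\<close> absorb the
  one-sided \<psi>\<phi> of the comonoidality condition, and \<psi>\<phi>\<psi> = \<psi> removes
  them from the other side of that condition.\<close>

lemma comult_psi:
  assumes "y \<in> carrier Y"
  shows "\<Delta>H (\<psi> y) = tensor_map R H H \<psi> \<psi> (tensor_comult R A B y)"
proof -
  have "\<Delta>H (\<psi> y) = tensor_map R H H e e (tensor_map R X X e id (tensor_comult R B A (\<psi> y)))"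
    unfolding H_comult
    by (rule tensor_map_fuse[OF mX mX mX mX mH mH e_linear linear_map_id(1) e_linear_H e_linear_H, symmetric])
      (simp_all add: tensor_comult_X_closed assms)
  also have "\<dots> = tensor_map R H H \<psi> \<psi> (tensor_comult R A B y)"
    unfolding comonoidal_psi(1)[OF assms]
    by (rule tensor_map_fuse[OF mY mY mX mX mH mH P.psi_linear P.psi_linear e_linear_H e_linear_H])
      (simp_all add: tensor_comult_Y_closed assms)
  finally show ?thesis .
qed

text \<open>Rests on the condition for \<phi>: after \<open>comult_psi\<close> at \<phi>(x), the
  one-sided \<phi>\<psi> can be inserted under \<psi> \<otimes> \<psi>. In effect x need not be
  projected before it is comultiplied.\<close>

lemma comult_e:
  assumes "x \<in> carrier X"
  shows "\<Delta>H (e x) = tensor_map R H H e e (tensor_comult R B A x)"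
proof -
  have "\<Delta>H (e x) = tensor_map R H H \<psi> \<psi> (tensor_comult R A B (\<phi> x))"
    using comult_psi[of "\<phi> x"] assms by simp
  also have "\<dots> = tensor_map R H H \<psi> \<psi> (tensor_map R Y Y (\<phi> \<circ> \<psi>) id (tensor_comult R A B (\<phi> x)))"
    by (rule tensor_map_fuse[OF mY mY mY mY mH mH linear_map_comp[OF P.psi_linear Q.psi_linear] linear_map_id(1)
          psi_linear_H psi_linear_H, symmetric])
      (simp_all add: tensor_comult_Y_closed assms)
  also have "\<dots> = tensor_map R H H e e (tensor_comult R B A x)"
    unfolding comonoidal_phi[OF assms]
    by (rule tensor_map_fuse[OF mX mX mY mY mH mH Q.psi_linear Q.psi_linear psi_linear_H psi_linear_H])
      (simp_all add: tensor_comult_X_closed assms)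
  finally show ?thesis .
qed

lemma comult_iA_iB:
  assumes "a \<in> carrier A" "b \<in> carrier B"
  shows "\<Delta>H (iA a \<otimes>\<^bsub>H\<^esub> iB b) = AA (comult A a) \<otimes>\<^bsub>HH\<^esub> BB (comult B b)"
  unfolding AA_def BB_def
  by (simp add: iA_iB comult_psi tensor_comult_pure cA cB assms)
    (rule middle_map_product[OF H_algebra mA mB iA_linear iB_linear psi_linear_H]; simp add: iA_iB assms)

lemma comult_iB_iA:
  assumes "a \<in> carrier A" "b \<in> carrier B"
  shows "\<Delta>H (iB b \<otimes>\<^bsub>H\<^esub> iA a) = BB (comult B b) \<otimes>\<^bsub>HH\<^esub> AA (comult A a)"
  unfolding AA_def BB_def
  by (simp add: iB_iA comult_e tensor_comult_pure cA cB assms)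
    (rule middle_map_product[OF H_algebra mB mA iB_linear iA_linear e_linear_H]; simp add: iB_iA assms)

text \<open>\<psi>\<phi> is onto \<open>H\<close> and sends b \<otimes> a to \<open>iB b\<close>
  times \<open>iA a\<close>, so these products span \<open>H\<close>.\<close>

lemma ext_iB_iA:
  assumes "linear_map R H M f" "linear_map R H M g"
    and "\<And>a b. \<lbrakk>a \<in> carrier A; b \<in> carrier B\<rbrakk> \<Longrightarrow> f (iB b \<otimes>\<^bsub>H\<^esub> iA a) = g (iB b \<otimes>\<^bsub>H\<^esub> iA a)"
    and "w \<in> carrier H"
  shows "f w = g w"
proof -
  have "f (e w) = g (e w)"
    by (rule tensor_ext[OF mB mA linear_map_compose[OF e_linear_H assms(1)] linear_map_compose[OF e_linear_H assms(2)]
          _ H_in_X[OF assms(4)]]) (simp add: assms(3) flip: iB_iA)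
  then show ?thesis using assms(4) by (simp add: in_H)
qed

text \<open>\<psi> is onto \<open>H\<close> as well, since w = \<psi>(\<phi>(w)); hence the products
  in the opposite order span \<open>H\<close> too.\<close>

lemma ext_iA_iB:
  assumes "linear_map R H M f" "linear_map R H M g"
    and "\<And>a b. \<lbrakk>a \<in> carrier A; b \<in> carrier B\<rbrakk> \<Longrightarrow> f (iA a \<otimes>\<^bsub>H\<^esub> iB b) = g (iA a \<otimes>\<^bsub>H\<^esub> iB b)"
    and "w \<in> carrier H"
  shows "f w = g w"
proof -
  have "f (\<psi> (\<phi> w)) = g (\<psi> (\<phi> w))"
    by (rule tensor_ext[OF mA mB linear_map_compose[OF psi_linear_H assms(1)] linear_map_compose[OF psi_linear_H assms(2)]])
      (simp_all add: assms(3,4) H_in_X flip: iA_iB)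
  then show ?thesis using assms(4) by (simp add: in_H)
qed

lemmas mult_H_closed [simp] = bilinear_closed[OF mult_bilinear[OF H_algebra]]
lemmas mult_H_left = mult_left_linear[OF H_algebra] and mult_H_right = mult_right_linear[OF H_algebra]
lemmas mult_HH_closed [simp] = bilinear_closed[OF mult_bilinear[OF aHH], simplified]
lemmas mult_HH_left = mult_left_linear[OF aHH, simplified] and mult_HH_right = mult_right_linear[OF aHH, simplified]

sublocale HA: ring H by (rule assoc_algebra_ring[OF H_algebra])
sublocale HHA: ring HH rewrites "carrier HH = carrier (tensor R H H)"
  by (rule assoc_algebra_ring[OF aHH]) simp

text \<open>Multiplying by \<open>iB b\<close> on the left and by \<open>iA a\<close> on the right
  keeps a product of a B-element and an A-element in this order, in which \<Delta> is known.\<close>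

lemma comult_iB_left_iA_right:
  assumes "a \<in> carrier A" "b \<in> carrier B" "w \<in> carrier H"
  shows "\<Delta>H (iB b \<otimes>\<^bsub>H\<^esub> w \<otimes>\<^bsub>H\<^esub> iA a) = BB (comult B b) \<otimes>\<^bsub>HH\<^esub> \<Delta>H w \<otimes>\<^bsub>HH\<^esub> AA (comult A a)"
proof (rule ext_iB_iA[OF _ _ _ assms(3)])
  show "linear_map R H (tensor R H H) (\<lambda>w. \<Delta>H (iB b \<otimes>\<^bsub>H\<^esub> w \<otimes>\<^bsub>H\<^esub> iA a))"
    by (rule linear_map_compose[OF linear_map_compose[OF mult_H_right mult_H_left] comult_H_linear])
      (simp_all add: assms)
  show "linear_map R H (tensor R H H) (\<lambda>w. BB (comult B b) \<otimes>\<^bsub>HH\<^esub> \<Delta>H w \<otimes>\<^bsub>HH\<^esub> AA (comult A a))"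
    by (rule linear_map_compose[OF linear_map_compose[OF comult_H_linear mult_HH_right] mult_HH_left])
      (simp_all add: assms)
  fix a' b' assume ab': "a' \<in> carrier A" "b' \<in> carrier B"
  have "iB b \<otimes>\<^bsub>H\<^esub> (iB b' \<otimes>\<^bsub>H\<^esub> iA a') \<otimes>\<^bsub>H\<^esub> iA a = iB (b \<otimes>\<^bsub>B\<^esub> b') \<otimes>\<^bsub>H\<^esub> iA (a' \<otimes>\<^bsub>A\<^esub> a)"
    using assms ab' by (simp add: algebra_hom_mult[OF iA_hom] algebra_hom_mult[OF iB_hom] HA.m_assoc)
  then have "\<Delta>H (iB b \<otimes>\<^bsub>H\<^esub> (iB b' \<otimes>\<^bsub>H\<^esub> iA a') \<otimes>\<^bsub>H\<^esub> iA a) =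
      BB (comult B (b \<otimes>\<^bsub>B\<^esub> b')) \<otimes>\<^bsub>HH\<^esub> AA (comult A (a' \<otimes>\<^bsub>A\<^esub> a))"
    using assms ab' by (simp add: comult_iB_iA)
  also have "\<dots> = BB (comult B b) \<otimes>\<^bsub>HH\<^esub> \<Delta>H (iB b' \<otimes>\<^bsub>H\<^esub> iA a') \<otimes>\<^bsub>HH\<^esub> AA (comult A a)"
    using assms ab'
    by (simp add: KA.comult_mult KB.comult_mult algebra_hom_mult[OF AA_hom] algebra_hom_mult[OF BB_hom]
        comult_iB_iA HHA.m_assoc)
  finally show "\<Delta>H (iB b \<otimes>\<^bsub>H\<^esub> (iB b' \<otimes>\<^bsub>H\<^esub> iA a') \<otimes>\<^bsub>H\<^esub> iA a) =
    BB (comult B b) \<otimes>\<^bsub>HH\<^esub> \<Delta>H (iB b' \<otimes>\<^bsub>H\<^esub> iA a') \<otimes>\<^bsub>HH\<^esub> AA (comult A a)" .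
qed

text \<open>In (b a)(b' a') the factors are regrouped as b (a b') a'. The outer ones come off by
  \<open>comult_iB_left_iA_right\<close>, and the inner product is in the order covered by
  \<open>comult_iA_iB\<close>.\<close>

lemma comult_H_mult:
  assumes "x \<in> carrier H" "y \<in> carrier H"
  shows "\<Delta>H (x \<otimes>\<^bsub>H\<^esub> y) = \<Delta>H x \<otimes>\<^bsub>HH\<^esub> \<Delta>H y"
proof (rule ext_iB_iA[OF linear_map_compose[OF mult_H_left comult_H_linear]
      linear_map_compose[OF comult_H_linear mult_HH_left] _ assms(1)])
  fix a b assume ab: "a \<in> carrier A" "b \<in> carrier B"
  show "\<Delta>H (iB b \<otimes>\<^bsub>H\<^esub> iA a \<otimes>\<^bsub>H\<^esub> y) = \<Delta>H (iB b \<otimes>\<^bsub>H\<^esub> iA a) \<otimes>\<^bsub>HH\<^esub> \<Delta>H y"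
  proof (rule ext_iB_iA[OF linear_map_compose[OF mult_H_right comult_H_linear]
        linear_map_compose[OF comult_H_linear mult_HH_right] _ assms(2)])
    fix a' b' assume ab': "a' \<in> carrier A" "b' \<in> carrier B"
    have "iB b \<otimes>\<^bsub>H\<^esub> iA a \<otimes>\<^bsub>H\<^esub> (iB b' \<otimes>\<^bsub>H\<^esub> iA a') = iB b \<otimes>\<^bsub>H\<^esub> (iA a \<otimes>\<^bsub>H\<^esub> iB b') \<otimes>\<^bsub>H\<^esub> iA a'"
      using ab ab' by (simp add: HA.m_assoc)
    then show "\<Delta>H (iB b \<otimes>\<^bsub>H\<^esub> iA a \<otimes>\<^bsub>H\<^esub> (iB b' \<otimes>\<^bsub>H\<^esub> iA a')) =
      \<Delta>H (iB b \<otimes>\<^bsub>H\<^esub> iA a) \<otimes>\<^bsub>HH\<^esub> \<Delta>H (iB b' \<otimes>\<^bsub>H\<^esub> iA a')"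
      using ab ab' by (simp add: comult_iB_left_iA_right comult_iB_iA comult_iA_iB HHA.m_assoc)
  qed (simp_all add: ab)
qed (simp_all add: assms)

text \<open>On a product of a B-element and an A-element, each iterated comultiplication is a
  product of a term from \<open>B\<close> and a term from \<open>A\<close>. Reassociation is an
  algebra map, so the claim separates into coassociativity of \<open>B\<close> and of
  \<open>A\<close>.\<close>

lemma coassoc_H:
  assumes "x \<in> carrier H"
  shows "assoc R H H H (tensor_map R (tensor R H H) H \<Delta>H id (\<Delta>H x)) =
    tensor_map R H (tensor R H H) id \<Delta>H (\<Delta>H x)"
proof (rule ext_iB_iA[OF _ _ _ assms])
  note dl = tensor_map_linear[OF mH mH mHH mH comult_H_linear linear_map_id(1)]
    and dr = tensor_map_linear[OF mH mH mH mHH linear_map_id(1) comult_H_linear]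
  show "linear_map R H (tensor R H (tensor R H H)) (\<lambda>x. assoc R H H H (tensor_map R (tensor R H H) H \<Delta>H id (\<Delta>H x)))"
    by (rule linear_map_compose[OF linear_map_compose[OF comult_H_linear dl] assoc_linear[OF mH mH mH]])
  show "linear_map R H (tensor R H (tensor R H H)) (\<lambda>x. tensor_map R H (tensor R H H) id \<Delta>H (\<Delta>H x))"
    by (rule linear_map_compose[OF comult_H_linear dr])
  fix a b assume ab: "a \<in> carrier A" "b \<in> carrier B"
  let ?A3 = "tensor_map R (tensor R H H) H AA iA" and ?B3 = "tensor_map R (tensor R H H) H BB iB"
  let ?A3' = "tensor_map R H (tensor R H H) iA AA" and ?B3' = "tensor_map R H (tensor R H H) iB BB"
  note mAA = tensor_module[OF mA mA] and mBB = tensor_module[OF mB mB]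
  let ?a = "tensor_map R (tensor R A A) A (comult A) id (comult A a)"
  let ?b = "tensor_map R (tensor R B B) B (comult B) id (comult B b)"
  have a: "?a \<in> carrier (tensor R (tensor R A A) A)"
    using ab by (intro linear_map_closed[OF tensor_map_linear[OF mA mA mAA mA KA.comult_linear linear_map_id(1)]]) simp
  have b: "?b \<in> carrier (tensor R (tensor R B B) B)"
    using ab by (intro linear_map_closed[OF tensor_map_linear[OF mB mB mBB mB KB.comult_linear linear_map_id(1)]]) simp
  have a3: "?A3 ?a \<in> carrier (tensor R (tensor R H H) H)"
    using a by (intro linear_map_closed[OF tensor_map_linear[OF mAA mA mHH mH]] AA_linear iA_linear)
  have b3: "?B3 ?b \<in> carrier (tensor R (tensor R H H) H)"
    using b by (intro linear_map_closed[OF tensor_map_linear[OF mBB mB mHH mH]] BB_linear iB_linear)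
  have D: "\<Delta>H (iB b \<otimes>\<^bsub>H\<^esub> iA a) = BB (comult B b) \<otimes>\<^bsub>HH\<^esub> AA (comult A a)"
    using ab by (rule comult_iB_iA)
  have "tensor_map R (tensor R H H) H \<Delta>H id (\<Delta>H (iB b \<otimes>\<^bsub>H\<^esub> iA a)) =
      ?B3 ?b \<otimes>\<^bsub>tensor_algebra R HH H\<^esub> ?A3 ?a"
    unfolding D AA_def BB_def
    by (rule comult_product_left[OF H_algebra mB mA iB_linear iA_linear KB.comult_linear KA.comult_linear comult_H_linear])
      (simp_all add: comult_iB_iA ab flip: AA_def BB_def)
  then have "assoc R H H H (tensor_map R (tensor R H H) H \<Delta>H id (\<Delta>H (iB b \<otimes>\<^bsub>H\<^esub> iA a))) =
      assoc R H H H (?B3 ?b) \<otimes>\<^bsub>tensor_algebra R H HH\<^esub> assoc R H H H (?A3 ?a)"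
    using algebra_hom_mult[OF tensor_algebra_assoc_hom(2)[OF H_algebra H_algebra H_algebra], of "?B3 ?b" "?A3 ?a"] a3 b3
    by simp
  also have "assoc R H H H (?B3 ?b) = ?B3' (tensor_map R B (tensor R B B) id (comult B) (comult B b))"
    using KB.coassoc[OF ab(2)] assoc_natural[OF mB mB mB mH mH mH iB_linear iB_linear iB_linear b]
    by (simp add: BB_def)
  also have "assoc R H H H (?A3 ?a) = ?A3' (tensor_map R A (tensor R A A) id (comult A) (comult A a))"
    using KA.coassoc[OF ab(1)] assoc_natural[OF mA mA mA mH mH mH iA_linear iA_linear iA_linear a]
    by (simp add: AA_def)
  also have "?B3' (tensor_map R B (tensor R B B) id (comult B) (comult B b)) \<otimes>\<^bsub>tensor_algebra R H HH\<^esub>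
      ?A3' (tensor_map R A (tensor R A A) id (comult A) (comult A a)) =
      tensor_map R H (tensor R H H) id \<Delta>H (\<Delta>H (iB b \<otimes>\<^bsub>H\<^esub> iA a))"
    unfolding D AA_def BB_def
    by (rule comult_product_right[OF H_algebra mB mA iB_linear iA_linear KB.comult_linear KA.comult_linear comult_H_linear, symmetric])
      (simp_all add: comult_iB_iA ab flip: AA_def BB_def)
  finally show "assoc R H H H (tensor_map R (tensor R H H) H \<Delta>H id (\<Delta>H (iB b \<otimes>\<^bsub>H\<^esub> iA a))) =
    tensor_map R H (tensor R H H) id \<Delta>H (\<Delta>H (iB b \<otimes>\<^bsub>H\<^esub> iA a))" .
qed

text \<open>Each law uses the comonoidality equation with \<psi>\<phi> on the leg not read by the
  counit. The other leg is then free of \<psi>\<phi>, and the remaining \<psi>\<phi> is pulled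
  outside the counit law of B \<otimes> A, where it fixes \<open>w\<close>.\<close>

lemma counit_law_H:
  assumes "w \<in> carrier H"
  shows "lunit R H (tensor_map R (regular_module R) H (counit H) id (\<Delta>H w)) = w"
    and "runit R H (tensor_map R H (regular_module R) id (counit H) (\<Delta>H w)) = w"
proof -
  let ?k = "regular_module R" and ?\<epsilon> = "tensor_counit R B A"
  note mk = regular_module_module[OF module.axioms(1)[OF mA]]
  note \<epsilon> = tensor_counit_linear[OF cB cA]
  let ?y = "\<phi> w"
  have y: "?y \<in> carrier Y" and w: "\<psi> ?y = w" "e w = w" "w \<in> carrier X"
    using assms by (simp_all add: in_H)
  let ?D = "tensor_comult R B A w"
  have D: "?D \<in> carrier (tensor R X X)" by (rule tensor_comult_X_closed[OF w(3)])
  have dw: "\<Delta>H w = tensor_map R H H \<psi> \<psi> (tensor_comult R A B ?y)"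
    using comult_psi[OF y] w by simp
  have "tensor_map R ?k H (counit H) id (\<Delta>H w) = tensor_map R ?k H (\<lambda>y. ?\<epsilon> (\<psi> y)) \<psi> (tensor_comult R A B ?y)"
    unfolding dw
    by (rule tensor_map_fuse[OF mY mY mH mH mk mH psi_linear_H psi_linear_H counit_H_linear linear_map_id(1)])
      (simp_all add: H_counit tensor_comult_Y_closed y)
  \<comment> \<open>Writing the second \<psi> as \<psi>\<phi>\<psi> exposes \<psi> \<otimes> \<psi>,
    to which the comonoidality condition applies.\<close>
  also have "\<dots> = tensor_map R ?k H ?\<epsilon> e (tensor_map R X X \<psi> \<psi> (tensor_comult R A B ?y))"
    by (rule tensor_map_fuse[OF mY mY mX mX mk mH P.psi_linear P.psi_linear \<epsilon> e_linear_H, symmetric])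
      (simp_all add: tensor_comult_Y_closed y)
  also have "\<dots> = tensor_map R ?k H ?\<epsilon> e ?D"
    unfolding comonoidal_psi(2)[OF y, symmetric] w
    by (rule tensor_map_fuse[OF mX mX mX mX mk mH linear_map_id(1) e_linear \<epsilon> e_linear_H]) (simp_all add: D)
  finally have "lunit R H (tensor_map R ?k H (counit H) id (\<Delta>H w)) = lunit R H (tensor_map R ?k H ?\<epsilon> e ?D)"
    by simp
  also have "\<dots> = e (lunit R X (tensor_map R ?k X ?\<epsilon> id ?D))"
    by (rule tensor_ext[OF mX mX linear_map_compose[OF tensor_map_linear lunit_linear]
          linear_map_compose[OF linear_map_compose[OF tensor_map_linear lunit_linear] e_linear_H] _ D])
      (simp_all add: mX mk mH \<epsilon> e_linear_H linear_map_id lunit_pure tensor_map_pure[OF mX mX mk mH \<epsilon> e_linear_H]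
        tensor_map_pure[OF mX mX mk mX \<epsilon> linear_map_id(1)] linear_map_closed[OF \<epsilon>, simplified]
        linear_map_smult[OF e_linear])
  finally show "lunit R H (tensor_map R ?k H (counit H) id (\<Delta>H w)) = w"
    by (simp add: tensor_counit_unit(1)[OF cB cA w(3)] w)
  have "tensor_map R H ?k id (counit H) (\<Delta>H w) = tensor_map R H ?k \<psi> (\<lambda>y. ?\<epsilon> (\<psi> y)) (tensor_comult R A B ?y)"
    unfolding dw
    by (rule tensor_map_fuse[OF mY mY mH mH mH mk psi_linear_H psi_linear_H linear_map_id(1) counit_H_linear])
      (simp_all add: H_counit tensor_comult_Y_closed y)
  also have "\<dots> = tensor_map R H ?k e ?\<epsilon> (tensor_map R X X \<psi> \<psi> (tensor_comult R A B ?y))"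
    by (rule tensor_map_fuse[OF mY mY mX mX mH mk P.psi_linear P.psi_linear e_linear_H \<epsilon>, symmetric])
      (simp_all add: tensor_comult_Y_closed y)
  also have "\<dots> = tensor_map R H ?k e ?\<epsilon> ?D"
    unfolding comonoidal_psi(1)[OF y, symmetric] w
    by (rule tensor_map_fuse[OF mX mX mX mX mH mk e_linear linear_map_id(1) e_linear_H \<epsilon>]) (simp_all add: D)
  finally have "runit R H (tensor_map R H ?k id (counit H) (\<Delta>H w)) = runit R H (tensor_map R H ?k e ?\<epsilon> ?D)"
    by simp
  also have "\<dots> = e (runit R X (tensor_map R X ?k id ?\<epsilon> ?D))"
    by (rule tensor_ext[OF mX mX linear_map_compose[OF tensor_map_linear runit_linear]
          linear_map_compose[OF linear_map_compose[OF tensor_map_linear runit_linear] e_linear_H] _ D])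
      (simp_all add: mX mk mH \<epsilon> e_linear_H linear_map_id runit_pure tensor_map_pure[OF mX mX mH mk e_linear_H \<epsilon>]
        tensor_map_pure[OF mX mX mX mk linear_map_id(1) \<epsilon>] linear_map_closed[OF \<epsilon>, simplified]
        linear_map_smult[OF e_linear])
  finally show "runit R H (tensor_map R H ?k id (counit H) (\<Delta>H w)) = w"
    by (simp add: tensor_counit_unit(2)[OF cB cA w(3)] w)
qed

lemma H_coalgebra: "coalgebra R H"
  by (intro coalgebra.intro coalgebra_axioms.intro mH comult_H_linear counit_H_linear)
    (simp_all add: coassoc_H counit_law_H)

end

section \<open>Functionals on a weak bialgebra\<close>

lemma functional_product_bilinear:
  assumes "cring R" "linear_map R M (regular_module R) f" "linear_map R N (regular_module R) g"
  shows "bilinear R M N (regular_module R) (\<lambda>u v. f u \<otimes>\<^bsub>R\<^esub> g v)"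
  using bilinear_compose[OF smult_bilinear[OF regular_module_module[OF assms(1)]] assms(2,3)] by simp

lemma functional_mult_const:
  assumes "cring R" "linear_map R M (regular_module R) f" "c \<in> carrier R"
  shows "linear_map R M (regular_module R) (\<lambda>u. f u \<otimes>\<^bsub>R\<^esub> c)"
    and "linear_map R M (regular_module R) (\<lambda>u. c \<otimes>\<^bsub>R\<^esub> f u)"
  using linear_map_compose[OF assms(2) bilinear_left[OF smult_bilinear[OF regular_module_module[OF assms(1)]]], of c]
    linear_map_compose[OF assms(2) bilinear_right[OF smult_bilinear[OF regular_module_module[OF assms(1)]]], of c]
    assms(3) by simp_all

lemma tensor_lift_cong:
  assumes "module R A" "module R B" "module R M" "bilinear R A B M f"
    and "\<And>a b. \<lbrakk>a \<in> carrier A; b \<in> carrier B\<rbrakk> \<Longrightarrow> f a b = g a b"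
    and "t \<in> carrier (tensor R A B)"
  shows "tensor_lift R M f t = tensor_lift R M g t"
proof -
  have "bilinear R A B M g"
  proof (rule bilinearI)
    show "linear_map R B M (g a)" if a: "a \<in> carrier A" for a
      by (rule linear_map_cong[OF bilinear_right[OF assms(4) a] assms(2) assms(5)[OF a]])
    show "linear_map R A M (\<lambda>a. g a b)" if b: "b \<in> carrier B" for b
      by (rule linear_map_cong[OF bilinear_left[OF assms(4) b] assms(1) assms(5)[OF _ b]])
  qed
  then show ?thesis
    by (intro tensor_ext[OF assms(1,2) tensor_lift_linear[OF assms(1-4)] tensor_lift_linear[OF assms(1-3)] _ assms(6)])
      (simp_all add: tensor_lift_pure assms(1-5))
qed

lemma tensor_lift_counit:
  assumes "coalgebra R C" and f: "linear_map R C (regular_module R) f" and x: "x \<in> carrier (tensor R C C)"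
  shows "tensor_lift R (regular_module R) (\<lambda>a b. f a \<otimes>\<^bsub>R\<^esub> counit C b) x =
      f (runit R C (tensor_map R C (regular_module R) id (counit C) x))"
    and "tensor_lift R (regular_module R) (\<lambda>a b. counit C a \<otimes>\<^bsub>R\<^esub> f b) x =
      f (lunit R C (tensor_map R (regular_module R) C (counit C) id x))"
proof -
  interpret C: coalgebra R C by fact
  note mC = C.module_axioms and e = C.counit_linear
  note mk = regular_module_module[OF C.is_cring]
  note fe = functional_product_bilinear[OF C.is_cring f e] and ef = functional_product_bilinear[OF C.is_cring e f]
  note [simp] = linear_map_closed[OF f, simplified] linear_map_closed[OF e, simplified]
  show "tensor_lift R (regular_module R) (\<lambda>a b. f a \<otimes>\<^bsub>R\<^esub> counit C b) x =
      f (runit R C (tensor_map R C (regular_module R) id (counit C) x))"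
    by (rule tensor_ext[OF mC mC tensor_lift_linear[OF mC mC mk fe] linear_map_compose[OF linear_map_compose[OF
          tensor_map_linear[OF mC mC mC mk linear_map_id(1) e] runit_linear[OF mC]] f] _ x])
      (simp add: tensor_lift_pure[OF mC mC mk fe] C.m_comm runit_pure[OF mC] linear_map_smult[OF f]
        tensor_map_pure[OF mC mC mC mk linear_map_id(1) e])
  show "tensor_lift R (regular_module R) (\<lambda>a b. counit C a \<otimes>\<^bsub>R\<^esub> f b) x =
      f (lunit R C (tensor_map R (regular_module R) C (counit C) id x))"
    by (rule tensor_ext[OF mC mC tensor_lift_linear[OF mC mC mk ef] linear_map_compose[OF linear_map_compose[OF
          tensor_map_linear[OF mC mC mk mC e linear_map_id(1)] lunit_linear[OF mC]] f] _ x])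
      (simp add: tensor_lift_pure[OF mC mC mk ef] lunit_pure[OF mC] linear_map_smult[OF f]
        tensor_map_pure[OF mC mC mk mC e linear_map_id(1)])
qed

lemma tensor_cube_homs:
  assumes "assoc_algebra R H"
  shows "algebra_hom R (tensor_algebra R H H) (tensor_algebra R (tensor_algebra R H H) H)
      (\<lambda>t. pure R (tensor R H H) H t \<one>\<^bsub>H\<^esub>)"
    and "algebra_hom R (tensor_algebra R H H) (tensor_algebra R (tensor_algebra R H H) H)
      (\<lambda>t. assoc_inv R H H H (pure R H (tensor R H H) \<one>\<^bsub>H\<^esub> t))"
  using pure_one_algebra_hom(1)[OF tensor_algebra_assoc_algebra[OF assms assms] assms]
    algebra_hom_compose[OF pure_one_algebra_hom(2)[OF assms tensor_algebra_assoc_algebra[OF assms assms]]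
      tensor_algebra_assoc_hom(1)[OF assms assms assms]] by simp_all

lemma tensor_cube_mult:
  assumes "assoc_algebra R H" "a \<in> carrier H" "a' \<in> carrier H"
    and "y \<in> carrier (tensor R H H)" "y' \<in> carrier (tensor R H H)"
  shows "pure R (tensor R H H) H y a \<otimes>\<^bsub>tensor_algebra R (tensor_algebra R H H) H\<^esub> pure R (tensor R H H) H y' a' =
      pure R (tensor R H H) H (y \<otimes>\<^bsub>tensor_algebra R H H\<^esub> y') (a \<otimes>\<^bsub>H\<^esub> a')"
    and "assoc_inv R H H H (pure R H (tensor R H H) a y) \<otimes>\<^bsub>tensor_algebra R (tensor_algebra R H H) H\<^esub>
        assoc_inv R H H H (pure R H (tensor R H H) a' y') =
      assoc_inv R H H H (pure R H (tensor R H H) (a \<otimes>\<^bsub>H\<^esub> a') (y \<otimes>\<^bsub>tensor_algebra R H H\<^esub> y'))"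
proof -
  note mH = assoc_algebra_module[OF assms(1)] and aHH = tensor_algebra_assoc_algebra[OF assms(1,1)]
  show "pure R (tensor R H H) H y a \<otimes>\<^bsub>tensor_algebra R (tensor_algebra R H H) H\<^esub> pure R (tensor R H H) H y' a' =
      pure R (tensor R H H) H (y \<otimes>\<^bsub>tensor_algebra R H H\<^esub> y') (a \<otimes>\<^bsub>H\<^esub> a')"
    using tensor_algebra_mult_pure[OF aHH assms(1), of y a y' a'] assms(2-) by simp
  show "assoc_inv R H H H (pure R H (tensor R H H) a y) \<otimes>\<^bsub>tensor_algebra R (tensor_algebra R H H) H\<^esub>
        assoc_inv R H H H (pure R H (tensor R H H) a' y') =
      assoc_inv R H H H (pure R H (tensor R H H) (a \<otimes>\<^bsub>H\<^esub> a') (y \<otimes>\<^bsub>tensor_algebra R H H\<^esub> y'))"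
    using algebra_hom_mult[OF tensor_algebra_assoc_hom(1)[OF assms(1,1,1)],
        of "pure R H (tensor R H H) a y" "pure R H (tensor R H H) a' y'"]
      tensor_algebra_mult_pure[OF assms(1) aHH, of a y a' y'] assms(2-)
    by (simp add: pure_closed mH tensor_module)
qed

context weak_bialgebra
begin

abbreviation k where "k \<equiv> regular_module R"
abbreviation tl where "tl \<equiv> tensor_lift R k"
abbreviation HH where "HH \<equiv> tensor_algebra R H H"
abbreviation HHH where "HHH \<equiv> tensor_algebra R HH H"
abbreviation pH where "pH \<equiv> pure R H H"
abbreviation \<delta> where "\<delta> \<equiv> comult H \<one>\<^bsub>H\<^esub>"
abbreviation \<epsilon> where "\<epsilon> \<equiv> counit H"

lemmas mH = module_axioms and aH = assoc_algebra_axioms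
lemmas mHH = tensor_module[OF mH mH]
lemmas mk = regular_module_module[OF is_cring]
lemmas aHH = tensor_algebra_assoc_algebra[OF aH aH]
lemmas aHHH = tensor_algebra_assoc_algebra[OF aHH aH]

text \<open>\<open>l\<close> and \<open>r\<close> are t \<otimes> 1 and 1 \<otimes> t, while
  \<open>\<Delta>l\<close> and \<open>\<Delta>r\<close> are \<Delta> \<otimes> id and id \<otimes>
  \<Delta>. All take values in the left-bracketed cube in which the axioms on \<Delta>(1) are
  stated.\<close>

definition l where "l t = pure R (tensor R H H) H t \<one>\<^bsub>H\<^esub>"
definition r where "r t = assoc_inv R H H H (pure R H (tensor R H H) \<one>\<^bsub>H\<^esub> t)"
definition \<Delta>l where "\<Delta>l = tensor_map R (tensor R H H) H (comult H) id"
definition \<Delta>r where "\<Delta>r s = assoc_inv R H H H (tensor_map R H (tensor R H H) id (comult H) s)"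
text \<open>The functional f \<otimes> g \<otimes> h on the cube, by which identities there are
  turned into identities of Sweedler expressions.\<close>

definition \<Theta> where "\<Theta> f g h = tl (\<lambda>x c. tl (\<lambda>a b. f a \<otimes> g b) x \<otimes> h c)"

lemmas delta_closed [simp] = linear_map_closed[OF comult_linear]
lemmas counit_closed [simp] = linear_map_closed[OF counit_linear, simplified]
lemmas pH_closed [simp] = pure_closed[OF mH mH]
lemmas comult_id_linear = tensor_map_linear[OF mH mH mHH mH comult_linear linear_map_id(1)]
lemmas id_comult_linear = tensor_map_linear[OF mH mH mH mHH linear_map_id(1) comult_linear]

lemmas HHH_mult = tensor_cube_mult(1)[OF aH] and assoc_inv_mult = tensor_cube_mult(2)[OF aH]
lemmas HH_mult = tensor_algebra_mult_pure[OF aH aH]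
lemmas HHH_bil = tensor_algebra_mult_bilinear[OF aHH aH, simplified]
lemmas HH_bil = tensor_algebra_mult_bilinear[OF aH aH]
lemmas HH_mult_closed [simp] = bilinear_closed[OF HH_bil]

section \<open>Multiplication and functionals on the threefold tensor power\<close>

lemma HHH_assoc:
  "\<lbrakk>x \<in> carrier (tensor R (tensor R H H) H); y \<in> carrier (tensor R (tensor R H H) H);
    z \<in> carrier (tensor R (tensor R H H) H)\<rbrakk> \<Longrightarrow> x \<otimes>\<^bsub>HHH\<^esub> y \<otimes>\<^bsub>HHH\<^esub> z = x \<otimes>\<^bsub>HHH\<^esub> (y \<otimes>\<^bsub>HHH\<^esub> z)"
  using monoid.m_assoc[OF ring.axioms(2)[OF assoc_algebra_ring[OF aHHH]]] by simp

lemma l_hom: "algebra_hom R HH HHH l" and r_hom: "algebra_hom R HH HHH r"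
  unfolding l_def[abs_def] r_def[abs_def] by (rule tensor_cube_homs[OF aH])+

lemmas l_linear = algebra_hom_linear[OF l_hom, simplified]
lemmas r_linear = algebra_hom_linear[OF r_hom, simplified]
lemmas l_closed [simp] = linear_map_closed[OF l_linear]
lemmas r_closed [simp] = linear_map_closed[OF r_linear]

lemma r_pure: "\<lbrakk>p \<in> carrier H; q \<in> carrier H\<rbrakk> \<Longrightarrow> r (pH p q) = pure R (tensor R H H) H (pH \<one>\<^bsub>H\<^esub> p) q"
  by (simp add: r_def assoc_inv_pure mH)

lemma \<Delta>l_linear: "linear_map R (tensor R H H) (tensor R (tensor R H H) H) \<Delta>l"
  unfolding \<Delta>l_def by (rule comult_id_linear)

lemma \<Delta>r_linear: "linear_map R (tensor R H H) (tensor R (tensor R H H) H) \<Delta>r"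
  unfolding \<Delta>r_def[abs_def] by (rule linear_map_compose[OF id_comult_linear assoc_inv_linear[OF mH mH mH]])

lemma \<Delta>l_pure: "\<lbrakk>a \<in> carrier H; b \<in> carrier H\<rbrakk> \<Longrightarrow> \<Delta>l (pH a b) = pure R (tensor R H H) H (comult H a) b"
  by (simp add: \<Delta>l_def tensor_map_pure[OF mH mH mHH mH comult_linear linear_map_id(1)])

lemma \<Delta>r_pure: "\<lbrakk>a \<in> carrier H; b \<in> carrier H\<rbrakk> \<Longrightarrow>
    \<Delta>r (pH a b) = assoc_inv R H H H (pure R H (tensor R H H) a (comult H b))"
  by (simp add: \<Delta>r_def tensor_map_pure[OF mH mH mH mHH linear_map_id(1) comult_linear])

lemma l_r: "l \<delta> \<otimes>\<^bsub>HHH\<^esub> r \<delta> = \<Delta>l \<delta>" and r_l: "r \<delta> \<otimes>\<^bsub>HHH\<^esub> l \<delta> = \<Delta>l \<delta>"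
  unfolding l_def r_def \<Delta>l_def by (rule comult_one_left comult_one_right)+

lemma \<Delta>l_comult: "x \<in> carrier H \<Longrightarrow> \<Delta>l (comult H x) = \<Delta>r (comult H x)"
  using coassoc[of x] assoc_inv_assoc[OF mH mH mH, of "\<Delta>l (comult H x)"] linear_map_closed[OF \<Delta>l_linear]
  by (simp add: \<Delta>l_def \<Delta>r_def)

lemma \<Delta>l_mult:
  assumes "h \<in> carrier H" "s \<in> carrier (tensor R H H)"
  shows "\<Delta>l s \<otimes>\<^bsub>HHH\<^esub> l (comult H h) = \<Delta>l (s \<otimes>\<^bsub>HH\<^esub> pH h \<one>\<^bsub>H\<^esub>)"
    and "l (comult H h) \<otimes>\<^bsub>HHH\<^esub> \<Delta>l s = \<Delta>l (pH h \<one>\<^bsub>H\<^esub> \<otimes>\<^bsub>HH\<^esub> s)"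
proof -
  have *: "l (comult H h) \<in> carrier (tensor R (tensor R H H) H)" "pH h \<one>\<^bsub>H\<^esub> \<in> carrier (tensor R H H)"
    using assms(1) by simp_all
  show "\<Delta>l s \<otimes>\<^bsub>HHH\<^esub> l (comult H h) = \<Delta>l (s \<otimes>\<^bsub>HH\<^esub> pH h \<one>\<^bsub>H\<^esub>)"
    by (rule tensor_ext[OF mH mH linear_map_compose[OF \<Delta>l_linear bilinear_left[OF HHH_bil *(1)]]
          linear_map_compose[OF bilinear_left[OF HH_bil *(2)] \<Delta>l_linear] _ assms(2)])
      (simp add: \<Delta>l_pure l_def HHH_mult HH_mult comult_mult assms)
  show "l (comult H h) \<otimes>\<^bsub>HHH\<^esub> \<Delta>l s = \<Delta>l (pH h \<one>\<^bsub>H\<^esub> \<otimes>\<^bsub>HH\<^esub> s)"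
    by (rule tensor_ext[OF mH mH linear_map_compose[OF \<Delta>l_linear bilinear_right[OF HHH_bil *(1)]]
          linear_map_compose[OF bilinear_right[OF HH_bil *(2)] \<Delta>l_linear] _ assms(2)])
      (simp add: \<Delta>l_pure l_def HHH_mult HH_mult comult_mult assms)
qed

lemma \<Delta>r_mult:
  assumes "h \<in> carrier H" "s \<in> carrier (tensor R H H)"
  shows "\<Delta>r s \<otimes>\<^bsub>HHH\<^esub> r (comult H h) = \<Delta>r (s \<otimes>\<^bsub>HH\<^esub> pH \<one>\<^bsub>H\<^esub> h)"
    and "r (comult H h) \<otimes>\<^bsub>HHH\<^esub> \<Delta>r s = \<Delta>r (pH \<one>\<^bsub>H\<^esub> h \<otimes>\<^bsub>HH\<^esub> s)"
proof -
  have *: "r (comult H h) \<in> carrier (tensor R (tensor R H H) H)" "pH \<one>\<^bsub>H\<^esub> h \<in> carrier (tensor R H H)"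
    using assms(1) by simp_all
  show "\<Delta>r s \<otimes>\<^bsub>HHH\<^esub> r (comult H h) = \<Delta>r (s \<otimes>\<^bsub>HH\<^esub> pH \<one>\<^bsub>H\<^esub> h)"
    by (rule tensor_ext[OF mH mH linear_map_compose[OF \<Delta>r_linear bilinear_left[OF HHH_bil *(1)]]
          linear_map_compose[OF bilinear_left[OF HH_bil *(2)] \<Delta>r_linear] _ assms(2)])
      (simp add: \<Delta>r_pure r_def assoc_inv_mult HH_mult comult_mult assms)
  show "r (comult H h) \<otimes>\<^bsub>HHH\<^esub> \<Delta>r s = \<Delta>r (pH \<one>\<^bsub>H\<^esub> h \<otimes>\<^bsub>HH\<^esub> s)"
    by (rule tensor_ext[OF mH mH linear_map_compose[OF \<Delta>r_linear bilinear_right[OF HHH_bil *(1)]]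
          linear_map_compose[OF bilinear_right[OF HH_bil *(2)] \<Delta>r_linear] _ assms(2)])
      (simp add: \<Delta>r_pure r_def assoc_inv_mult HH_mult comult_mult assms)
qed

lemma tl_linear: "bilinear R M N k f \<Longrightarrow> module R M \<Longrightarrow> module R N \<Longrightarrow> linear_map R (tensor R M N) k (tl f)"
  by (rule tensor_lift_linear[OF _ _ mk])

lemma tl_pure: "bilinear R M N k f \<Longrightarrow> module R M \<Longrightarrow> module R N \<Longrightarrow> a \<in> carrier M \<Longrightarrow> b \<in> carrier N \<Longrightarrow>
    tl f (pure R M N a b) = f a b"
  by (rule tensor_lift_pure[OF _ _ mk])

lemmas product_bilinear = functional_product_bilinear[OF is_cring]

context
  fixes f g h :: "'c \<Rightarrow> 'a"
  assumes f: "linear_map R H k f" and g: "linear_map R H k g" and h: "linear_map R H k h"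
begin

lemmas fgh_closed [simp] = linear_map_closed[OF f, simplified] linear_map_closed[OF g, simplified]
  linear_map_closed[OF h, simplified]

lemma \<Theta>_linear: "linear_map R (tensor R (tensor R H H) H) k (\<Theta> f g h)"
  unfolding \<Theta>_def by (intro tl_linear product_bilinear f g h mH mHH)

lemma \<Theta>_pure_left: "\<lbrakk>x \<in> carrier (tensor R H H); c \<in> carrier H\<rbrakk> \<Longrightarrow>
    \<Theta> f g h (pure R (tensor R H H) H x c) = tl (\<lambda>a b. f a \<otimes> g b) x \<otimes> h c"
  unfolding \<Theta>_def by (rule tl_pure) (intro product_bilinear tl_linear f g h mH mHH)+

lemma \<Theta>_pure: "\<lbrakk>a \<in> carrier H; b \<in> carrier H; c \<in> carrier H\<rbrakk> \<Longrightarrow>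
    \<Theta> f g h (pure R (tensor R H H) H (pH a b) c) = f a \<otimes> g b \<otimes> h c"
  by (simp add: \<Theta>_pure_left tl_pure[OF product_bilinear[OF f g] mH mH])

lemma \<Theta>_pure_right:
  assumes "a \<in> carrier H" "y \<in> carrier (tensor R H H)"
  shows "\<Theta> f g h (assoc_inv R H H H (pure R H (tensor R H H) a y)) = f a \<otimes> tl (\<lambda>b c. g b \<otimes> h c) y"
  by (rule tensor_ext[OF mH mH linear_map_compose[OF linear_map_compose[OF pure_right_linear[OF mH mHH assms(1)]
          assoc_inv_linear[OF mH mH mH]] \<Theta>_linear] functional_mult_const(2)[OF is_cring
          tl_linear[OF product_bilinear[OF g h] mH mH]] _ assms(2)])
    (simp_all add: assms(1) assoc_inv_pure mH \<Theta>_pure tl_pure[OF product_bilinear[OF g h] mH mH] m_assoc)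

text \<open>Evaluates f \<otimes> g \<otimes> h on a product of s \<otimes> 1 and 1 \<otimes> t with
  either summation outermost. The parameter \<open>m\<close> is the product or the opposite product
  of the two middle entries, which covers both orders of the factors.\<close>

lemma \<Theta>_expand:
  assumes Z: "bilinear R (tensor R H H) (tensor R H H) (tensor R (tensor R H H) H) Z"
    and m: "bilinear R H H H m"
    and Zm: "\<And>u v p q. \<lbrakk>u \<in> carrier H; v \<in> carrier H; p \<in> carrier H; q \<in> carrier H\<rbrakk> \<Longrightarrow>
      Z (pH u v) (pH p q) = pure R (tensor R H H) H (pH u (m v p)) q"
    and s: "s \<in> carrier (tensor R H H)" and t: "t \<in> carrier (tensor R H H)"
  shows "\<Theta> f g h (Z s t) = tl (\<lambda>u v. f u \<otimes> tl (\<lambda>p q. g (m v p) \<otimes> h q) t) s" (is ?th1)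
    and "\<Theta> f g h (Z s t) = tl (\<lambda>p q. tl (\<lambda>u v. f u \<otimes> g (m v p)) s \<otimes> h q) t" (is ?th2)
proof -
  note mr = linear_map_compose[OF bilinear_right[OF m] g] and ml = linear_map_compose[OF bilinear_left[OF m] g]
  note [simp] = bilinear_closed[OF m]
  have b1: "bilinear R H H k (\<lambda>p q. g (m v p) \<otimes> h q)" if "v \<in> carrier H" for v
    by (rule product_bilinear[OF mr[OF that] h])
  have b2: "bilinear R H H k (\<lambda>u v. f u \<otimes> g (m v p))" if "p \<in> carrier H" for p
    by (rule product_bilinear[OF f ml[OF that]])
  have c1: "linear_map R H k (\<lambda>v. tl (\<lambda>p q. g (m v p) \<otimes> h q) t)"
    if "t \<in> carrier (tensor R H H)" for t
    by (rule tensor_lift_parameter[OF mH mH mH mk b1 _ that])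
      (simp_all add: functional_mult_const(1)[OF is_cring ml])
  have c2: "linear_map R H k (\<lambda>p. tl (\<lambda>u v. f u \<otimes> g (m v p)) s)"
    if "s \<in> carrier (tensor R H H)" for s
    by (rule tensor_lift_parameter[OF mH mH mH mk b2 _ that])
      (simp_all add: functional_mult_const(2)[OF is_cring mr])
  show ?th1
  proof (rule tensor_ext[OF mH mH linear_map_compose[OF bilinear_left[OF Z t] \<Theta>_linear]
        tl_linear[OF product_bilinear[OF f c1[OF t]] mH mH] _ s])
    fix u v assume uv: "u \<in> carrier H" "v \<in> carrier H"
    have "\<Theta> f g h (Z (pH u v) t) = f u \<otimes> tl (\<lambda>p q. g (m v p) \<otimes> h q) t"
      by (rule tensor_ext[OF mH mH linear_map_compose[OF bilinear_right[OF Z] \<Theta>_linear]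
            functional_mult_const(2)[OF is_cring tl_linear[OF b1 mH mH]] _ t])
        (simp_all add: uv Zm \<Theta>_pure tl_pure[OF b1 mH mH] m_assoc)
    then show "\<Theta> f g h (Z (pH u v) t) = tl (\<lambda>u v. f u \<otimes> tl (\<lambda>p q. g (m v p) \<otimes> h q) t) (pH u v)"
      by (simp add: tl_pure[OF product_bilinear[OF f c1[OF t]] mH mH] uv)
  qed
  show ?th2
  proof (rule tensor_ext[OF mH mH linear_map_compose[OF bilinear_right[OF Z s] \<Theta>_linear]
        tl_linear[OF product_bilinear[OF c2[OF s] h] mH mH] _ t])
    fix p q assume pq: "p \<in> carrier H" "q \<in> carrier H"
    have "\<Theta> f g h (Z s (pH p q)) = tl (\<lambda>u v. f u \<otimes> g (m v p)) s \<otimes> h q"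
      by (rule tensor_ext[OF mH mH linear_map_compose[OF bilinear_left[OF Z] \<Theta>_linear]
            functional_mult_const(1)[OF is_cring tl_linear[OF b2 mH mH]] _ s])
        (simp_all add: pq Zm \<Theta>_pure tl_pure[OF b2 mH mH])
    then show "\<Theta> f g h (Z s (pH p q)) = tl (\<lambda>p q. tl (\<lambda>u v. f u \<otimes> g (m v p)) s \<otimes> h q) (pH p q)"
      by (simp add: tl_pure[OF product_bilinear[OF c2[OF s] h] mH mH] pq)
  qed
qed

lemma l_r_bilinear: "bilinear R (tensor R H H) (tensor R H H) (tensor R (tensor R H H) H) (\<lambda>s t. l s \<otimes>\<^bsub>HHH\<^esub> r t)"
  and r_l_bilinear: "bilinear R (tensor R H H) (tensor R H H) (tensor R (tensor R H H) H) (\<lambda>s t. r t \<otimes>\<^bsub>HHH\<^esub> l s)"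
  by (rule bilinear_compose[OF HHH_bil l_linear r_linear]
      bilinear_compose[OF bilinear_flip[OF HHH_bil] l_linear r_linear])+

lemmas \<Theta>_l_r = \<Theta>_expand[OF l_r_bilinear mult_bilinear[OF aH]]
lemmas \<Theta>_r_l = \<Theta>_expand[OF r_l_bilinear bilinear_flip[OF mult_bilinear[OF aH]]]

lemma l_r_pure:
  "\<lbrakk>u \<in> carrier H; v \<in> carrier H; p \<in> carrier H; q \<in> carrier H\<rbrakk> \<Longrightarrow>
    l (pH u v) \<otimes>\<^bsub>HHH\<^esub> r (pH p q) = pure R (tensor R H H) H (pH u (v \<otimes>\<^bsub>H\<^esub> p)) q"
  "\<lbrakk>u \<in> carrier H; v \<in> carrier H; p \<in> carrier H; q \<in> carrier H\<rbrakk> \<Longrightarrow>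
    r (pH p q) \<otimes>\<^bsub>HHH\<^esub> l (pH u v) = pure R (tensor R H H) H (pH u (p \<otimes>\<^bsub>H\<^esub> v)) q"
  by (simp_all add: l_def r_pure HHH_mult HH_mult)

end

lemmas tl_counit_right = tensor_lift_counit(1)[OF coalgebra_axioms]
  and tl_counit_left = tensor_lift_counit(2)[OF coalgebra_axioms]

text \<open>A counit in the middle leg undoes the comultiplication of either neighbour, so
  \<open>\<Delta>l\<close> and \<open>\<Delta>r\<close> give the same value.\<close>

lemma \<Theta>_counit:
  assumes f: "linear_map R H k f" and h: "linear_map R H k h" and s: "s \<in> carrier (tensor R H H)"
  shows "\<Theta> f \<epsilon> h (\<Delta>l s) = tl (\<lambda>u v. f u \<otimes> h v) s" and "\<Theta> f \<epsilon> h (\<Delta>r s) = tl (\<lambda>u v. f u \<otimes> h v) s"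
proof -
  note lin = \<Theta>_linear[OF f counit_linear h]
  note tl = tl_linear[OF product_bilinear[OF f h] mH mH]
  show "\<Theta> f \<epsilon> h (\<Delta>l s) = tl (\<lambda>u v. f u \<otimes> h v) s"
    by (rule tensor_ext[OF mH mH linear_map_compose[OF \<Delta>l_linear lin] tl _ s])
      (use counit_right in \<open>simp add: \<Delta>l_pure \<Theta>_pure_left[OF f counit_linear h] tl_counit_right[OF f]
        tl_pure[OF product_bilinear[OF f h] mH mH]\<close>)
  show "\<Theta> f \<epsilon> h (\<Delta>r s) = tl (\<lambda>u v. f u \<otimes> h v) s"
    by (rule tensor_ext[OF mH mH linear_map_compose[OF \<Delta>r_linear lin] tl _ s])
      (use counit_left in \<open>simp add: \<Delta>r_pure \<Theta>_pure_right[OF f counit_linear h] tl_counit_left[OF h]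
        tl_pure[OF product_bilinear[OF f h] mH mH]\<close>)
qed

lemma tl_mult_pure:
  assumes f: "linear_map R H k f" and g: "linear_map R H k g" and x: "x \<in> carrier H"
    and s: "s \<in> carrier (tensor R H H)"
  shows "tl (\<lambda>u v. f u \<otimes> g v) (s \<otimes>\<^bsub>HH\<^esub> pH \<one>\<^bsub>H\<^esub> x) = tl (\<lambda>u v. f u \<otimes> g (v \<otimes>\<^bsub>H\<^esub> x)) s"
    and "tl (\<lambda>u v. f u \<otimes> g v) (s \<otimes>\<^bsub>HH\<^esub> pH x \<one>\<^bsub>H\<^esub>) = tl (\<lambda>u v. f (u \<otimes>\<^bsub>H\<^esub> x) \<otimes> g v) s"
    and "tl (\<lambda>u v. f u \<otimes> g v) (pH \<one>\<^bsub>H\<^esub> x \<otimes>\<^bsub>HH\<^esub> s) = tl (\<lambda>u v. f u \<otimes> g (x \<otimes>\<^bsub>H\<^esub> v)) s"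
    and "tl (\<lambda>u v. f u \<otimes> g v) (pH x \<one>\<^bsub>H\<^esub> \<otimes>\<^bsub>HH\<^esub> s) = tl (\<lambda>u v. f (x \<otimes>\<^bsub>H\<^esub> u) \<otimes> g v) s"
proof -
  have p: "pH \<one>\<^bsub>H\<^esub> x \<in> carrier (tensor R H H)" "pH x \<one>\<^bsub>H\<^esub> \<in> carrier (tensor R H H)"
    using x by simp_all
  note fl = linear_map_compose[OF mult_left_linear[OF aH x] f] and gl = linear_map_compose[OF mult_left_linear[OF aH x] g]
    and fr = linear_map_compose[OF mult_right_linear[OF aH x] f] and gr = linear_map_compose[OF mult_right_linear[OF aH x] g]
  note tl0 = tl_linear[OF product_bilinear[OF f g] mH mH]
  note L = linear_map_compose[OF bilinear_left[OF HH_bil] tl0] and R = linear_map_compose[OF bilinear_right[OF HH_bil] tl0]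
  note [simp] = tl_pure[OF product_bilinear[OF f g] mH mH] HH_mult x
    tl_pure[OF product_bilinear[OF f gl] mH mH] tl_pure[OF product_bilinear[OF fl g] mH mH]
    tl_pure[OF product_bilinear[OF f gr] mH mH] tl_pure[OF product_bilinear[OF fr g] mH mH]
  show "tl (\<lambda>u v. f u \<otimes> g v) (s \<otimes>\<^bsub>HH\<^esub> pH \<one>\<^bsub>H\<^esub> x) = tl (\<lambda>u v. f u \<otimes> g (v \<otimes>\<^bsub>H\<^esub> x)) s"
    by (rule tensor_ext[OF mH mH L[OF p(1)] tl_linear[OF product_bilinear[OF f gl] mH mH] _ s]) simp
  show "tl (\<lambda>u v. f u \<otimes> g v) (s \<otimes>\<^bsub>HH\<^esub> pH x \<one>\<^bsub>H\<^esub>) = tl (\<lambda>u v. f (u \<otimes>\<^bsub>H\<^esub> x) \<otimes> g v) s"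
    by (rule tensor_ext[OF mH mH L[OF p(2)] tl_linear[OF product_bilinear[OF fl g] mH mH] _ s]) simp
  show "tl (\<lambda>u v. f u \<otimes> g v) (pH \<one>\<^bsub>H\<^esub> x \<otimes>\<^bsub>HH\<^esub> s) = tl (\<lambda>u v. f u \<otimes> g (x \<otimes>\<^bsub>H\<^esub> v)) s"
    by (rule tensor_ext[OF mH mH R[OF p(1)] tl_linear[OF product_bilinear[OF f gr] mH mH] _ s]) simp
  show "tl (\<lambda>u v. f u \<otimes> g v) (pH x \<one>\<^bsub>H\<^esub> \<otimes>\<^bsub>HH\<^esub> s) = tl (\<lambda>u v. f (x \<otimes>\<^bsub>H\<^esub> u) \<otimes> g v) s"
    by (rule tensor_ext[OF mH mH R[OF p(2)] tl_linear[OF product_bilinear[OF fr g] mH mH] _ s]) simp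
qed

lemma delta_comult:
  assumes "x \<in> carrier H"
  shows "\<delta> \<otimes>\<^bsub>HH\<^esub> comult H x = comult H x" "comult H x \<otimes>\<^bsub>HH\<^esub> \<delta> = comult H x"
  using comult_mult[of "\<one>\<^bsub>H\<^esub>" x] comult_mult[of x "\<one>\<^bsub>H\<^esub>"] assms by simp_all

text \<open>\<Delta>(x) is expanded to \<Delta>(1)\<Delta>(x) or \<Delta>(x)\<Delta>(1). The extra 1
  \<otimes> \<Delta>(1) combines with \<Delta>(1) \<otimes> 1 to the iterated comultiplication of 1,
  taken by coassociativity as (id \<otimes> \<Delta>)\<Delta>(1), and \<Delta> is multiplicative on
  the last two legs.\<close>

lemma factor_right:
  assumes x: "x \<in> carrier H"
  shows "l \<delta> \<otimes>\<^bsub>HHH\<^esub> r (comult H x) = \<Delta>r (\<delta> \<otimes>\<^bsub>HH\<^esub> pH \<one>\<^bsub>H\<^esub> x)"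
    and "r (comult H x) \<otimes>\<^bsub>HHH\<^esub> l \<delta> = \<Delta>r (pH \<one>\<^bsub>H\<^esub> x \<otimes>\<^bsub>HH\<^esub> \<delta>)"
proof -
  have "l \<delta> \<otimes>\<^bsub>HHH\<^esub> r (\<delta> \<otimes>\<^bsub>HH\<^esub> comult H x) = \<Delta>r \<delta> \<otimes>\<^bsub>HHH\<^esub> r (comult H x)"
    using x by (simp add: algebra_hom_mult[OF r_hom] l_r \<Delta>l_comult flip: HHH_assoc)
  then show "l \<delta> \<otimes>\<^bsub>HHH\<^esub> r (comult H x) = \<Delta>r (\<delta> \<otimes>\<^bsub>HH\<^esub> pH \<one>\<^bsub>H\<^esub> x)"
    using x by (simp add: delta_comult \<Delta>r_mult)
  have "r (comult H x \<otimes>\<^bsub>HH\<^esub> \<delta>) \<otimes>\<^bsub>HHH\<^esub> l \<delta> = r (comult H x) \<otimes>\<^bsub>HHH\<^esub> \<Delta>r \<delta>"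
    using x by (simp add: algebra_hom_mult[OF r_hom] r_l \<Delta>l_comult HHH_assoc)
  then show "r (comult H x) \<otimes>\<^bsub>HHH\<^esub> l \<delta> = \<Delta>r (pH \<one>\<^bsub>H\<^esub> x \<otimes>\<^bsub>HH\<^esub> \<delta>)"
    using x by (simp add: delta_comult \<Delta>r_mult)
qed

text \<open>Now \<Delta>(x) occupies the first two legs, where (\<Delta> \<otimes> id)\<Delta>(1)
  can be used as it stands.\<close>

lemma factor_left:
  assumes x: "x \<in> carrier H"
  shows "r \<delta> \<otimes>\<^bsub>HHH\<^esub> l (comult H x) = \<Delta>l (\<delta> \<otimes>\<^bsub>HH\<^esub> pH x \<one>\<^bsub>H\<^esub>)"
    and "l (comult H x) \<otimes>\<^bsub>HHH\<^esub> r \<delta> = \<Delta>l (pH x \<one>\<^bsub>H\<^esub> \<otimes>\<^bsub>HH\<^esub> \<delta>)"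
proof -
  have "r \<delta> \<otimes>\<^bsub>HHH\<^esub> l (\<delta> \<otimes>\<^bsub>HH\<^esub> comult H x) = \<Delta>l \<delta> \<otimes>\<^bsub>HHH\<^esub> l (comult H x)"
    using x by (simp add: algebra_hom_mult[OF l_hom] r_l flip: HHH_assoc)
  then show "r \<delta> \<otimes>\<^bsub>HHH\<^esub> l (comult H x) = \<Delta>l (\<delta> \<otimes>\<^bsub>HH\<^esub> pH x \<one>\<^bsub>H\<^esub>)"
    using x by (simp add: delta_comult \<Delta>l_mult)
  have "l (comult H x \<otimes>\<^bsub>HH\<^esub> \<delta>) \<otimes>\<^bsub>HHH\<^esub> r \<delta> = l (comult H x) \<otimes>\<^bsub>HHH\<^esub> \<Delta>l \<delta>"
    using x by (simp add: algebra_hom_mult[OF l_hom] l_r HHH_assoc)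
  then show "l (comult H x) \<otimes>\<^bsub>HHH\<^esub> r \<delta> = \<Delta>l (pH x \<one>\<^bsub>H\<^esub> \<otimes>\<^bsub>HH\<^esub> \<delta>)"
    using x by (simp add: delta_comult \<Delta>l_mult)
qed

text \<open>Absorption rests on the identities
  \<open>1\<^sub>1 \<otimes> \<epsilon>(1\<^sub>2 x\<^sub>1) x\<^sub>2 = 1\<^sub>1 \<otimes> 1\<^sub>2 x\<close>, \<open>x\<^sub>1 \<epsilon>(1\<^sub>1 x\<^sub>2) \<otimes> 1\<^sub>2 = 1\<^sub>1 x \<otimes> 1\<^sub>2\<close> and their mirror images, which
  come from multiplying the two factorisations of \<open>(\<Delta> \<otimes> H)\<Delta>(1)\<close> by \<open>1 \<otimes> \<Delta>(x)\<close> or \<open>\<Delta>(x) \<otimes> 1\<close>.\<close>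

lemma absorb_right:
  assumes g: "linear_map R H k g" and f: "linear_map R H k f" and x: "x \<in> carrier H"
    and eq: "\<And>y. y \<in> carrier H \<Longrightarrow> g y = tl (\<lambda>u v. g u \<otimes> \<epsilon> (v \<otimes>\<^bsub>H\<^esub> y)) \<delta>"
  shows "tl (\<lambda>u v. g u \<otimes> f v) (comult H x) = tl (\<lambda>u v. g u \<otimes> f (v \<otimes>\<^bsub>H\<^esub> x)) \<delta>"
proof -
  have "tl (\<lambda>u v. g u \<otimes> f v) (comult H x) =
      tl (\<lambda>p q. tl (\<lambda>u v. g u \<otimes> \<epsilon> (v \<otimes>\<^bsub>H\<^esub> p)) \<delta> \<otimes> f q) (comult H x)"
    by (rule tensor_lift_cong[OF mH mH mk product_bilinear[OF g f]]) (simp_all add: eq[symmetric] x)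
  also have "\<dots> = \<Theta> g \<epsilon> f (l \<delta> \<otimes>\<^bsub>HHH\<^esub> r (comult H x))"
    by (rule \<Theta>_l_r(2)[OF g counit_linear f, symmetric]) (simp_all add: l_r_pure[OF g counit_linear f] x)
  finally show ?thesis
    by (simp add: x factor_right \<Theta>_counit[OF g f] tl_mult_pure[OF g f])
qed

text \<open>Here \<open>g\<close> reads the second leg. The reversed product of 1 \<otimes>
  \<Delta>(1) and \<Delta>(x) \<otimes> 1 places the new factor to the left of the second leg of
  \<Delta>(x), as the law for \<open>g\<close> demands.\<close>

lemma absorb_right':
  assumes g: "linear_map R H k g" and f: "linear_map R H k f" and x: "x \<in> carrier H"
    and eq: "\<And>y. y \<in> carrier H \<Longrightarrow> g y = tl (\<lambda>u v. \<epsilon> (u \<otimes>\<^bsub>H\<^esub> y) \<otimes> g v) \<delta>"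
  shows "tl (\<lambda>u v. f u \<otimes> g v) (comult H x) = tl (\<lambda>u v. f (u \<otimes>\<^bsub>H\<^esub> x) \<otimes> g v) \<delta>"
proof -
  have "tl (\<lambda>u v. f u \<otimes> g v) (comult H x) =
      tl (\<lambda>u v. f u \<otimes> tl (\<lambda>p q. \<epsilon> (p \<otimes>\<^bsub>H\<^esub> v) \<otimes> g q) \<delta>) (comult H x)"
    by (rule tensor_lift_cong[OF mH mH mk product_bilinear[OF f g]]) (simp_all add: eq[symmetric] x)
  also have "\<dots> = \<Theta> f \<epsilon> g (r \<delta> \<otimes>\<^bsub>HHH\<^esub> l (comult H x))"
    by (rule \<Theta>_r_l(1)[OF f counit_linear g, symmetric]) (simp_all add: l_r_pure[OF g counit_linear f] x)
  finally show ?thesis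
    by (simp add: x factor_left \<Theta>_counit[OF f g] tl_mult_pure[OF f g])
qed

lemma absorb_left:
  assumes g: "linear_map R H k g" and f: "linear_map R H k f" and x: "x \<in> carrier H"
    and eq: "\<And>y. y \<in> carrier H \<Longrightarrow> g y = tl (\<lambda>u v. \<epsilon> (y \<otimes>\<^bsub>H\<^esub> u) \<otimes> g v) \<delta>"
  shows "tl (\<lambda>u v. f u \<otimes> g v) (comult H x) = tl (\<lambda>u v. f (x \<otimes>\<^bsub>H\<^esub> u) \<otimes> g v) \<delta>"
proof -
  have "tl (\<lambda>u v. f u \<otimes> g v) (comult H x) =
      tl (\<lambda>u v. f u \<otimes> tl (\<lambda>p q. \<epsilon> (v \<otimes>\<^bsub>H\<^esub> p) \<otimes> g q) \<delta>) (comult H x)"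
    by (rule tensor_lift_cong[OF mH mH mk product_bilinear[OF f g]]) (simp_all add: eq[symmetric] x)
  also have "\<dots> = \<Theta> f \<epsilon> g (l (comult H x) \<otimes>\<^bsub>HHH\<^esub> r \<delta>)"
    by (rule \<Theta>_l_r(1)[OF f counit_linear g, symmetric]) (simp_all add: l_r_pure[OF g counit_linear f] x)
  finally show ?thesis
    by (simp add: x factor_left \<Theta>_counit[OF f g] tl_mult_pure[OF f g])
qed

lemma absorb_left':
  assumes g: "linear_map R H k g" and f: "linear_map R H k f" and x: "x \<in> carrier H"
    and eq: "\<And>y. y \<in> carrier H \<Longrightarrow> g y = tl (\<lambda>u v. g u \<otimes> \<epsilon> (y \<otimes>\<^bsub>H\<^esub> v)) \<delta>"
  shows "tl (\<lambda>u v. g u \<otimes> f v) (comult H x) = tl (\<lambda>u v. g u \<otimes> f (x \<otimes>\<^bsub>H\<^esub> v)) \<delta>"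
proof -
  have "tl (\<lambda>u v. g u \<otimes> f v) (comult H x) =
      tl (\<lambda>p q. tl (\<lambda>u v. g u \<otimes> \<epsilon> (p \<otimes>\<^bsub>H\<^esub> v)) \<delta> \<otimes> f q) (comult H x)"
    by (rule tensor_lift_cong[OF mH mH mk product_bilinear[OF g f]]) (simp_all add: eq[symmetric] x)
  also have "\<dots> = \<Theta> g \<epsilon> f (r (comult H x) \<otimes>\<^bsub>HHH\<^esub> l \<delta>)"
    by (rule \<Theta>_r_l(2)[OF g counit_linear f, symmetric]) (simp_all add: l_r_pure[OF g counit_linear f] x)
  finally show ?thesis
    by (simp add: x factor_right \<Theta>_counit[OF g f] tl_mult_pure[OF g f])
qed

section \<open>Functionals inheriting the counit axioms\<close>

lemma tl_scale:
  assumes "bilinear R M N k F" "module R M" "module R N" "c \<in> carrier R" "t \<in> carrier (tensor R M N)"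
  shows "tl (\<lambda>u v. c \<otimes> F u v) t = c \<otimes> tl F t"
proof -
  have "linear_map R k k (\<lambda>x. c \<otimes> x)"
    using functional_mult_const(2)[OF is_cring linear_map_id(2)] assms(4) .
  note b = bilinear_postcompose[OF assms(1) this]
  show ?thesis
    by (rule tensor_ext[OF assms(2,3) tl_linear[OF b assms(2,3)]
          functional_mult_const(2)[OF is_cring tl_linear[OF assms(1-3)]] _ assms(5)])
      (simp_all add: assms(4) tl_pure[OF b assms(2,3)] tl_pure[OF assms(1-3)])
qed

lemma counit_mult_linear:
  assumes "a \<in> carrier H"
  shows "linear_map R H k (\<lambda>u. \<epsilon> (a \<otimes>\<^bsub>H\<^esub> u))" "linear_map R H k (\<lambda>u. \<epsilon> (u \<otimes>\<^bsub>H\<^esub> a))"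
  by (rule linear_map_compose[OF mult_right_linear[OF aH assms] counit_linear]
      linear_map_compose[OF mult_left_linear[OF aH assms] counit_linear])+

lemma tl_twist:
  assumes f: "linear_map R H k f" and g: "linear_map R H k g" and t: "t \<in> carrier (tensor R H H)"
  shows "tl (\<lambda>u v. f u \<otimes> g v) (twist R H H t) = tl (\<lambda>u v. g u \<otimes> f v) t"
  using linear_map_closed[OF f, simplified] linear_map_closed[OF g, simplified]
  by (intro tensor_ext[OF mH mH linear_map_compose[OF twist_linear[OF mH mH] tl_linear[OF product_bilinear[OF f g] mH mH]]
        tl_linear[OF product_bilinear[OF g f] mH mH] _ t])
    (simp add: twist_pure mH tl_pure[OF product_bilinear[OF f g] mH mH] tl_pure[OF product_bilinear[OF g f] mH mH] m_comm)

text \<open>The law at \<open>y\<close> is linear in the functional, so it passes from the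
  functionals \<open>p a\<close> to combinations of them with coefficients e(m). In the applications
  such a combination is a tensor product counit evaluated after its argument has acted on one
  leg.\<close>

lemma functional_law_extend:
  assumes mM: "module R M" and e: "linear_map R M k e" and p: "bilinear R H H k p" and q: "linear_map R H k q"
    and t: "t \<in> carrier (tensor R H H)" and y: "y \<in> carrier H" and x: "x \<in> carrier (tensor R M H)"
    and base: "\<And>a. a \<in> carrier H \<Longrightarrow> p a y = tl (\<lambda>u v. p a u \<otimes> q v) t"
    and f: "\<And>c. c \<in> carrier H \<Longrightarrow> f c = tl (\<lambda>m a. e m \<otimes> p a c) x"
  shows "linear_map R H k f" and "f y = tl (\<lambda>u v. f u \<otimes> q v) t"
proof -
  let ?g = "\<lambda>x c. tl (\<lambda>m a. e m \<otimes> p a c) x"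
  note [simp] = linear_map_closed[OF e, simplified] linear_map_closed[OF q, simplified]
    bilinear_closed[OF p, simplified]
  have ep: "bilinear R M H k (\<lambda>m a. e m \<otimes> p a c)" if "c \<in> carrier H" for c
    by (rule product_bilinear[OF e bilinear_left[OF p that]])
  have gc: "linear_map R H k (?g x)" if "x \<in> carrier (tensor R M H)" for x
    by (rule tensor_lift_parameter[OF mM mH mH mk ep _ that])
      (simp_all add: functional_mult_const(2)[OF is_cring bilinear_right[OF p]])
  note gx = tl_linear[OF ep mM mH]
  show "linear_map R H k f"
    by (rule linear_map_cong[OF gc[OF x] mH]) (simp add: f)
  have "?g x y = tl (\<lambda>u v. ?g x u \<otimes> q v) t"
  proof (rule tensor_ext[OF mM mH gx[OF y] tensor_lift_parameter[OF mH mH tensor_module[OF mM mH] mk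
          product_bilinear[OF gc q] functional_mult_const(1)[OF is_cring gx] t] _ x])
    fix m a assume ma: "m \<in> carrier M" "a \<in> carrier H"
    then have "tl (\<lambda>u v. ?g (pure R M H m a) u \<otimes> q v) t = tl (\<lambda>u v. e m \<otimes> (p a u \<otimes> q v)) t"
      by (intro tensor_lift_cong[OF mH mH mk product_bilinear[OF gc[OF pure_closed[OF mM mH]] q] _ t])
        (simp_all add: tl_pure[OF ep mM mH] m_assoc)
    then show "?g (pure R M H m a) y = tl (\<lambda>u v. ?g (pure R M H m a) u \<otimes> q v) t"
      using ma y tl_scale[OF product_bilinear[OF bilinear_right[OF p ma(2)] q] mH mH _ t]
      by (simp add: tl_pure[OF ep mM mH] base)
  qed simp_all
  then show "f y = tl (\<lambda>u v. f u \<otimes> q v) t"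
    using tensor_lift_cong[OF mH mH mk product_bilinear[OF gc[OF x] q], of "\<lambda>u v. f u \<otimes> q v"] t y
    by (simp add: f)
qed

text \<open>The two counit axioms with middle argument 1.\<close>

lemma counit_delta:
  assumes "a \<in> carrier H" "y \<in> carrier H"
  shows "tl (\<lambda>u v. \<epsilon> (a \<otimes>\<^bsub>H\<^esub> u) \<otimes> \<epsilon> (v \<otimes>\<^bsub>H\<^esub> y)) \<delta> = \<epsilon> (a \<otimes>\<^bsub>H\<^esub> y)"
    and "tl (\<lambda>u v. \<epsilon> (u \<otimes>\<^bsub>H\<^esub> y) \<otimes> \<epsilon> (a \<otimes>\<^bsub>H\<^esub> v)) \<delta> = \<epsilon> (a \<otimes>\<^bsub>H\<^esub> y)"
proof -
  show "tl (\<lambda>u v. \<epsilon> (a \<otimes>\<^bsub>H\<^esub> u) \<otimes> \<epsilon> (v \<otimes>\<^bsub>H\<^esub> y)) \<delta> = \<epsilon> (a \<otimes>\<^bsub>H\<^esub> y)"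
    using counit_mult_12[OF assms(1) _ assms(2), of "\<one>\<^bsub>H\<^esub>"] assms by simp
  have "tl (\<lambda>u v. \<epsilon> (u \<otimes>\<^bsub>H\<^esub> y) \<otimes> \<epsilon> (a \<otimes>\<^bsub>H\<^esub> v)) \<delta> = tl (\<lambda>u v. \<epsilon> (a \<otimes>\<^bsub>H\<^esub> v) \<otimes> \<epsilon> (u \<otimes>\<^bsub>H\<^esub> y)) \<delta>"
    by (rule tensor_lift_cong[OF mH mH mk product_bilinear[OF counit_mult_linear(2) counit_mult_linear(1)]])
      (simp_all add: assms m_comm)
  then show "tl (\<lambda>u v. \<epsilon> (u \<otimes>\<^bsub>H\<^esub> y) \<otimes> \<epsilon> (a \<otimes>\<^bsub>H\<^esub> v)) \<delta> = \<epsilon> (a \<otimes>\<^bsub>H\<^esub> y)"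
    using counit_mult_21[OF assms(1) _ assms(2), of "\<one>\<^bsub>H\<^esub>"] assms by simp
qed

lemma counit_mult_bilinear: "bilinear R H H k (\<lambda>u v. \<epsilon> (u \<otimes>\<^bsub>H\<^esub> v))"
  by (rule bilinear_postcompose[OF mult_bilinear[OF aH] counit_linear])

lemma twist_delta: "twist R H H \<delta> \<in> carrier (tensor R H H)"
  by (simp add: linear_map_closed[OF twist_linear[OF mH mH]])

text \<open>\<open>f\<close> is a combination of the functionals \<epsilon>(a -), for which
  \<open>counit_delta\<close> supplies the laws.\<close>

lemma counit_right_laws:
  assumes M: "coalgebra R M" and x: "x \<in> carrier (tensor R M H)"
    and f: "\<And>c. c \<in> carrier H \<Longrightarrow> f c = tensor_counit R M H (tensor_map R M H id (\<lambda>y. y \<otimes>\<^bsub>H\<^esub> c) x)"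
    and y: "y \<in> carrier H"
  shows "f y = tl (\<lambda>u v. f u \<otimes> \<epsilon> (v \<otimes>\<^bsub>H\<^esub> y)) \<delta>" "f y = tl (\<lambda>u v. \<epsilon> (u \<otimes>\<^bsub>H\<^esub> y) \<otimes> f v) \<delta>"
proof -
  interpret M: coalgebra R M by fact
  note mM = M.module_axioms and act = mult_left_linear[OF aH] and q = counit_mult_linear(2)
  have f': "f c = tl (\<lambda>m a. counit M m \<otimes> \<epsilon> (a \<otimes>\<^bsub>H\<^esub> c)) x" if c: "c \<in> carrier H" for c
    unfolding f[OF c]
    by (rule tensor_ext[OF mM mH linear_map_compose[OF tensor_map_linear[OF mM mH mM mH linear_map_id(1) act[OF c]]
          tensor_counit_linear[OF M coalgebra_axioms]] tl_linear[OF product_bilinear[OF M.counit_linear q[OF c]] mM mH] _ x])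
      (simp add: c tensor_map_pure[OF mM mH mM mH linear_map_id(1) act] tensor_counit_pure[OF M coalgebra_axioms]
        tl_pure[OF product_bilinear[OF M.counit_linear q] mM mH])
  note law = functional_law_extend[OF mM M.counit_linear counit_mult_bilinear q[OF y] _ y x _ f']
  have d: "\<delta> \<in> carrier (tensor R H H)" by simp
  show "f y = tl (\<lambda>u v. f u \<otimes> \<epsilon> (v \<otimes>\<^bsub>H\<^esub> y)) \<delta>"
    by (rule law(2)) (simp_all add: counit_delta y)
  have lin: "linear_map R H k f"
    by (rule law(1)[OF d]) (simp_all add: counit_delta y)
  \<comment> \<open>The second law is the first one for the flipped \<Delta>(1); the flip makes its
    base case the other counit axiom.\<close>
  have "f y = tl (\<lambda>u v. f u \<otimes> \<epsilon> (v \<otimes>\<^bsub>H\<^esub> y)) (twist R H H \<delta>)"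
    by (rule law(2)) (simp_all add: tl_twist[OF counit_mult_linear(1) q d] counit_delta y twist_delta)
  then show "f y = tl (\<lambda>u v. \<epsilon> (u \<otimes>\<^bsub>H\<^esub> y) \<otimes> f v) \<delta>"
    by (simp add: tl_twist[OF lin q d] y)
qed

lemma counit_left_laws:
  assumes M: "coalgebra R M" and x: "x \<in> carrier (tensor R H M)"
    and f: "\<And>c. c \<in> carrier H \<Longrightarrow> f c = tensor_counit R H M (tensor_map R H M (\<lambda>y. c \<otimes>\<^bsub>H\<^esub> y) id x)"
    and y: "y \<in> carrier H"
  shows "f y = tl (\<lambda>u v. \<epsilon> (y \<otimes>\<^bsub>H\<^esub> u) \<otimes> f v) \<delta>" "f y = tl (\<lambda>u v. f u \<otimes> \<epsilon> (y \<otimes>\<^bsub>H\<^esub> v)) \<delta>"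
proof -
  interpret M: coalgebra R M by fact
  note mM = M.module_axioms and act = mult_right_linear[OF aH] and q = counit_mult_linear(1)
  note [simp] = linear_map_closed[OF M.counit_linear, simplified]
  \<comment> \<open>Flipping \<open>x\<close> brings the leg in \<open>M\<close> to the front, as
    \<open>functional_law_extend\<close> expects. The functionals involved are now \<epsilon>(- a),
    hence the flipped bilinear form below.\<close>
  have f': "f c = tl (\<lambda>m a. counit M m \<otimes> \<epsilon> (c \<otimes>\<^bsub>H\<^esub> a)) (twist R H M x)" if c: "c \<in> carrier H" for c
    unfolding f[OF c]
    by (rule tensor_ext[OF mH mM linear_map_compose[OF tensor_map_linear[OF mH mM mH mM act[OF c] linear_map_id(1)]
          tensor_counit_linear[OF coalgebra_axioms M]] linear_map_compose[OF twist_linear[OF mH mM]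
          tl_linear[OF product_bilinear[OF M.counit_linear q[OF c]] mM mH]] _ x])
      (simp add: c tensor_map_pure[OF mH mM mH mM act linear_map_id(1)] tensor_counit_pure[OF coalgebra_axioms M]
        twist_pure mH mM tl_pure[OF product_bilinear[OF M.counit_linear q] mM mH] m_comm)
  note law = functional_law_extend[OF mM M.counit_linear bilinear_flip[OF counit_mult_bilinear] q[OF y] _ y
      linear_map_closed[OF twist_linear[OF mH mM] x] _ f']
  have d: "\<delta> \<in> carrier (tensor R H H)" by simp
  show "f y = tl (\<lambda>u v. f u \<otimes> \<epsilon> (y \<otimes>\<^bsub>H\<^esub> v)) \<delta>"
    by (rule law(2)) (simp_all add: counit_delta y)
  have lin: "linear_map R H k f"
    by (rule law(1)[OF d]) (simp_all add: counit_delta y)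
  have "f y = tl (\<lambda>u v. f u \<otimes> \<epsilon> (y \<otimes>\<^bsub>H\<^esub> v)) (twist R H H \<delta>)"
    by (rule law(2)) (simp_all add: tl_twist[OF counit_mult_linear(2) q d] counit_delta y twist_delta)
  then show "f y = tl (\<lambda>u v. \<epsilon> (y \<otimes>\<^bsub>H\<^esub> u) \<otimes> f v) \<delta>"
    by (simp add: tl_twist[OF lin q d] y)
qed

end

section \<open>Multiplicativity of the counit\<close>

text \<open>For \<open>S = s\<^sub>1 \<otimes> s\<^sub>2\<close> the pairings are \<open>e(x s\<^sub>1) e(s\<^sub>2 z)\<close> and \<open>e(x s\<^sub>2) e(s\<^sub>1 z)\<close>.\<close>

definition pairing where
  "pairing R H e x z S = tensor_lift R (regular_module R) (\<lambda>u v. e u \<otimes>\<^bsub>R\<^esub> e v)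
    (pure R H H x \<one>\<^bsub>H\<^esub> \<otimes>\<^bsub>tensor_algebra R H H\<^esub> S \<otimes>\<^bsub>tensor_algebra R H H\<^esub> pure R H H \<one>\<^bsub>H\<^esub> z)"

definition twisted_pairing where
  "twisted_pairing R H e x z S = tensor_lift R (regular_module R) (\<lambda>u v. e u \<otimes>\<^bsub>R\<^esub> e v)
    (pure R H H \<one>\<^bsub>H\<^esub> x \<otimes>\<^bsub>tensor_algebra R H H\<^esub> S \<otimes>\<^bsub>tensor_algebra R H H\<^esub> pure R H H z \<one>\<^bsub>H\<^esub>)"

text \<open>Treats the maps from \<open>A\<close> and from \<open>B\<close> into the wreath product
  alike. The last four assumptions are the laws demanded by the four absorption lemmas, for the
  functionals e(w i(-)) and e(i(-) w); each of the four pairing lemmas consumes one.\<close>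

locale counit_hom = K: weak_bialgebra R K + H: assoc_algebra R H
  for R :: "('r, 'q) ring_scheme" (structure) and K :: "('r, 'a, 'm) bialgebra_data_scheme"
    and H :: "('r, 'h, 'n) module_scheme" +
  fixes i :: "'a \<Rightarrow> 'h" and e :: "'h \<Rightarrow> 'r"
  assumes hom: "algebra_hom R K H i" and functional: "linear_map R H (regular_module R) e"
    and right: "\<lbrakk>w \<in> carrier H; y \<in> carrier K\<rbrakk> \<Longrightarrow> e (w \<otimes>\<^bsub>H\<^esub> i y) = tensor_lift R (regular_module R)
      (\<lambda>u v. e (w \<otimes>\<^bsub>H\<^esub> i u) \<otimes> counit K (v \<otimes>\<^bsub>K\<^esub> y)) (comult K \<one>\<^bsub>K\<^esub>)"
    and right': "\<lbrakk>w \<in> carrier H; y \<in> carrier K\<rbrakk> \<Longrightarrow> e (w \<otimes>\<^bsub>H\<^esub> i y) = tensor_lift R (regular_module R)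
      (\<lambda>u v. counit K (u \<otimes>\<^bsub>K\<^esub> y) \<otimes> e (w \<otimes>\<^bsub>H\<^esub> i v)) (comult K \<one>\<^bsub>K\<^esub>)"
    and left: "\<lbrakk>w \<in> carrier H; y \<in> carrier K\<rbrakk> \<Longrightarrow> e (i y \<otimes>\<^bsub>H\<^esub> w) = tensor_lift R (regular_module R)
      (\<lambda>u v. counit K (y \<otimes>\<^bsub>K\<^esub> u) \<otimes> e (i v \<otimes>\<^bsub>H\<^esub> w)) (comult K \<one>\<^bsub>K\<^esub>)"
    and left': "\<lbrakk>w \<in> carrier H; y \<in> carrier K\<rbrakk> \<Longrightarrow> e (i y \<otimes>\<^bsub>H\<^esub> w) = tensor_lift R (regular_module R)
      (\<lambda>u v. e (i u \<otimes>\<^bsub>H\<^esub> w) \<otimes> counit K (y \<otimes>\<^bsub>K\<^esub> v)) (comult K \<one>\<^bsub>K\<^esub>)"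
begin

abbreviation HH where "HH \<equiv> tensor_algebra R H H"
abbreviation pH where "pH \<equiv> pure R H H"
abbreviation I where "I \<equiv> tensor_map R H H i i"
abbreviation E where "E \<equiv> tensor_lift R (regular_module R) (\<lambda>u v. e u \<otimes> e v)"
abbreviation T where "T \<equiv> pairing R H e"
abbreviation T' where "T' \<equiv> twisted_pairing R H e"

lemmas mH = H.module_axioms and mK = K.mH and aH = H.assoc_algebra_axioms
lemmas mHH = tensor_module[OF mH mH] and aHH = tensor_algebra_assoc_algebra[OF aH aH]
lemmas bil = tensor_algebra_mult_bilinear[OF aH aH]
lemmas HH_assoc = monoid.m_assoc[OF ring.axioms(2)[OF assoc_algebra_ring[OF aHH]], simplified]
lemmas i_linear = algebra_hom_linear[OF hom]

lemma I_linear: "linear_map R (tensor R K K) (tensor R H H) I"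
  by (rule tensor_map_linear[OF mK mK mH mH i_linear i_linear])

lemma E_linear: "linear_map R (tensor R H H) (regular_module R) E"
  by (rule K.tl_linear[OF K.product_bilinear[OF functional functional] mH mH])

lemmas closed [simp] = algebra_hom_closed[OF hom] linear_map_closed[OF I_linear] pure_closed[OF mH mH]
    linear_map_closed[OF functional, simplified] bilinear_closed[OF bil]

lemma e_right: "w \<in> carrier H \<Longrightarrow> linear_map R K (regular_module R) (\<lambda>c. e (w \<otimes>\<^bsub>H\<^esub> i c))"
  and e_left: "w \<in> carrier H \<Longrightarrow> linear_map R K (regular_module R) (\<lambda>c. e (i c \<otimes>\<^bsub>H\<^esub> w))"
  and e_both: "\<lbrakk>w \<in> carrier H; w' \<in> carrier H\<rbrakk> \<Longrightarrow>
    linear_map R K (regular_module R) (\<lambda>c. e (w \<otimes>\<^bsub>H\<^esub> i c \<otimes>\<^bsub>H\<^esub> w'))"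
  by (intro linear_map_compose[OF linear_map_compose[OF i_linear mult_right_linear[OF aH]] functional]
      linear_map_compose[OF linear_map_compose[OF i_linear mult_left_linear[OF aH]] functional]
      linear_map_compose[OF linear_map_compose[OF linear_map_compose[OF i_linear mult_right_linear[OF aH]]
        mult_left_linear[OF aH]] functional]; assumption)+

text \<open>Turns a product in H \<otimes> H sandwiching an image from K \<otimes> K into a
  functional of \<open>t\<close> alone, the form in which absorption is formulated.\<close>

lemma expand:
  assumes "a \<in> carrier H" "b \<in> carrier H" "c \<in> carrier H" "d \<in> carrier H" "t \<in> carrier (tensor R K K)"
  shows "E (pH a b \<otimes>\<^bsub>HH\<^esub> I t \<otimes>\<^bsub>HH\<^esub> pH c d) =
      K.tl (\<lambda>u v. e (a \<otimes>\<^bsub>H\<^esub> i u \<otimes>\<^bsub>H\<^esub> c) \<otimes> e (b \<otimes>\<^bsub>H\<^esub> i v \<otimes>\<^bsub>H\<^esub> d)) t"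
    by (rule tensor_ext[OF mK mK linear_map_compose[OF linear_map_compose[OF linear_map_compose[OF I_linear bilinear_right[OF bil]]
            bilinear_left[OF bil]] E_linear] K.tl_linear[OF K.product_bilinear[OF e_both e_both] mK mK] _ assms(5)])
      (simp_all add: assms tensor_map_pure[OF mK mK mH mH i_linear i_linear] tensor_algebra_mult_pure[OF aH aH]
        K.tl_pure[OF K.product_bilinear[OF functional functional] mH mH]
        K.tl_pure[OF K.product_bilinear[OF e_both e_both] mK mK])

lemma expand_one:
  assumes "a \<in> carrier H" "b \<in> carrier H" "c \<in> carrier H" "t \<in> carrier (tensor R K K)"
  shows "E (pH a b \<otimes>\<^bsub>HH\<^esub> I t \<otimes>\<^bsub>HH\<^esub> pH \<one>\<^bsub>H\<^esub> c) = K.tl (\<lambda>u v. e (a \<otimes>\<^bsub>H\<^esub> i u) \<otimes> e (b \<otimes>\<^bsub>H\<^esub> i v \<otimes>\<^bsub>H\<^esub> c)) t"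
    and "E (pH a b \<otimes>\<^bsub>HH\<^esub> I t \<otimes>\<^bsub>HH\<^esub> pH c \<one>\<^bsub>H\<^esub>) = K.tl (\<lambda>u v. e (a \<otimes>\<^bsub>H\<^esub> i u \<otimes>\<^bsub>H\<^esub> c) \<otimes> e (b \<otimes>\<^bsub>H\<^esub> i v)) t"
    and "E (pH a \<one>\<^bsub>H\<^esub> \<otimes>\<^bsub>HH\<^esub> I t \<otimes>\<^bsub>HH\<^esub> pH b c) = K.tl (\<lambda>u v. e (a \<otimes>\<^bsub>H\<^esub> i u \<otimes>\<^bsub>H\<^esub> b) \<otimes> e (i v \<otimes>\<^bsub>H\<^esub> c)) t"
    and "E (pH \<one>\<^bsub>H\<^esub> a \<otimes>\<^bsub>HH\<^esub> I t \<otimes>\<^bsub>HH\<^esub> pH b c) = K.tl (\<lambda>u v. e (i u \<otimes>\<^bsub>H\<^esub> b) \<otimes> e (a \<otimes>\<^bsub>H\<^esub> i v \<otimes>\<^bsub>H\<^esub> c)) t"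
  by (subst expand, simp_all only: assms H.A.one_closed,
      rule tensor_lift_cong[OF mK mK K.mk K.product_bilinear[OF e_both e_both]], simp_all add: assms)+

lemma sandwich_linear:
  assumes "p \<in> carrier (tensor R H H)" "q \<in> carrier (tensor R H H)" "t \<in> carrier (tensor R H H)"
  shows "linear_map R (tensor R H H) (regular_module R) (\<lambda>S. E (p \<otimes>\<^bsub>HH\<^esub> (S \<otimes>\<^bsub>HH\<^esub> t) \<otimes>\<^bsub>HH\<^esub> q))"
    and "linear_map R (tensor R H H) (regular_module R) (\<lambda>S. E (p \<otimes>\<^bsub>HH\<^esub> (t \<otimes>\<^bsub>HH\<^esub> S) \<otimes>\<^bsub>HH\<^esub> q))"
proof -
  show "linear_map R (tensor R H H) (regular_module R) (\<lambda>S. E (p \<otimes>\<^bsub>HH\<^esub> (S \<otimes>\<^bsub>HH\<^esub> t) \<otimes>\<^bsub>HH\<^esub> q))"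
    using assms by (intro linear_map_compose[OF linear_map_compose[OF linear_map_compose[OF
      bilinear_left[OF bil] bilinear_right[OF bil]] bilinear_left[OF bil]] E_linear])
  show "linear_map R (tensor R H H) (regular_module R) (\<lambda>S. E (p \<otimes>\<^bsub>HH\<^esub> (t \<otimes>\<^bsub>HH\<^esub> S) \<otimes>\<^bsub>HH\<^esub> q))"
    using assms by (intro linear_map_compose[OF linear_map_compose[OF linear_map_compose[OF
      bilinear_right[OF bil] bilinear_right[OF bil]] bilinear_left[OF bil]] E_linear])
qed

lemma regroup:
  assumes "p \<in> carrier (tensor R H H)" "q \<in> carrier (tensor R H H)" "s \<in> carrier (tensor R H H)"
      "t \<in> carrier (tensor R H H)"
  shows "p \<otimes>\<^bsub>HH\<^esub> (s \<otimes>\<^bsub>HH\<^esub> t) \<otimes>\<^bsub>HH\<^esub> q = (p \<otimes>\<^bsub>HH\<^esub> s) \<otimes>\<^bsub>HH\<^esub> t \<otimes>\<^bsub>HH\<^esub> q"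
    and "p \<otimes>\<^bsub>HH\<^esub> (t \<otimes>\<^bsub>HH\<^esub> s) \<otimes>\<^bsub>HH\<^esub> q = p \<otimes>\<^bsub>HH\<^esub> t \<otimes>\<^bsub>HH\<^esub> (s \<otimes>\<^bsub>HH\<^esub> q)"
  using assms by (simp_all add: HH_assoc)

context
  fixes x z h S
  assumes x [simp]: "x \<in> carrier H" and z [simp]: "z \<in> carrier H" and h [simp]: "h \<in> carrier K"
    and S: "S \<in> carrier (tensor R H H)"
begin

text \<open>For S = a \<otimes> b, absorption is applied with g = e(x a i(-)), which obeys the law,
  and with f = e(b i(-) z). The factor h collected in f then moves to the left of z by
  multiplicativity of \<open>i\<close>.\<close>

lemma pairing_right: "T x z (S \<otimes>\<^bsub>HH\<^esub> I (comult K h)) = T x (i h \<otimes>\<^bsub>H\<^esub> z) (S \<otimes>\<^bsub>HH\<^esub> I (comult K \<one>\<^bsub>K\<^esub>))"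
  unfolding pairing_def
proof (rule tensor_ext[OF mH mH sandwich_linear(1) sandwich_linear(1) _ S])
  fix a b assume ab [simp]: "a \<in> carrier H" "b \<in> carrier H"
  have "K.tl (\<lambda>u v. e (x \<otimes>\<^bsub>H\<^esub> a \<otimes>\<^bsub>H\<^esub> i u) \<otimes> e (b \<otimes>\<^bsub>H\<^esub> i v \<otimes>\<^bsub>H\<^esub> z)) (comult K h) =
      K.tl (\<lambda>u v. e (x \<otimes>\<^bsub>H\<^esub> a \<otimes>\<^bsub>H\<^esub> i u) \<otimes> e (b \<otimes>\<^bsub>H\<^esub> i (v \<otimes>\<^bsub>K\<^esub> h) \<otimes>\<^bsub>H\<^esub> z)) (comult K \<one>\<^bsub>K\<^esub>)"
    by (rule K.absorb_right[OF e_right e_both h right]) simp_all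
  also have "\<dots> = K.tl (\<lambda>u v. e (x \<otimes>\<^bsub>H\<^esub> a \<otimes>\<^bsub>H\<^esub> i u) \<otimes> e (b \<otimes>\<^bsub>H\<^esub> i v \<otimes>\<^bsub>H\<^esub> (i h \<otimes>\<^bsub>H\<^esub> z))) (comult K \<one>\<^bsub>K\<^esub>)"
    by (rule tensor_lift_cong[OF mK mK K.mk K.product_bilinear[OF e_right e_both], symmetric])
      (simp_all add: algebra_hom_mult[OF hom] H.A.m_assoc)
  finally show "E (pH x \<one>\<^bsub>H\<^esub> \<otimes>\<^bsub>HH\<^esub> (pH a b \<otimes>\<^bsub>HH\<^esub> I (comult K h)) \<otimes>\<^bsub>HH\<^esub> pH \<one>\<^bsub>H\<^esub> z) =
    E (pH x \<one>\<^bsub>H\<^esub> \<otimes>\<^bsub>HH\<^esub> (pH a b \<otimes>\<^bsub>HH\<^esub> I (comult K \<one>\<^bsub>K\<^esub>)) \<otimes>\<^bsub>HH\<^esub> pH \<one>\<^bsub>H\<^esub> (i h \<otimes>\<^bsub>H\<^esub> z))"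
    by (simp add: regroup tensor_algebra_mult_pure[OF aH aH] expand_one)
qed simp_all

text \<open>In the twisted pairing z stands on the first leg, so h is absorbed there and the law is
  used for the functional on the second leg.\<close>

lemma twisted_pairing_right: "T' x z (S \<otimes>\<^bsub>HH\<^esub> I (comult K h)) = T' x (i h \<otimes>\<^bsub>H\<^esub> z) (S \<otimes>\<^bsub>HH\<^esub> I (comult K \<one>\<^bsub>K\<^esub>))"
  unfolding twisted_pairing_def
proof (rule tensor_ext[OF mH mH sandwich_linear(1) sandwich_linear(1) _ S])
  fix a b assume ab [simp]: "a \<in> carrier H" "b \<in> carrier H"
  have "K.tl (\<lambda>u v. e (a \<otimes>\<^bsub>H\<^esub> i u \<otimes>\<^bsub>H\<^esub> z) \<otimes> e (x \<otimes>\<^bsub>H\<^esub> b \<otimes>\<^bsub>H\<^esub> i v)) (comult K h) =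
      K.tl (\<lambda>u v. e (a \<otimes>\<^bsub>H\<^esub> i (u \<otimes>\<^bsub>K\<^esub> h) \<otimes>\<^bsub>H\<^esub> z) \<otimes> e (x \<otimes>\<^bsub>H\<^esub> b \<otimes>\<^bsub>H\<^esub> i v)) (comult K \<one>\<^bsub>K\<^esub>)"
    by (rule K.absorb_right'[OF e_right e_both h right']) simp_all
  also have "\<dots> = K.tl (\<lambda>u v. e (a \<otimes>\<^bsub>H\<^esub> i u \<otimes>\<^bsub>H\<^esub> (i h \<otimes>\<^bsub>H\<^esub> z)) \<otimes> e (x \<otimes>\<^bsub>H\<^esub> b \<otimes>\<^bsub>H\<^esub> i v)) (comult K \<one>\<^bsub>K\<^esub>)"
    by (rule tensor_lift_cong[OF mK mK K.mk K.product_bilinear[OF e_both e_right], symmetric])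
      (simp_all add: algebra_hom_mult[OF hom] H.A.m_assoc)
  finally show "E (pH \<one>\<^bsub>H\<^esub> x \<otimes>\<^bsub>HH\<^esub> (pH a b \<otimes>\<^bsub>HH\<^esub> I (comult K h)) \<otimes>\<^bsub>HH\<^esub> pH z \<one>\<^bsub>H\<^esub>) =
    E (pH \<one>\<^bsub>H\<^esub> x \<otimes>\<^bsub>HH\<^esub> (pH a b \<otimes>\<^bsub>HH\<^esub> I (comult K \<one>\<^bsub>K\<^esub>)) \<otimes>\<^bsub>HH\<^esub> pH (i h \<otimes>\<^bsub>H\<^esub> z) \<one>\<^bsub>H\<^esub>)"
    by (simp add: regroup tensor_algebra_mult_pure[OF aH aH] expand_one)
qed simp_all

text \<open>Now the law is obeyed by e(i(-) b z) on the second leg, and h is collected on the first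
  leg, next to x.\<close>

lemma pairing_left: "T x z (I (comult K h) \<otimes>\<^bsub>HH\<^esub> S) = T (x \<otimes>\<^bsub>H\<^esub> i h) z (I (comult K \<one>\<^bsub>K\<^esub>) \<otimes>\<^bsub>HH\<^esub> S)"
  unfolding pairing_def
proof (rule tensor_ext[OF mH mH sandwich_linear(2) sandwich_linear(2) _ S])
  fix a b assume ab [simp]: "a \<in> carrier H" "b \<in> carrier H"
  have "K.tl (\<lambda>u v. e (x \<otimes>\<^bsub>H\<^esub> i u \<otimes>\<^bsub>H\<^esub> a) \<otimes> e (i v \<otimes>\<^bsub>H\<^esub> (b \<otimes>\<^bsub>H\<^esub> z))) (comult K h) =
      K.tl (\<lambda>u v. e (x \<otimes>\<^bsub>H\<^esub> i (h \<otimes>\<^bsub>K\<^esub> u) \<otimes>\<^bsub>H\<^esub> a) \<otimes> e (i v \<otimes>\<^bsub>H\<^esub> (b \<otimes>\<^bsub>H\<^esub> z))) (comult K \<one>\<^bsub>K\<^esub>)"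
    by (rule K.absorb_left[OF e_left e_both h left]) simp_all
  also have "\<dots> = K.tl (\<lambda>u v. e (x \<otimes>\<^bsub>H\<^esub> i h \<otimes>\<^bsub>H\<^esub> i u \<otimes>\<^bsub>H\<^esub> a) \<otimes> e (i v \<otimes>\<^bsub>H\<^esub> (b \<otimes>\<^bsub>H\<^esub> z))) (comult K \<one>\<^bsub>K\<^esub>)"
    by (rule tensor_lift_cong[OF mK mK K.mk K.product_bilinear[OF e_both e_left], symmetric])
      (simp_all add: algebra_hom_mult[OF hom] H.A.m_assoc)
  finally show "E (pH x \<one>\<^bsub>H\<^esub> \<otimes>\<^bsub>HH\<^esub> (I (comult K h) \<otimes>\<^bsub>HH\<^esub> pH a b) \<otimes>\<^bsub>HH\<^esub> pH \<one>\<^bsub>H\<^esub> z) =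
    E (pH (x \<otimes>\<^bsub>H\<^esub> i h) \<one>\<^bsub>H\<^esub> \<otimes>\<^bsub>HH\<^esub> (I (comult K \<one>\<^bsub>K\<^esub>) \<otimes>\<^bsub>HH\<^esub> pH a b) \<otimes>\<^bsub>HH\<^esub> pH \<one>\<^bsub>H\<^esub> z)"
    by (simp add: regroup(2) tensor_algebra_mult_pure[OF aH aH] expand_one)
qed simp_all

lemma twisted_pairing_left: "T' x z (I (comult K h) \<otimes>\<^bsub>HH\<^esub> S) = T' (x \<otimes>\<^bsub>H\<^esub> i h) z (I (comult K \<one>\<^bsub>K\<^esub>) \<otimes>\<^bsub>HH\<^esub> S)"
  unfolding twisted_pairing_def
proof (rule tensor_ext[OF mH mH sandwich_linear(2) sandwich_linear(2) _ S])
  fix a b assume ab [simp]: "a \<in> carrier H" "b \<in> carrier H"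
  have "K.tl (\<lambda>u v. e (i u \<otimes>\<^bsub>H\<^esub> (a \<otimes>\<^bsub>H\<^esub> z)) \<otimes> e (x \<otimes>\<^bsub>H\<^esub> i v \<otimes>\<^bsub>H\<^esub> b)) (comult K h) =
      K.tl (\<lambda>u v. e (i u \<otimes>\<^bsub>H\<^esub> (a \<otimes>\<^bsub>H\<^esub> z)) \<otimes> e (x \<otimes>\<^bsub>H\<^esub> i (h \<otimes>\<^bsub>K\<^esub> v) \<otimes>\<^bsub>H\<^esub> b)) (comult K \<one>\<^bsub>K\<^esub>)"
    by (rule K.absorb_left'[OF e_left e_both h left']) simp_all
  also have "\<dots> = K.tl (\<lambda>u v. e (i u \<otimes>\<^bsub>H\<^esub> (a \<otimes>\<^bsub>H\<^esub> z)) \<otimes> e (x \<otimes>\<^bsub>H\<^esub> i h \<otimes>\<^bsub>H\<^esub> i v \<otimes>\<^bsub>H\<^esub> b)) (comult K \<one>\<^bsub>K\<^esub>)"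
    by (rule tensor_lift_cong[OF mK mK K.mk K.product_bilinear[OF e_left e_both], symmetric])
      (simp_all add: algebra_hom_mult[OF hom] H.A.m_assoc)
  finally show "E (pH \<one>\<^bsub>H\<^esub> x \<otimes>\<^bsub>HH\<^esub> (I (comult K h) \<otimes>\<^bsub>HH\<^esub> pH a b) \<otimes>\<^bsub>HH\<^esub> pH z \<one>\<^bsub>H\<^esub>) =
    E (pH \<one>\<^bsub>H\<^esub> (x \<otimes>\<^bsub>H\<^esub> i h) \<otimes>\<^bsub>HH\<^esub> (I (comult K \<one>\<^bsub>K\<^esub>) \<otimes>\<^bsub>HH\<^esub> pH a b) \<otimes>\<^bsub>HH\<^esub> pH z \<one>\<^bsub>H\<^esub>)"
    by (simp add: regroup(2) tensor_algebra_mult_pure[OF aH aH] expand_one)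
qed simp_all

end

end

section \<open>The weak bialgebra axioms for the weak wreath product\<close>

context weak_wreath_bialgebra
begin

abbreviation HHH where "HHH \<equiv> tensor_algebra R HH H"
abbreviation \<delta>A where "\<delta>A \<equiv> comult A \<one>\<^bsub>A\<^esub>"
abbreviation \<delta>B where "\<delta>B \<equiv> comult B \<one>\<^bsub>B\<^esub>"
abbreviation \<delta>H where "\<delta>H \<equiv> comult H \<one>\<^bsub>H\<^esub>"
abbreviation \<epsilon>H where "\<epsilon>H \<equiv> counit H"

lemma i_one [simp]: "iA \<one>\<^bsub>A\<^esub> = \<one>\<^bsub>H\<^esub>" "iB \<one>\<^bsub>B\<^esub> = \<one>\<^bsub>H\<^esub>"
  by (simp_all add: algebra_hom_one[OF iA_hom] algebra_hom_one[OF iB_hom])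

section \<open>The axioms on \<Delta>(1)\<close>

lemma delta_H: "\<delta>H = AA \<delta>A \<otimes>\<^bsub>HH\<^esub> BB \<delta>B" "\<delta>H = BB \<delta>B \<otimes>\<^bsub>HH\<^esub> AA \<delta>A"
  using comult_iA_iB[of "\<one>\<^bsub>A\<^esub>" "\<one>\<^bsub>B\<^esub>"] comult_iB_iA[of "\<one>\<^bsub>A\<^esub>" "\<one>\<^bsub>B\<^esub>"] by simp_all

lemma delta_A_commute:
  assumes "b \<in> carrier B"
  shows "AA \<delta>A \<otimes>\<^bsub>HH\<^esub> BB (comult B b) = BB (comult B b) \<otimes>\<^bsub>HH\<^esub> AA \<delta>A"
  using comult_iA_iB[of "\<one>\<^bsub>A\<^esub>" b] comult_iB_iA[of "\<one>\<^bsub>A\<^esub>" b] assms by simp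

definition l where "l t = pure R (tensor R H H) H t \<one>\<^bsub>H\<^esub>"
definition r where "r t = assoc_inv R H H H (pure R H (tensor R H H) \<one>\<^bsub>H\<^esub> t)"

lemma l_hom: "algebra_hom R HH HHH l" and r_hom: "algebra_hom R HH HHH r"
  unfolding l_def[abs_def] r_def[abs_def] by (rule tensor_cube_homs[OF H_algebra])+

lemmas l_closed [simp] = algebra_hom_closed[OF l_hom, simplified]
lemmas r_closed [simp] = algebra_hom_closed[OF r_hom, simplified]
lemmas mult_HHH = tensor_cube_mult[OF H_algebra]
lemmas HHH_bil = tensor_algebra_mult_bilinear[OF aHH H_algebra, simplified]
lemmas mult_HHH_closed [simp] = bilinear_closed[OF HHH_bil]
lemmas HHH_assoc = monoid.m_assoc[OF ring.axioms(2)[OF assoc_algebra_ring[OF aHHH]], simplified]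

definition A3 where "A3 = tensor_map R (tensor R H H) H AA iA"
definition B3 where "B3 = tensor_map R (tensor R H H) H BB iB"

lemmas mBB = KB.mHH

lemma B3_linear: "linear_map R (tensor R (tensor R B B) B) (tensor R (tensor R H H) H) B3"
  unfolding B3_def by (rule tensor_map_linear[OF mBB mB mHH mH BB_linear iB_linear])

lemmas B3_closed [simp] = linear_map_closed[OF B3_linear]

lemma B3_pure:
  "\<lbrakk>t \<in> carrier (tensor R B B); b \<in> carrier B\<rbrakk> \<Longrightarrow>
    B3 (pure R (tensor R B B) B t b) = pure R (tensor R H H) H (BB t) (iB b)"
  "\<lbrakk>t \<in> carrier (tensor R B B); b \<in> carrier B\<rbrakk> \<Longrightarrow>
    B3 (assoc_inv R B B B (pure R B (tensor R B B) b t)) = assoc_inv R H H H (pure R H (tensor R H H) (iB b) (BB t))"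
proof -
  show "\<lbrakk>t \<in> carrier (tensor R B B); b \<in> carrier B\<rbrakk> \<Longrightarrow>
      B3 (pure R (tensor R B B) B t b) = pure R (tensor R H H) H (BB t) (iB b)"
    by (simp add: B3_def tensor_map_pure[OF mBB mB mHH mH BB_linear iB_linear])
  assume t: "t \<in> carrier (tensor R B B)" and b: "b \<in> carrier B"
  have p: "pure R B (tensor R B B) b t \<in> carrier (tensor R B (tensor R B B))"
    by (rule pure_closed[OF mB mBB b t])
  show "B3 (assoc_inv R B B B (pure R B (tensor R B B) b t)) = assoc_inv R H H H (pure R H (tensor R H H) (iB b) (BB t))"
    using assoc_inv_natural[OF mB mB mB mH mH mH iB_linear iB_linear iB_linear p] t b
    by (simp add: B3_def tensor_map_pure[OF mB mBB mH mHH iB_linear BB_linear] flip: BB_def)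
qed

text \<open>For pure \<open>s\<close> the first two legs contain \<Delta>(b) with b in
  \<open>B\<close>, to which \<open>delta_A_commute\<close> applies; the third leg only meets a
  unit.\<close>

lemma l_commute:
  assumes "s \<in> carrier (tensor R B B)"
  shows "l (AA \<delta>A) \<otimes>\<^bsub>HHH\<^esub> B3 (KB.\<Delta>l s) = B3 (KB.\<Delta>l s) \<otimes>\<^bsub>HHH\<^esub> l (AA \<delta>A)"
  by (rule tensor_ext[OF mB mB linear_map_compose[OF linear_map_compose[OF KB.\<Delta>l_linear B3_linear] bilinear_right[OF HHH_bil]]
        linear_map_compose[OF linear_map_compose[OF KB.\<Delta>l_linear B3_linear] bilinear_left[OF HHH_bil]] _ assms])
    (simp_all add: KB.\<Delta>l_pure B3_pure l_def mult_HHH delta_A_commute pure_closed[OF mHH mH])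

lemma r_commute:
  assumes "s \<in> carrier (tensor R B B)"
  shows "r (AA \<delta>A) \<otimes>\<^bsub>HHH\<^esub> B3 (KB.\<Delta>r s) = B3 (KB.\<Delta>r s) \<otimes>\<^bsub>HHH\<^esub> r (AA \<delta>A)"
  by (rule tensor_ext[OF mB mB linear_map_compose[OF linear_map_compose[OF KB.\<Delta>r_linear B3_linear] bilinear_right[OF HHH_bil]]
        linear_map_compose[OF linear_map_compose[OF KB.\<Delta>r_linear B3_linear] bilinear_left[OF HHH_bil]] _ assms])
    (simp_all, simp add: KB.\<Delta>r_pure B3_pure r_def mult_HHH delta_A_commute)

lemma l_r_AA: "l (AA \<delta>A) \<otimes>\<^bsub>HHH\<^esub> r (AA \<delta>A) = A3 (KA.\<Delta>l \<delta>A)" "r (AA \<delta>A) \<otimes>\<^bsub>HHH\<^esub> l (AA \<delta>A) = A3 (KA.\<Delta>l \<delta>A)"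
  and l_r_BB: "l (BB \<delta>B) \<otimes>\<^bsub>HHH\<^esub> r (BB \<delta>B) = B3 (KB.\<Delta>l \<delta>B)" "r (BB \<delta>B) \<otimes>\<^bsub>HHH\<^esub> l (BB \<delta>B) = B3 (KB.\<Delta>l \<delta>B)"
  unfolding l_def r_def A3_def B3_def KA.\<Delta>l_def KB.\<Delta>l_def AA_def BB_def
  by (rule algebra_hom_comult_one[OF KA.weak_bialgebra_axioms H_algebra iA_hom]
      algebra_hom_comult_one[OF KB.weak_bialgebra_axioms H_algebra iB_hom])+

lemma comult_delta_H: "tensor_map R (tensor R H H) H \<Delta>H id \<delta>H = B3 (KB.\<Delta>l \<delta>B) \<otimes>\<^bsub>HHH\<^esub> A3 (KA.\<Delta>l \<delta>A)"
  unfolding delta_H(2) A3_def B3_def KA.\<Delta>l_def KB.\<Delta>l_def AA_def BB_def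
  by (rule comult_product_left[OF H_algebra mB mA iB_linear iA_linear KB.comult_linear KA.comult_linear comult_H_linear])
    (simp_all add: comult_iB_iA flip: AA_def BB_def)

lemma \<Delta>l_closed [simp]:
  "s \<in> carrier (tensor R A A) \<Longrightarrow> KA.\<Delta>l s \<in> carrier (tensor R (tensor R A A) A)"
  "t \<in> carrier (tensor R B B) \<Longrightarrow> KB.\<Delta>l t \<in> carrier (tensor R (tensor R B B) B)"
  "t \<in> carrier (tensor R B B) \<Longrightarrow> KB.\<Delta>r t \<in> carrier (tensor R (tensor R B B) B)"
  by (rule linear_map_closed[OF KA.\<Delta>l_linear] linear_map_closed[OF KB.\<Delta>l_linear]
      linear_map_closed[OF KB.\<Delta>r_linear]; assumption)+

text \<open>\<Delta>(1) is written with the A-part first in the left factor and with the B-part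
  first in the right factor. The B-parts are then adjacent and combine by the axiom of
  \<open>B\<close>; commuting the A-part past the result makes the A-parts adjacent.\<close>

lemma comult_one_left_H: "l \<delta>H \<otimes>\<^bsub>HHH\<^esub> r \<delta>H = tensor_map R (tensor R H H) H \<Delta>H id \<delta>H"
proof -
  have "l (AA \<delta>A \<otimes>\<^bsub>HH\<^esub> BB \<delta>B) \<otimes>\<^bsub>HHH\<^esub> r (BB \<delta>B \<otimes>\<^bsub>HH\<^esub> AA \<delta>A) =
      l (AA \<delta>A) \<otimes>\<^bsub>HHH\<^esub> (l (BB \<delta>B) \<otimes>\<^bsub>HHH\<^esub> r (BB \<delta>B)) \<otimes>\<^bsub>HHH\<^esub> r (AA \<delta>A)"
    by (simp add: algebra_hom_mult[OF l_hom] algebra_hom_mult[OF r_hom] HHH_assoc)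
  also have "\<dots> = B3 (KB.\<Delta>l \<delta>B) \<otimes>\<^bsub>HHH\<^esub> (l (AA \<delta>A) \<otimes>\<^bsub>HHH\<^esub> r (AA \<delta>A))"
    by (simp add: l_r_BB l_commute HHH_assoc)
  finally show ?thesis
    unfolding comult_delta_H l_r_AA by (simp flip: delta_H)
qed

lemma comult_one_right_H: "r \<delta>H \<otimes>\<^bsub>HHH\<^esub> l \<delta>H = tensor_map R (tensor R H H) H \<Delta>H id \<delta>H"
proof -
  have "r (AA \<delta>A \<otimes>\<^bsub>HH\<^esub> BB \<delta>B) \<otimes>\<^bsub>HHH\<^esub> l (BB \<delta>B \<otimes>\<^bsub>HH\<^esub> AA \<delta>A) =
      r (AA \<delta>A) \<otimes>\<^bsub>HHH\<^esub> (r (BB \<delta>B) \<otimes>\<^bsub>HHH\<^esub> l (BB \<delta>B)) \<otimes>\<^bsub>HHH\<^esub> l (AA \<delta>A)"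
    by (simp add: algebra_hom_mult[OF l_hom] algebra_hom_mult[OF r_hom] HHH_assoc)
  \<comment> \<open>The A-part to be moved now sits in the last two legs, so the B-term is first
    rewritten by coassociativity as (id \<otimes> \<Delta>)\<Delta>(1).\<close>
  also have "\<dots> = r (AA \<delta>A) \<otimes>\<^bsub>HHH\<^esub> B3 (KB.\<Delta>r \<delta>B) \<otimes>\<^bsub>HHH\<^esub> l (AA \<delta>A)"
    by (simp add: l_r_BB KB.\<Delta>l_comult)
  also have "\<dots> = B3 (KB.\<Delta>r \<delta>B) \<otimes>\<^bsub>HHH\<^esub> (r (AA \<delta>A) \<otimes>\<^bsub>HHH\<^esub> l (AA \<delta>A))"
    by (subst r_commute) (simp_all add: HHH_assoc)
  also have "\<dots> = B3 (KB.\<Delta>l \<delta>B) \<otimes>\<^bsub>HHH\<^esub> (r (AA \<delta>A) \<otimes>\<^bsub>HHH\<^esub> l (AA \<delta>A))"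
    by (simp add: KB.\<Delta>l_comult)
  finally show ?thesis
    unfolding comult_delta_H l_r_AA by (simp flip: delta_H)
qed

text \<open>\<open>iA c\<close> is the unit of \<open>H\<close> acted on by c, and the action on the
  right leg commutes with left multiplication; \<open>iB d\<close> is symmetric. This makes
  \<epsilon>(w iA(c)) a tensor product counit evaluated after an action on one leg.\<close>

lemma P_right_action: "\<lbrakk>w \<in> carrier H; c \<in> carrier A\<rbrakk> \<Longrightarrow> w \<otimes>\<^bsub>H\<^esub> iA c = P.ract c w"
  and P_left_action: "\<lbrakk>w \<in> carrier H; d \<in> carrier B\<rbrakk> \<Longrightarrow> iB d \<otimes>\<^bsub>H\<^esub> w = P.lact d w"
proof -
  assume w: "w \<in> carrier H"
  have one: "\<psi> (pY \<one>\<^bsub>A\<^esub> \<one>\<^bsub>B\<^esub>) = \<one>\<^bsub>H\<^esub>" by (simp add: H_one)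
  have 1: "\<one>\<^bsub>H\<^esub> \<in> carrier X" by (rule H_in_X) simp
  have w1: "P.wprod w \<one>\<^bsub>H\<^esub> = w" "P.wprod \<one>\<^bsub>H\<^esub> w = w"
    using w by (simp_all flip: H_mult)
  show "w \<otimes>\<^bsub>H\<^esub> iA c = P.ract c w" if c: "c \<in> carrier A"
  proof -
    have "iA c = P.ract c \<one>\<^bsub>H\<^esub>" unfolding P.iA_def P.psi_one_right[OF c] one ..
    then have "w \<otimes>\<^bsub>H\<^esub> iA c = P.wprod w (P.ract c \<one>\<^bsub>H\<^esub>)" using H_mult[OF w iA_in_H[OF c]] by simp
    then show ?thesis using w c by (simp add: P.wprod_ract H_in_X 1 w1)
  qed
  show "iB d \<otimes>\<^bsub>H\<^esub> w = P.lact d w" if d: "d \<in> carrier B"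
  proof -
    have "iB d = P.lact d \<one>\<^bsub>H\<^esub>" unfolding P.iB_def P.psi_one_left[OF d] one ..
    then have "iB d \<otimes>\<^bsub>H\<^esub> w = P.wprod (P.lact d \<one>\<^bsub>H\<^esub>) w" using H_mult[OF iB_in_H[OF d] w] by simp
    then show ?thesis using w d by (simp add: P.wprod_lact H_in_X 1 w1)
  qed
qed

text \<open>\<psi> intertwines the action of \<open>A\<close> on the left leg of A \<otimes> B with
  multiplication by \<open>iA\<close> in \<open>H\<close>, because \<psi>(a \<otimes> b) is
  \<open>iA a\<close> times \<open>iB b\<close>.\<close>

lemma psi_lact: "\<lbrakk>y \<in> carrier Y; c \<in> carrier A\<rbrakk> \<Longrightarrow> \<psi> (Q.lact c y) = iA c \<otimes>\<^bsub>H\<^esub> \<psi> y"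
  by (rule tensor_ext[OF mA mB linear_map_compose[OF Q.lact_linear psi_linear_H] linear_map_compose[OF psi_linear_H mult_H_right]])
    (simp_all add: algebra_hom_mult[OF iA_hom] HA.m_assoc flip: iA_iB)

lemma psi_ract: "\<lbrakk>y \<in> carrier Y; d \<in> carrier B\<rbrakk> \<Longrightarrow> \<psi> (Q.ract d y) = \<psi> y \<otimes>\<^bsub>H\<^esub> iB d"
  by (rule tensor_ext[OF mA mB linear_map_compose[OF Q.ract_linear psi_linear_H] linear_map_compose[OF psi_linear_H mult_H_left]])
    (simp_all add: algebra_hom_mult[OF iB_hom] HA.m_assoc flip: iA_iB)

lemma phi_H:
  assumes "w \<in> carrier H"
  shows "\<psi> (\<phi> w) = w" "Q.wprod (\<phi> w) Q.j = \<phi> w" "\<phi> w \<in> carrier Y"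
  using assms phi_psi_eq[of "\<phi> w"] by (simp_all add: in_H)

text \<open>In \<open>A \<otimes> B\<close> the left action of \<open>A\<close> and the right action of \<open>B\<close> on the product are visible; \<open>\<phi>\<close>
  transports them and, by the counit condition, the counit.\<close>

lemma Q_left_action: "\<lbrakk>w \<in> carrier H; c \<in> carrier A\<rbrakk> \<Longrightarrow> \<phi> (iA c \<otimes>\<^bsub>H\<^esub> w) = Q.lact c (\<phi> w)"
  using psi_lact[of "\<phi> w" c] phi_psi_eq[of "Q.lact c (\<phi> w)"]
  by (simp add: phi_H Q.lact_j del: psi_phi)

lemma Q_right_action: "\<lbrakk>w \<in> carrier H; d \<in> carrier B\<rbrakk> \<Longrightarrow> \<phi> (w \<otimes>\<^bsub>H\<^esub> iB d) = Q.ract d (\<phi> w)"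
  using psi_ract[of "\<phi> w" d] phi_psi_eq[of "Q.ract d (\<phi> w)"]
  by (simp add: phi_H Q.ract_j del: psi_phi)

lemma counit_H_phi: "w \<in> carrier H \<Longrightarrow> \<epsilon>H w = tensor_counit R A B (\<phi> w)"
  using comonoidal_counit[of "\<phi> w"] phi_H[of w] by (simp add: H_counit del: psi_phi)

lemmas actions = P.ract_def[symmetric] P.lact_def[symmetric] Q.ract_def[symmetric] Q.lact_def[symmetric]

sublocale IA: counit_hom R A H iA \<epsilon>H
proof (intro counit_hom.intro counit_hom_axioms.intro KA.weak_bialgebra_axioms H_algebra iA_hom counit_H_linear)
  fix w y assume w: "w \<in> carrier H" and y: "y \<in> carrier A"
  \<comment> \<open>Right multiplication by \<open>iA\<close> is an action on B \<otimes> A, so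
    \<open>w\<close> itself serves; left multiplication is one on A \<otimes> B, so there \<phi>(w)
    takes its place.\<close>
  note right = KA.counit_right_laws[OF cB H_in_X[OF w] _ y, of "\<lambda>c. \<epsilon>H (w \<otimes>\<^bsub>H\<^esub> iA c)", unfolded actions]
    and left = KA.counit_left_laws[OF cB phi_H(3)[OF w] _ y, of "\<lambda>c. \<epsilon>H (iA c \<otimes>\<^bsub>H\<^esub> w)", unfolded actions]
  show "\<epsilon>H (w \<otimes>\<^bsub>H\<^esub> iA y) = KA.tl (\<lambda>u v. \<epsilon>H (w \<otimes>\<^bsub>H\<^esub> iA u) \<otimes> counit A (v \<otimes>\<^bsub>A\<^esub> y)) \<delta>A"
    "\<epsilon>H (w \<otimes>\<^bsub>H\<^esub> iA y) = KA.tl (\<lambda>u v. counit A (u \<otimes>\<^bsub>A\<^esub> y) \<otimes> \<epsilon>H (w \<otimes>\<^bsub>H\<^esub> iA v)) \<delta>A"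
    by (rule right; simp add: H_counit P_right_action w)+
  show "\<epsilon>H (iA y \<otimes>\<^bsub>H\<^esub> w) = KA.tl (\<lambda>u v. counit A (y \<otimes>\<^bsub>A\<^esub> u) \<otimes> \<epsilon>H (iA v \<otimes>\<^bsub>H\<^esub> w)) \<delta>A"
    "\<epsilon>H (iA y \<otimes>\<^bsub>H\<^esub> w) = KA.tl (\<lambda>u v. \<epsilon>H (iA u \<otimes>\<^bsub>H\<^esub> w) \<otimes> counit A (y \<otimes>\<^bsub>A\<^esub> v)) \<delta>A"
    by (rule left; simp add: counit_H_phi Q_left_action w)+
qed

sublocale IB: counit_hom R B H iB \<epsilon>H
proof (intro counit_hom.intro counit_hom_axioms.intro KB.weak_bialgebra_axioms H_algebra iB_hom counit_H_linear)
  fix w y assume w: "w \<in> carrier H" and y: "y \<in> carrier B"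
  \<comment> \<open>For \<open>B\<close> the sides are exchanged: right multiplication is read off
    \<phi>(w), left multiplication off \<open>w\<close>.\<close>
  note right = KB.counit_right_laws[OF cA phi_H(3)[OF w] _ y, of "\<lambda>c. \<epsilon>H (w \<otimes>\<^bsub>H\<^esub> iB c)", unfolded actions]
    and left = KB.counit_left_laws[OF cA H_in_X[OF w] _ y, of "\<lambda>c. \<epsilon>H (iB c \<otimes>\<^bsub>H\<^esub> w)", unfolded actions]
  show "\<epsilon>H (w \<otimes>\<^bsub>H\<^esub> iB y) = KB.tl (\<lambda>u v. \<epsilon>H (w \<otimes>\<^bsub>H\<^esub> iB u) \<otimes> counit B (v \<otimes>\<^bsub>B\<^esub> y)) \<delta>B"
    "\<epsilon>H (w \<otimes>\<^bsub>H\<^esub> iB y) = KB.tl (\<lambda>u v. counit B (u \<otimes>\<^bsub>B\<^esub> y) \<otimes> \<epsilon>H (w \<otimes>\<^bsub>H\<^esub> iB v)) \<delta>B"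
    by (rule right; simp add: counit_H_phi Q_right_action w)+
  show "\<epsilon>H (iB y \<otimes>\<^bsub>H\<^esub> w) = KB.tl (\<lambda>u v. counit B (y \<otimes>\<^bsub>B\<^esub> u) \<otimes> \<epsilon>H (iB v \<otimes>\<^bsub>H\<^esub> w)) \<delta>B"
    "\<epsilon>H (iB y \<otimes>\<^bsub>H\<^esub> w) = KB.tl (\<lambda>u v. \<epsilon>H (iB u \<otimes>\<^bsub>H\<^esub> w) \<otimes> counit B (y \<otimes>\<^bsub>B\<^esub> v)) \<delta>B"
    by (rule left; simp add: H_counit P_left_action w)+
qed

text \<open>\<open>T\<close> is kept abstract so that the pairing and its twisted form share one
  argument. The spanning products in both orders give two evaluations of the same comultiplication,
  and their comparison yields the balance.\<close>

lemma balanced_functional: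
  fixes T :: "('r, 'b, 'a) tens \<Rightarrow> ('r, 'b, 'a) tens \<Rightarrow> ('r, ('r, 'b, 'a) tens, ('r, 'b, 'a) tens) tens \<Rightarrow> 'r"
  assumes A_right: "\<And>x z a S. \<lbrakk>x \<in> carrier H; z \<in> carrier H; a \<in> carrier A; S \<in> carrier (tensor R H H)\<rbrakk> \<Longrightarrow>
      T x z (S \<otimes>\<^bsub>HH\<^esub> AA (comult A a)) = T x (iA a \<otimes>\<^bsub>H\<^esub> z) (S \<otimes>\<^bsub>HH\<^esub> AA \<delta>A)"
    and A_left: "\<And>x z a S. \<lbrakk>x \<in> carrier H; z \<in> carrier H; a \<in> carrier A; S \<in> carrier (tensor R H H)\<rbrakk> \<Longrightarrow>
      T x z (AA (comult A a) \<otimes>\<^bsub>HH\<^esub> S) = T (x \<otimes>\<^bsub>H\<^esub> iA a) z (AA \<delta>A \<otimes>\<^bsub>HH\<^esub> S)"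
    and B_right: "\<And>x z b S. \<lbrakk>x \<in> carrier H; z \<in> carrier H; b \<in> carrier B; S \<in> carrier (tensor R H H)\<rbrakk> \<Longrightarrow>
      T x z (S \<otimes>\<^bsub>HH\<^esub> BB (comult B b)) = T x (iB b \<otimes>\<^bsub>H\<^esub> z) (S \<otimes>\<^bsub>HH\<^esub> BB \<delta>B)"
    and B_left: "\<And>x z b S. \<lbrakk>x \<in> carrier H; z \<in> carrier H; b \<in> carrier B; S \<in> carrier (tensor R H H)\<rbrakk> \<Longrightarrow>
      T x z (BB (comult B b) \<otimes>\<^bsub>HH\<^esub> S) = T (x \<otimes>\<^bsub>H\<^esub> iB b) z (BB \<delta>B \<otimes>\<^bsub>HH\<^esub> S)"
    and lin_x: "\<And>z S. \<lbrakk>z \<in> carrier H; S \<in> carrier (tensor R H H)\<rbrakk> \<Longrightarrow>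
      linear_map R H (regular_module R) (\<lambda>x. T x z S)"
    and lin_z: "\<And>x S. \<lbrakk>x \<in> carrier H; S \<in> carrier (tensor R H H)\<rbrakk> \<Longrightarrow>
      linear_map R H (regular_module R) (\<lambda>z. T x z S)"
    and lin_S: "\<And>x z. \<lbrakk>x \<in> carrier H; z \<in> carrier H\<rbrakk> \<Longrightarrow> linear_map R (tensor R H H) (regular_module R) (T x z)"
    and unit: "\<And>y. y \<in> carrier H \<Longrightarrow> T \<one>\<^bsub>H\<^esub> \<one>\<^bsub>H\<^esub> (\<Delta>H y) = \<epsilon>H y"
    and x: "x \<in> carrier H" and y: "y \<in> carrier H" and z: "z \<in> carrier H"
  shows "T x z (\<Delta>H y) = \<epsilon>H (x \<otimes>\<^bsub>H\<^esub> y \<otimes>\<^bsub>H\<^esub> z)"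
proof -
  have AB: "T x z (\<Delta>H (iA a \<otimes>\<^bsub>H\<^esub> iB b)) = T (x \<otimes>\<^bsub>H\<^esub> iA a) (iB b \<otimes>\<^bsub>H\<^esub> z) \<delta>H"
    and BA: "T x z (\<Delta>H (iB b \<otimes>\<^bsub>H\<^esub> iA a)) = T (x \<otimes>\<^bsub>H\<^esub> iB b) (iA a \<otimes>\<^bsub>H\<^esub> z) \<delta>H"
    if [simp]: "x \<in> carrier H" "z \<in> carrier H" "a \<in> carrier A" "b \<in> carrier B" for x z a b
  proof -
    have "T x z (AA (comult A a) \<otimes>\<^bsub>HH\<^esub> BB (comult B b)) = T x (iB b \<otimes>\<^bsub>H\<^esub> z) (AA (comult A a) \<otimes>\<^bsub>HH\<^esub> BB \<delta>B)"
      by (rule B_right) simp_all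
    also have "\<dots> = T (x \<otimes>\<^bsub>H\<^esub> iA a) (iB b \<otimes>\<^bsub>H\<^esub> z) (AA \<delta>A \<otimes>\<^bsub>HH\<^esub> BB \<delta>B)"
      by (rule A_left) simp_all
    finally show "T x z (\<Delta>H (iA a \<otimes>\<^bsub>H\<^esub> iB b)) = T (x \<otimes>\<^bsub>H\<^esub> iA a) (iB b \<otimes>\<^bsub>H\<^esub> z) \<delta>H"
      by (simp only: comult_iA_iB that delta_H(1))
    have "T x z (BB (comult B b) \<otimes>\<^bsub>HH\<^esub> AA (comult A a)) = T x (iA a \<otimes>\<^bsub>H\<^esub> z) (BB (comult B b) \<otimes>\<^bsub>HH\<^esub> AA \<delta>A)"
      by (rule A_right) simp_all
    also have "\<dots> = T (x \<otimes>\<^bsub>H\<^esub> iB b) (iA a \<otimes>\<^bsub>H\<^esub> z) (BB \<delta>B \<otimes>\<^bsub>HH\<^esub> AA \<delta>A)"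
      by (rule B_left) simp_all
    finally show "T x z (\<Delta>H (iB b \<otimes>\<^bsub>H\<^esub> iA a)) = T (x \<otimes>\<^bsub>H\<^esub> iB b) (iA a \<otimes>\<^bsub>H\<^esub> z) \<delta>H"
      by (simp only: comult_iB_iA that delta_H(2))
  qed
  \<comment> \<open>With b = 1 both orders of the product are just \<open>iA a\<close>; the two
    evaluations put it next to x and next to z.\<close>
  have balA: "T (x \<otimes>\<^bsub>H\<^esub> iA a) z \<delta>H = T x (iA a \<otimes>\<^bsub>H\<^esub> z) \<delta>H"
    if "x \<in> carrier H" "z \<in> carrier H" "a \<in> carrier A" for x z a
    using AB[OF that, of "\<one>\<^bsub>B\<^esub>"] BA[OF that, of "\<one>\<^bsub>B\<^esub>"] that by simp
  have balB: "T (x \<otimes>\<^bsub>H\<^esub> iB b) z \<delta>H = T x (iB b \<otimes>\<^bsub>H\<^esub> z) \<delta>H"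
    if "x \<in> carrier H" "z \<in> carrier H" "b \<in> carrier B" for x z b
    using AB[OF that(1,2) _ that(3), of "\<one>\<^bsub>A\<^esub>"] BA[OF that(1,2) _ that(3), of "\<one>\<^bsub>A\<^esub>"] that by simp
  have \<delta>: "\<delta>H \<in> carrier (tensor R H H)" by simp
  have left: "T x z (\<Delta>H y) = T (x \<otimes>\<^bsub>H\<^esub> y) z \<delta>H"
    and right: "T x z (\<Delta>H y) = T x (y \<otimes>\<^bsub>H\<^esub> z) \<delta>H"
    if x: "x \<in> carrier H" and z: "z \<in> carrier H" and y: "y \<in> carrier H" for x y z
  proof -
    note l = linear_map_compose[OF comult_H_linear lin_S[OF x z]]
    show "T x z (\<Delta>H y) = T (x \<otimes>\<^bsub>H\<^esub> y) z \<delta>H"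
      by (rule ext_iA_iB[OF l linear_map_compose[OF mult_H_right[OF x] lin_x[OF z \<delta>]] _ y])
        (simp add: AB x z balB[symmetric] HA.m_assoc)
    show "T x z (\<Delta>H y) = T x (y \<otimes>\<^bsub>H\<^esub> z) \<delta>H"
      by (rule ext_iA_iB[OF l linear_map_compose[OF mult_H_left[OF z] lin_z[OF x \<delta>]] _ y])
        (simp add: AB x z balA HA.m_assoc)
  qed
  have xy: "x \<otimes>\<^bsub>H\<^esub> y \<in> carrier H" "x \<otimes>\<^bsub>H\<^esub> y \<otimes>\<^bsub>H\<^esub> z \<in> carrier H" and one: "\<one>\<^bsub>H\<^esub> \<in> carrier H"
    using x y z by simp_all
  \<comment> \<open>Once y has moved into x, the argument z = z 1 is read as the element to be
    comultiplied, with 1 left in its place. Moving x y z back from the first argument then leaves 1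
    on both sides.\<close>
  have "T x z (\<Delta>H y) = T (x \<otimes>\<^bsub>H\<^esub> y) \<one>\<^bsub>H\<^esub> (\<Delta>H z)"
    unfolding left[OF x z y] right[OF xy(1) one z] using z by simp
  also have "\<dots> = T \<one>\<^bsub>H\<^esub> \<one>\<^bsub>H\<^esub> (\<Delta>H (x \<otimes>\<^bsub>H\<^esub> y \<otimes>\<^bsub>H\<^esub> z))"
    unfolding left[OF xy(1) one z] left[OF one one xy(2)] using xy by simp
  finally show ?thesis
    by (simp only: unit[OF xy(2)])
qed

lemmas HH_bil = tensor_algebra_mult_bilinear[OF H_algebra H_algebra]
lemmas HH_mult = tensor_algebra_mult_pure[OF H_algebra H_algebra]

lemmas HH_one = HHA.l_one[simplified] HHA.r_one[simplified]

lemma E_comult: "y \<in> carrier H \<Longrightarrow> IA.E (\<Delta>H y) = \<epsilon>H y"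
  by (simp add: tensor_lift_counit(1)[OF H_coalgebra counit_H_linear] counit_law_H)

lemma E_pure: "\<lbrakk>u \<in> carrier H; v \<in> carrier H\<rbrakk> \<Longrightarrow> IA.E (pH u v) = \<epsilon>H u \<otimes> \<epsilon>H v"
  by (rule KA.tl_pure[OF KA.product_bilinear[OF counit_H_linear counit_H_linear] mH mH])

lemma pairing_comult:
  assumes "x \<in> carrier H" "y \<in> carrier H" "z \<in> carrier H"
  shows "pairing R H \<epsilon>H x z (\<Delta>H y) = \<epsilon>H (x \<otimes>\<^bsub>H\<^esub> y \<otimes>\<^bsub>H\<^esub> z)"
proof (rule balanced_functional[OF _ _ _ _ _ _ _ _ assms])
  show "linear_map R H (regular_module R) (\<lambda>x. pairing R H \<epsilon>H x z S)"
    if "z \<in> carrier H" "S \<in> carrier (tensor R H H)" for z S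
    unfolding pairing_def using that
    by (intro linear_map_compose[OF linear_map_compose[OF linear_map_compose[OF pure_left_linear[OF mH mH]
        bilinear_left[OF HH_bil]] bilinear_left[OF HH_bil]] IA.E_linear]) simp_all
  show "linear_map R H (regular_module R) (\<lambda>z. pairing R H \<epsilon>H x z S)"
    if "x \<in> carrier H" "S \<in> carrier (tensor R H H)" for x S
    unfolding pairing_def using that
    by (intro linear_map_compose[OF linear_map_compose[OF pure_right_linear[OF mH mH]
        bilinear_right[OF HH_bil]] IA.E_linear]) simp_all
  show "linear_map R (tensor R H H) (regular_module R) (pairing R H \<epsilon>H x z)"
    if "x \<in> carrier H" "z \<in> carrier H" for x z
    unfolding pairing_def[abs_def] using that
    by (intro linear_map_compose[OF linear_map_compose[OF bilinear_right[OF HH_bil] bilinear_left[OF HH_bil]]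
        IA.E_linear]) simp_all
  show "pairing R H \<epsilon>H \<one>\<^bsub>H\<^esub> \<one>\<^bsub>H\<^esub> (\<Delta>H y) = \<epsilon>H y" if "y \<in> carrier H" for y
    using that by (simp add: pairing_def HH_one E_comult)
qed (unfold AA_def BB_def, (rule IA.pairing_right IA.pairing_left IB.pairing_right IB.pairing_left; assumption)+)

lemma twisted_pairing_comult:
  assumes "x \<in> carrier H" "y \<in> carrier H" "z \<in> carrier H"
  shows "twisted_pairing R H \<epsilon>H x z (\<Delta>H y) = \<epsilon>H (x \<otimes>\<^bsub>H\<^esub> y \<otimes>\<^bsub>H\<^esub> z)"
proof (rule balanced_functional[OF _ _ _ _ _ _ _ _ assms])
  show "linear_map R H (regular_module R) (\<lambda>x. twisted_pairing R H \<epsilon>H x z S)"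
    if "z \<in> carrier H" "S \<in> carrier (tensor R H H)" for z S
    unfolding twisted_pairing_def using that
    by (intro linear_map_compose[OF linear_map_compose[OF linear_map_compose[OF pure_right_linear[OF mH mH]
        bilinear_left[OF HH_bil]] bilinear_left[OF HH_bil]] IA.E_linear]) simp_all
  show "linear_map R H (regular_module R) (\<lambda>z. twisted_pairing R H \<epsilon>H x z S)"
    if "x \<in> carrier H" "S \<in> carrier (tensor R H H)" for x S
    unfolding twisted_pairing_def using that
    by (intro linear_map_compose[OF linear_map_compose[OF pure_left_linear[OF mH mH]
        bilinear_right[OF HH_bil]] IA.E_linear]) simp_all
  show "linear_map R (tensor R H H) (regular_module R) (twisted_pairing R H \<epsilon>H x z)"
    if "x \<in> carrier H" "z \<in> carrier H" for x z
    unfolding twisted_pairing_def[abs_def] using that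
    by (intro linear_map_compose[OF linear_map_compose[OF bilinear_right[OF HH_bil] bilinear_left[OF HH_bil]]
        IA.E_linear]) simp_all
  show "twisted_pairing R H \<epsilon>H \<one>\<^bsub>H\<^esub> \<one>\<^bsub>H\<^esub> (\<Delta>H y) = \<epsilon>H y" if "y \<in> carrier H" for y
    using that by (simp add: twisted_pairing_def HH_one E_comult)
qed (unfold AA_def BB_def, (rule IA.twisted_pairing_right IA.twisted_pairing_left IB.twisted_pairing_right IB.twisted_pairing_left; assumption)+)

text \<open>Identifies the Sweedler expressions of the counit axioms with the two pairings, by
  comparison on pure tensors in place of \<Delta>(y).\<close>

lemma counit_mult_H:
  assumes "x \<in> carrier H" "y \<in> carrier H" "z \<in> carrier H"
  shows "KA.tl (\<lambda>u v. \<epsilon>H (x \<otimes>\<^bsub>H\<^esub> u) \<otimes> \<epsilon>H (v \<otimes>\<^bsub>H\<^esub> z)) (\<Delta>H y) = \<epsilon>H (x \<otimes>\<^bsub>H\<^esub> y \<otimes>\<^bsub>H\<^esub> z)"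
    and "KA.tl (\<lambda>u v. \<epsilon>H (x \<otimes>\<^bsub>H\<^esub> v) \<otimes> \<epsilon>H (u \<otimes>\<^bsub>H\<^esub> z)) (\<Delta>H y) = \<epsilon>H (x \<otimes>\<^bsub>H\<^esub> y \<otimes>\<^bsub>H\<^esub> z)"
proof -
  note l = linear_map_compose[OF mult_H_right[OF assms(1)] counit_H_linear]
    and r = linear_map_compose[OF mult_H_left[OF assms(3)] counit_H_linear]
  note b1 = KA.product_bilinear[OF l r] and b2 = bilinear_flip[OF KA.product_bilinear[OF l r]]
  have p: "pH x \<one>\<^bsub>H\<^esub> \<in> carrier (tensor R H H)" "pH \<one>\<^bsub>H\<^esub> x \<in> carrier (tensor R H H)"
    "pH z \<one>\<^bsub>H\<^esub> \<in> carrier (tensor R H H)" "pH \<one>\<^bsub>H\<^esub> z \<in> carrier (tensor R H H)"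
    using assms by simp_all
  have "KA.tl (\<lambda>u v. \<epsilon>H (x \<otimes>\<^bsub>H\<^esub> u) \<otimes> \<epsilon>H (v \<otimes>\<^bsub>H\<^esub> z)) (\<Delta>H y) = pairing R H \<epsilon>H x z (\<Delta>H y)"
    unfolding pairing_def
    by (rule tensor_ext[OF mH mH KA.tl_linear[OF b1 mH mH] linear_map_compose[OF linear_map_compose[OF
          bilinear_right[OF HH_bil p(1)] bilinear_left[OF HH_bil p(4)]] IA.E_linear]])
      (simp_all add: KA.tl_pure[OF b1 mH mH] HH_mult E_pure assms)
  then show "KA.tl (\<lambda>u v. \<epsilon>H (x \<otimes>\<^bsub>H\<^esub> u) \<otimes> \<epsilon>H (v \<otimes>\<^bsub>H\<^esub> z)) (\<Delta>H y) = \<epsilon>H (x \<otimes>\<^bsub>H\<^esub> y \<otimes>\<^bsub>H\<^esub> z)"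
    by (simp add: pairing_comult assms)
  have "KA.tl (\<lambda>u v. \<epsilon>H (x \<otimes>\<^bsub>H\<^esub> v) \<otimes> \<epsilon>H (u \<otimes>\<^bsub>H\<^esub> z)) (\<Delta>H y) = twisted_pairing R H \<epsilon>H x z (\<Delta>H y)"
    unfolding twisted_pairing_def
    by (rule tensor_ext[OF mH mH KA.tl_linear[OF b2 mH mH] linear_map_compose[OF linear_map_compose[OF
          bilinear_right[OF HH_bil p(2)] bilinear_left[OF HH_bil p(3)]] IA.E_linear]])
      (simp_all add: KA.tl_pure[OF b2 mH mH] HH_mult E_pure assms A.m_comm)
  then show "KA.tl (\<lambda>u v. \<epsilon>H (x \<otimes>\<^bsub>H\<^esub> v) \<otimes> \<epsilon>H (u \<otimes>\<^bsub>H\<^esub> z)) (\<Delta>H y) = \<epsilon>H (x \<otimes>\<^bsub>H\<^esub> y \<otimes>\<^bsub>H\<^esub> z)"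
    by (simp add: twisted_pairing_comult assms)
qed

lemma H_weak_bialgebra: "weak_bialgebra R H"
proof (intro weak_bialgebra.intro weak_bialgebra_axioms.intro H_algebra H_coalgebra)
  show "pure R (tensor R H H) H \<delta>H \<one>\<^bsub>H\<^esub> \<otimes>\<^bsub>HHH\<^esub> assoc_inv R H H H (pure R H (tensor R H H) \<one>\<^bsub>H\<^esub> \<delta>H) =
      tensor_map R (tensor R H H) H \<Delta>H id \<delta>H"
    "assoc_inv R H H H (pure R H (tensor R H H) \<one>\<^bsub>H\<^esub> \<delta>H) \<otimes>\<^bsub>HHH\<^esub> pure R (tensor R H H) H \<delta>H \<one>\<^bsub>H\<^esub> =
      tensor_map R (tensor R H H) H \<Delta>H id \<delta>H"
    using comult_one_left_H comult_one_right_H by (simp_all add: l_def r_def)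
qed (simp_all add: comult_H_mult counit_mult_H)

end

theorem theorem4:
  fixes R :: "('r, 'q) ring_scheme"
    and A :: "('r, 'a, 'm) bialgebra_data_scheme"
    and B :: "('r, 'b, 'n) bialgebra_data_scheme"
    and \<psi> :: "('r, 'a, 'b) tens \<Rightarrow> ('r, 'b, 'a) tens"
    and \<phi> :: "('r, 'b, 'a) tens \<Rightarrow> ('r, 'a, 'b) tens"
  assumes "cring R"
    and "weak_bialgebra R A"
    and "weak_bialgebra R B"
    and "mutually_weak_inverse R A B \<psi> \<phi>"
    and "weakly_comonoidal R A B \<psi> \<phi>"
  shows "assoc_algebra R (weak_wreath_product R A B \<psi> \<phi>) \<and>
         coalgebra R (weak_wreath_product R A B \<psi> \<phi>) \<and>
         weak_bialgebra R (weak_wreath_product R A B \<psi> \<phi>)"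
proof -
  interpret A: weak_bialgebra R A by fact
  interpret B: weak_bialgebra R B by fact
  interpret W: weak_wreath_bialgebra R A B \<psi> \<phi>
    by unfold_locales fact+
  show ?thesis
    using W.H_algebra W.H_coalgebra W.H_weak_bialgebra unfolding W.H_def by blast
qed

end
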